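(* Let $A=(\mathbf a_0,\ldots,\mathbf a_n)$ be an integer $d\times(n+1)$ matrix with $d\le n+1$ and $\mathbb ZA=\mathbb Z^d$, let $\beta\in\mathbb C^d$, and let $A'=(\mathbf a_1,\ldots,\mathbf a_n)$. Let $b$ be the $b$-function (in the argument $x_0\partial_0$) of $M_A(\beta)$ along $x_0=0$. Then the set of roots of $b$ is, up to inclusion of non-negative integers, contained in the locus of intersection $(-\operatorname{qdeg}_{A'}(S_{A'}/\bar J_{A,0})+\beta)\cap\mathbb C\cdot\mathbf a_0$ (where $\varepsilon\in\mathbb C$ is identified with the point $\varepsilon\mathbf a_0$). The set of integers needed can be taken to be $\{0,\ldots,k-1\}$ for $k$ such that $J_{A,0}=\sum_{1\le i\le k}J_{A,0;i}$; that is, for such $k$ every root $\varepsilon$ of $b$ satisfies $\varepsilon\in\{0,\ldots,k-1\}$ or $\varepsilon\mathbf a_0\in-\operatorname{qdeg}_{A'}(S_{A'}/\bar J_{A,0})+\beta$. In two extreme cases one can be explicit: (1) if $\dim S_A-1=\dim S_{A'}$, then $b$ is linear, with root given by the intersection $(-\operatorname{qdeg}_A(S_{A'})+\beta)\cap\mathbb C\cdot\mathbf a_0$; (2) if $\mathbf a_0\in\mathbb R_{\ge0}A'$, then the roots of $b$ are integers in $\{0,1,\ldots,k-1\}$, where $k=\min\{t\in\mathbb N\mid t\ge1,\ t\cdot\mathbf a_0\in\mathbb NA'\}$.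
   Context: For an integer matrix $B$ with columns $\mathbf b_j$, $R_B$ is the polynomial ring over $\mathbb C$ in variables $\partial_j$ corresponding to the columns; $I_B\subseteq R_B$ is the toric ideal generated by all $\partial^{\mathbf v_+}-\partial^{\mathbf v_-}$ with $\mathbf v$ integral, $B\mathbf v=0$ ($(\mathbf v_\pm)_j=\max(0,\pm v_j)$); $S_B=R_B/I_B\cong\mathbb C[\mathbb NB]$. $D_A$ is the Weyl algebra in $x_0,\ldots,x_n$, $\partial_j=\partial/\partial x_j$. $H_A(\beta)\subseteq D_A$ is the left ideal generated by $I_A$ and $E_i-\beta_i$, $E_i=\sum_{j=0}^na_{i,j}x_j\partial_j$, $1\le i\le d$; $M_A(\beta)=D_A/H_A(\beta)$. The $b$-function of $M_A(\beta)$ along $x_0=0$ is the monic polynomial $b(s)$ of minimal degree with $b(x_0\partial_0)\in H_A(\beta)+V^1D_A$, where $V^iD_A$ is the $\mathbb C$-span of the monomials $x^{\mu}\partial^{\nu}$ with $\mu_0-\nu_0\ge i$. Grading: $\deg(\partial_j)=\mathbf a_j\in\mathbb Z^d$ (for both $A$ and $A'$). For a $\mathbb Z^d$-graded module $N$, $\operatorname{qdeg}(N)$ (written $\operatorname{qdeg}_A$ or $\operatorname{qdeg}_{A'}$) is the Zariski closure in $\mathbb C^d$ of the set of degrees of nonzero homogeneous elements of $N$. Via $\mathbb NA'\subseteq\mathbb NA$, regard $S_{A'}$ as a subring of $S_A$. For $k\in\mathbb N$ let $\bar J_{A,0;k}\subseteq S_{A'}$ be the $\mathbb C$-span of the monomials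 $\partial^{\mathbf u}$ with $u_0=0$ such that $\partial_0^k\cdot\partial^{\mathbf u}\in S_{A'}$ (product in $S_A$); it is a monomial ideal of $S_{A'}$. Let $J_{A,0;k}\subseteq R_{A'}$ be its preimage under $R_{A'}\to S_{A'}$. Put $J_{A,0}=\sum_{k\ge1}J_{A,0;k}$ and $\bar J_{A,0}=J_{A,0}/I_{A'}\subseteq S_{A'}$. *)

theory Defs
  imports
    "HOL-Analysis.Analysis"
    "HOL-Algebra.QuotRing"
    "HOL-Library.Poly_Mapping"
    "HOL-Library.Extended_Nat"
    "HOL-Computational_Algebra.Polynomial"
begin

text \<open>
  The columns of the matrix \<open>A\<close> and the variables \<open>x\<^sub>j\<close>, \<open>\<partial>\<^sub>j\<close> are indexed by a finite type \<open>'n\<close>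
  with \<open>n + 1\<close> elements, the rows by a finite type \<open>'d\<close> with \<open>d\<close> elements; the column index called
  0 on paper is an arbitrary element \<open>z :: 'n\<close>. A matrix consisting of some of the columns of
  \<open>A\<close> is represented by \<open>A\<close> and the set \<open>J\<close> of these columns: \<open>A\<close> itself is \<open>(A, UNIV)\<close>, and
  \<open>A'\<close> is \<open>(A, - {z})\<close>.
\<close>

type_synonym 'n mono = "'n \<Rightarrow>\<^sub>0 nat"
type_synonym 'n mpol = "'n mono \<Rightarrow>\<^sub>0 complex"

abbreviation mon :: "'n mono \<Rightarrow> 'n mpol" where
  "mon u \<equiv> Poly_Mapping.single u 1"

abbreviation cst :: "complex \<Rightarrow> 'n mpol" where
  "cst c \<equiv> Poly_Mapping.single 0 c"

definition mpol_ring :: "'n set \<Rightarrow> 'n mpol ring" where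
  "mpol_ring J = \<lparr>carrier = {f. \<forall>u\<in>Poly_Mapping.keys f. Poly_Mapping.keys u \<subseteq> J},
     mult = (*), one = 1, zero = 0, add = (+)\<rparr>"

lemma carrier_mpol_ring_mult:
  assumes "f \<in> carrier (mpol_ring J)" "g \<in> carrier (mpol_ring J)"
  shows "f * g \<in> carrier (mpol_ring J)"
proof -
  have "Poly_Mapping.keys u \<subseteq> J" if u: "u \<in> Poly_Mapping.keys (f * g)" for u
  proof -
    from u keys_mult[of f g] obtain a b where "a \<in> Poly_Mapping.keys f" "b \<in> Poly_Mapping.keys g"
      and "u = a + b" by auto
    then have "Poly_Mapping.keys u \<subseteq> Poly_Mapping.keys a \<union> Poly_Mapping.keys b"
      and "Poly_Mapping.keys a \<subseteq> J" and "Poly_Mapping.keys b \<subseteq> J"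
      using assms keys_add[of a b] by (auto simp: mpol_ring_def)
    then show ?thesis by blast
  qed
  then show ?thesis by (simp add: mpol_ring_def)
qed

lemma cring_mpol_ring: "cring (mpol_ring J)"
proof (rule cringI)
  show "abelian_group (mpol_ring J)"
  proof (rule abelian_groupI)
    fix f g assume "f \<in> carrier (mpol_ring J)" "g \<in> carrier (mpol_ring J)"
    then show "f \<oplus>\<^bsub>mpol_ring J\<^esub> g \<in> carrier (mpol_ring J)"
      using keys_add[of f g] by (auto simp: mpol_ring_def)
  next
    fix f assume "f \<in> carrier (mpol_ring J)"
    then have "- f \<in> carrier (mpol_ring J)" "- f \<oplus>\<^bsub>mpol_ring J\<^esub> f = \<zero>\<^bsub>mpol_ring J\<^esub>"
      by (auto simp: mpol_ring_def in_keys_iff)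
    then show "\<exists>g\<in>carrier (mpol_ring J). g \<oplus>\<^bsub>mpol_ring J\<^esub> f = \<zero>\<^bsub>mpol_ring J\<^esub>"
      by blast
  qed (simp_all add: mpol_ring_def add.commute add.left_commute)
  show "comm_monoid (mpol_ring J)"
  proof (rule comm_monoidI)
    fix f g assume "f \<in> carrier (mpol_ring J)" "g \<in> carrier (mpol_ring J)"
    then have "f * g \<in> carrier (mpol_ring J)" by (rule carrier_mpol_ring_mult)
    then show "f \<otimes>\<^bsub>mpol_ring J\<^esub> g \<in> carrier (mpol_ring J)" by (simp add: mpol_ring_def)
  qed (simp_all add: mpol_ring_def mult.commute mult.left_commute)
qed (simp add: mpol_ring_def distrib_right)

definition mpol_eval :: "'d::finite mpol \<Rightarrow> complex ^ 'd \<Rightarrow> complex" where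
  "mpol_eval f p = (\<Sum>u\<in>Poly_Mapping.keys f.
     Poly_Mapping.lookup f u * (\<Prod>i\<in>UNIV. (p $ i) ^ Poly_Mapping.lookup u i))"

definition vec_of_int :: "int ^ 'd::finite \<Rightarrow> 'a::ring_1 ^ 'd" where
  "vec_of_int v = (\<chi> i. of_int (v $ i))"

definition zariski_closed :: "(complex ^ 'd::finite) set \<Rightarrow> bool" where
  "zariski_closed Z \<longleftrightarrow> (\<exists>F. Z = {p. \<forall>f\<in>F. mpol_eval f p = 0})"

definition zariski_closure :: "(complex ^ 'd::finite) set \<Rightarrow> (complex ^ 'd) set" where
  "zariski_closure X = zariski_closed hull X"

definition krull_dim :: "('a, 'm) ring_scheme \<Rightarrow> enat" where
  "krull_dim R = Sup {enat m | m.
     \<exists>P. (\<forall>i\<le>m. primeideal (P i) R) \<and> (\<forall>i<m. P i \<subset> P (Suc i))}"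

definition pos_part :: "int ^ 'n::finite \<Rightarrow> 'n mono" where
  "pos_part v = Abs_poly_mapping (\<lambda>j. nat (v $ j))"

definition toric_ideal :: "int ^ 'n::finite ^ 'd::finite \<Rightarrow> 'n set \<Rightarrow> 'n mpol set" where
  "toric_ideal A J = Idl\<^bsub>mpol_ring J\<^esub>
     {mon (pos_part v) - mon (pos_part (- v)) | v. A *v v = 0 \<and> (\<forall>j. j \<notin> J \<longrightarrow> v $ j = 0)}"

lemma ideal_toric_ideal: "ideal (toric_ideal A J) (mpol_ring J)"
proof -
  interpret cring "mpol_ring J" by (rule cring_mpol_ring)
  have keys_pos: "Poly_Mapping.keys (pos_part v) \<subseteq> J" if "\<forall>j. j \<notin> J \<longrightarrow> v $ j = 0" for v :: "int ^ 'a"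
    using that by (force simp: pos_part_def in_keys_iff)
  have "mon (pos_part v) - mon (pos_part (- v)) \<in> carrier (mpol_ring J)"
    if "\<forall>j. j \<notin> J \<longrightarrow> v $ j = 0" for v :: "int ^ 'a"
  proof -
    have "Poly_Mapping.keys (mon (pos_part v) - mon (pos_part (- v)) :: 'a mpol)
        \<subseteq> {pos_part v, pos_part (- v)}"
      by (auto simp: in_keys_iff lookup_minus lookup_single when_def split: if_splits)
    then show ?thesis
      using keys_pos[of v] keys_pos[of "- v"] that by (auto simp: mpol_ring_def)
  qed
  then show ?thesis
    unfolding toric_ideal_def by (intro genideal_ideal) auto
qed

definition toric_ring :: "int ^ 'n::finite ^ 'd::finite \<Rightarrow> 'n set \<Rightarrow> 'n mpol set ring" where
  "toric_ring A J = mpol_ring J Quot toric_ideal A J"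

definition toric_class ::
  "int ^ 'n::finite ^ 'd::finite \<Rightarrow> 'n set \<Rightarrow> 'n mpol \<Rightarrow> 'n mpol set" where
  "toric_class A J f = toric_ideal A J +>\<^bsub>mpol_ring J\<^esub> f"

definition mono_degree :: "int ^ 'n::finite ^ 'd::finite \<Rightarrow> 'n mono \<Rightarrow> int ^ 'd" where
  "mono_degree A u = (\<Sum>j\<in>UNIV. int (Poly_Mapping.lookup u j) *s column j A)"

definition semigroup_of :: "int ^ 'n::finite ^ 'd::finite \<Rightarrow> 'n set \<Rightarrow> (int ^ 'd) set" where
  "semigroup_of A J = mono_degree A ` {u. Poly_Mapping.keys u \<subseteq> J}"

definition real_cone :: "int ^ 'n::finite ^ 'd::finite \<Rightarrow> 'n set \<Rightarrow> (real ^ 'd) set" where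
  "real_cone A J = {\<Sum>j\<in>J. c j *\<^sub>R vec_of_int (column j A) | c. \<forall>j\<in>J. c j \<ge> 0}"

text \<open>A graded module enters \<open>qdeg\<close> through its family of homogeneous components and its zero.\<close>

definition qdeg :: "(int ^ 'd::finite \<Rightarrow> 'm set) \<Rightarrow> 'm \<Rightarrow> (complex ^ 'd) set" where
  "qdeg N zeroN = zariski_closure {vec_of_int \<alpha> | \<alpha>. \<exists>y\<in>N \<alpha>. y \<noteq> zeroN}"

definition toric_component ::
  "int ^ 'n::finite ^ 'd::finite \<Rightarrow> 'n set \<Rightarrow> int ^ 'd \<Rightarrow> 'n mpol set set" where
  "toric_component A J \<alpha> = toric_class A J `
     {f \<in> carrier (mpol_ring J). \<forall>u\<in>Poly_Mapping.keys f. mono_degree A u = \<alpha>}"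

definition qdeg_toric ::
  "int ^ 'n::finite ^ 'd::finite \<Rightarrow> 'n set \<Rightarrow> (complex ^ 'd) set" where
  "qdeg_toric A J = qdeg (toric_component A J) \<zero>\<^bsub>toric_ring A J\<^esub>"

text \<open>The quasi-degrees of the quotient of the toric ring by a homogeneous ideal \<open>K\<close>.\<close>

definition qdeg_toric_quot ::
  "int ^ 'n::finite ^ 'd::finite \<Rightarrow> 'n set \<Rightarrow> 'n mpol set set \<Rightarrow> (complex ^ 'd) set" where
  "qdeg_toric_quot A J K =
     qdeg (\<lambda>\<alpha>. (\<lambda>y. K +>\<^bsub>toric_ring A J\<^esub> y) ` toric_component A J \<alpha>)
       \<zero>\<^bsub>toric_ring A J Quot K\<^esub>"

text \<open>
  The toric ring of \<open>A'\<close> is a subring of the toric ring of \<open>A\<close> via the map induced by the inclusion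
  of polynomial rings; this is its image.
\<close>

definition toric_subring :: "int ^ 'n::finite ^ 'd::finite \<Rightarrow> 'n \<Rightarrow> 'n mpol set set" where
  "toric_subring A z = toric_class A UNIV ` carrier (mpol_ring (- {z}))"

definition J_bar_k :: "int ^ 'n::finite ^ 'd::finite \<Rightarrow> 'n \<Rightarrow> nat \<Rightarrow> 'n mpol set set" where
  "J_bar_k A z k = toric_class A (- {z}) `
     {f. \<forall>u\<in>Poly_Mapping.keys f. Poly_Mapping.lookup u z = 0 \<and>
        toric_class A UNIV (mon (Poly_Mapping.single z 1)) [^]\<^bsub>toric_ring A UNIV\<^esub> k
          \<otimes>\<^bsub>toric_ring A UNIV\<^esub> toric_class A UNIV (mon u) \<in> toric_subring A z}"

definition J_k :: "int ^ 'n::finite ^ 'd::finite \<Rightarrow> 'n \<Rightarrow> nat \<Rightarrow> 'n mpol set" where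
  "J_k A z k = {f \<in> carrier (mpol_ring (- {z})). toric_class A (- {z}) f \<in> J_bar_k A z k}"

text \<open>A sum of ideals is the ideal generated by their union.\<close>

definition J_sum :: "int ^ 'n::finite ^ 'd::finite \<Rightarrow> 'n \<Rightarrow> nat set \<Rightarrow> 'n mpol set" where
  "J_sum A z K = Idl\<^bsub>mpol_ring (- {z})\<^esub> (\<Union>k\<in>K. J_k A z k)"

definition J_ideal :: "int ^ 'n::finite ^ 'd::finite \<Rightarrow> 'n \<Rightarrow> 'n mpol set" where
  "J_ideal A z = J_sum A z {1..}"

definition J_bar :: "int ^ 'n::finite ^ 'd::finite \<Rightarrow> 'n \<Rightarrow> 'n mpol set set" where
  "J_bar A z = toric_class A (- {z}) ` J_ideal A z"

text \<open>Elements of the Weyl algebra are represented as differential operators on polynomials.\<close>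

type_synonym 'n oper = "'n mpol \<Rightarrow> 'n mpol"

definition pdiff :: "'n \<Rightarrow> 'n oper" where
  "pdiff j f = (\<Sum>u\<in>Poly_Mapping.keys f. Poly_Mapping.single (u - Poly_Mapping.single j 1)
     (of_nat (Poly_Mapping.lookup u j) * Poly_Mapping.lookup f u))"

definition xmul :: "'n \<Rightarrow> 'n oper" where
  "xmul j f = mon (Poly_Mapping.single j 1) * f"

inductive_set weyl :: "'n oper set" where
  const: "(\<lambda>f. cst c * f) \<in> weyl"
| var: "xmul j \<in> weyl"
| diff: "pdiff j \<in> weyl"
| add: "P \<in> weyl \<Longrightarrow> Q \<in> weyl \<Longrightarrow> (\<lambda>f. P f + Q f) \<in> weyl"
| comp: "P \<in> weyl \<Longrightarrow> Q \<in> weyl \<Longrightarrow> P \<circ> Q \<in> weyl"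

inductive_set left_ideal :: "'n oper set \<Rightarrow> 'n oper set" for G where
  zero: "(\<lambda>f. 0) \<in> left_ideal G"
| gen: "P \<in> weyl \<Longrightarrow> g \<in> G \<Longrightarrow> P \<circ> g \<in> left_ideal G"
| add: "P \<in> left_ideal G \<Longrightarrow> Q \<in> left_ideal G \<Longrightarrow> (\<lambda>f. P f + Q f) \<in> left_ideal G"

text \<open>
  \<open>\<partial>\<^sup>u\<close> as the composition of the powers of the \<open>\<partial>\<^sub>j\<close>; the order is irrelevant, as shown in
  \<open>mono_diff_add\<close> and \<open>mono_diff_single\<close> below.
\<close>

lemma lookup_pdiff:
  "Poly_Mapping.lookup (pdiff j f) m =
     of_nat (Poly_Mapping.lookup m j + 1) * Poly_Mapping.lookup f (m + Poly_Mapping.single j 1)"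
proof -
  let ?e = "Poly_Mapping.single j 1 :: 'a mono"
  have *: "Poly_Mapping.lookup (Poly_Mapping.single (u - ?e)
        (of_nat (Poly_Mapping.lookup u j) * Poly_Mapping.lookup f u)) m =
      (if u = m + ?e then of_nat (Poly_Mapping.lookup m j + 1) * Poly_Mapping.lookup f u else 0)" for u
  proof (cases "Poly_Mapping.lookup u j = 0")
    case True
    then show ?thesis by (auto simp: lookup_add lookup_single)
  next
    case False
    then have "(u - ?e) + ?e = u"
      by (intro poly_mapping_eqI) (auto simp: lookup_add lookup_minus lookup_single when_def)
    then have "u - ?e = m \<longleftrightarrow> u = m + ?e"
      by (metis add_diff_cancel_right')
    then show ?thesis by (auto simp: lookup_single lookup_add when_def)
  qed
  show ?thesis
    unfolding pdiff_def lookup_sum * by (simp add: in_keys_iff)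
qed

lemma pdiff_add: "pdiff j (f + g) = pdiff j f + pdiff j g"
  by (intro poly_mapping_eqI) (simp add: lookup_pdiff lookup_add algebra_simps)

lemma pdiff_commute: "pdiff i \<circ> pdiff j = pdiff j \<circ> pdiff i"
  by (intro ext poly_mapping_eqI)
    (auto simp: lookup_pdiff lookup_add lookup_single when_def ac_simps)

lemma funpow_comm:
  fixes p q :: "'a \<Rightarrow> 'a"
  assumes "p \<circ> q = q \<circ> p"
  shows "(p ^^ a) \<circ> (q ^^ b) = (q ^^ b) \<circ> (p ^^ a)"
proof -
  have 1: "(p ^^ a) \<circ> q = q \<circ> (p ^^ a)" for a
    by (induction a) (use assms in \<open>auto simp: fun_eq_iff\<close>)
  show ?thesis
    by (induction b) (use 1 in \<open>auto simp: fun_eq_iff\<close>)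
qed

lemma pdiff_fold:
  "comp_fun_commute (\<lambda>j P. (pdiff j ^^ r j) \<circ> P)"
proof
  show "(\<lambda>P. (pdiff j ^^ r j) \<circ> P) \<circ> (\<lambda>P. (pdiff i ^^ r i) \<circ> P) =
      (\<lambda>P. (pdiff i ^^ r i) \<circ> P) \<circ> (\<lambda>P. (pdiff j ^^ r j) \<circ> P)" for i j
    using funpow_comm[OF pdiff_commute, of "r i" i "r j" j] by (simp add: fun_eq_iff)
qed

lemma pdiff_fold_insert:
  assumes "finite L" "j \<notin> L"
  shows "Finite_Set.fold (\<lambda>j P. (pdiff j ^^ r j) \<circ> P) id (insert j L) =
    (pdiff j ^^ r j) \<circ> Finite_Set.fold (\<lambda>j P. (pdiff j ^^ r j) \<circ> P) id L"
proof -
  interpret comp_fun_commute "\<lambda>j P. (pdiff j ^^ r j) \<circ> P"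
    by (rule pdiff_fold)
  show ?thesis using assms by (rule fold_insert)
qed

definition mono_diff :: "'n mono \<Rightarrow> 'n oper" where
  "mono_diff u = Finite_Set.fold (\<lambda>j P. (pdiff j ^^ Poly_Mapping.lookup u j) \<circ> P) id
     (Poly_Mapping.keys u)"

lemma mono_diff_superset:
  assumes "finite K" "Poly_Mapping.keys u \<subseteq> K"
  shows "mono_diff u =
    Finite_Set.fold (\<lambda>j P. (pdiff j ^^ Poly_Mapping.lookup u j) \<circ> P) id K"
proof -
  have "Finite_Set.fold (\<lambda>j P. (pdiff j ^^ Poly_Mapping.lookup u j) \<circ> P) id
      (Poly_Mapping.keys u \<union> L) = mono_diff u"
    if "finite L" "L \<inter> Poly_Mapping.keys u = {}" for L
    using that
  proof (induction L)
    case empty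
    show ?case by (simp only: Un_empty_right mono_diff_def)
  next
    case (insert j L)
    have "finite (Poly_Mapping.keys u \<union> L)" "j \<notin> Poly_Mapping.keys u \<union> L"
      using insert by auto
    moreover have "(pdiff j ^^ Poly_Mapping.lookup u j) \<circ> mono_diff u = mono_diff u"
      using insert by (auto simp: in_keys_iff)
    moreover have "Finite_Set.fold (\<lambda>j P. (pdiff j ^^ Poly_Mapping.lookup u j) \<circ> P) id
        (Poly_Mapping.keys u \<union> L) = mono_diff u"
      using insert by blast
    ultimately show ?case
      unfolding Un_insert_right by (subst pdiff_fold_insert) (assumption | simp only:)+
  qed
  from this[of "K - Poly_Mapping.keys u"]
  have "Finite_Set.fold (\<lambda>j P. (pdiff j ^^ Poly_Mapping.lookup u j) \<circ> P) id
      (Poly_Mapping.keys u \<union> (K - Poly_Mapping.keys u)) = mono_diff u"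
    using assms by blast
  moreover have "Poly_Mapping.keys u \<union> (K - Poly_Mapping.keys u) = K"
    using assms by blast
  ultimately show ?thesis by (simp only:)
qed

lemma mono_diff_add: "mono_diff (u + v) = mono_diff u \<circ> mono_diff v"
proof -
  define K where "K = Poly_Mapping.keys u \<union> Poly_Mapping.keys v"
  define F where "F r = Finite_Set.fold (\<lambda>j P. (pdiff j ^^ r j) \<circ> P) id" for r :: "'a \<Rightarrow> nat"
  have F_empty: "F r {} = id" for r
    by (simp add: F_def)
  have F_insert: "F r (insert j L) = (pdiff j ^^ r j) \<circ> F r L" if "finite L" "j \<notin> L" for r j L
    unfolding F_def by (rule pdiff_fold_insert[OF that])
  have comm: "(pdiff j ^^ m) \<circ> F r L = F r L \<circ> (pdiff j ^^ m)" if "finite L" for j m r L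
    using that
  proof (induction L)
    case empty
    then show ?case by (simp add: F_empty)
  next
    case (insert i L)
    then show ?case
      using funpow_comm[OF pdiff_commute, of m j "r i" i]
      by (simp add: F_insert fun_eq_iff)
  qed
  have "F (\<lambda>j. r j + s j) L = F r L \<circ> F s L" if "finite L" for r s L
    using that
  proof (induction L)
    case empty
    then show ?case by (simp add: F_empty)
  next
    case (insert i L)
    then show ?case
      using comm[of L "s i" i r]
      by (simp add: F_insert funpow_add fun_eq_iff)
  qed
  moreover have "finite K"
    by (simp add: K_def)
  moreover have "mono_diff w = F (Poly_Mapping.lookup w) K" if "Poly_Mapping.keys w \<subseteq> K" for w
    unfolding F_def using that by (intro mono_diff_superset \<open>finite K\<close>)
  moreover have "Poly_Mapping.lookup (u + v) =
      (\<lambda>j. Poly_Mapping.lookup u j + Poly_Mapping.lookup v j)"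
    by (simp add: fun_eq_iff lookup_add)
  moreover have "Poly_Mapping.keys (u + v) \<subseteq> K"
    unfolding K_def by (rule keys_add)
  ultimately show ?thesis
    by (simp add: K_def)
qed

lemma mono_diff_single: "mono_diff (Poly_Mapping.single j r) = pdiff j ^^ r"
proof -
  have "mono_diff (Poly_Mapping.single j r) = Finite_Set.fold
      (\<lambda>i P. (pdiff i ^^ Poly_Mapping.lookup (Poly_Mapping.single j r) i) \<circ> P) id {j}"
    by (rule mono_diff_superset) auto
  also have "\<dots> = pdiff j ^^ r"
    by (subst pdiff_fold_insert) auto
  finally show ?thesis .
qed

definition poly_diff :: "'n mpol \<Rightarrow> 'n oper" where
  "poly_diff f g =
     (\<Sum>u\<in>Poly_Mapping.keys f. cst (Poly_Mapping.lookup f u) * mono_diff u g)"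

definition normal_form :: "('n mono \<times> 'n mono \<Rightarrow>\<^sub>0 complex) \<Rightarrow> 'n oper" where
  "normal_form p f = (\<Sum>(\<mu>, \<nu>)\<in>Poly_Mapping.keys p.
     cst (Poly_Mapping.lookup p (\<mu>, \<nu>)) * (mon \<mu> * mono_diff \<nu> f))"

definition V_filtration :: "'n \<Rightarrow> int \<Rightarrow> 'n oper set" where
  "V_filtration z i = normal_form ` {p. \<forall>(\<mu>, \<nu>)\<in>Poly_Mapping.keys p.
     int (Poly_Mapping.lookup \<mu> z) - int (Poly_Mapping.lookup \<nu> z) \<ge> i}"

definition euler :: "int ^ 'n::finite ^ 'd::finite \<Rightarrow> 'd \<Rightarrow> 'n oper" where
  "euler A i f = (\<Sum>j\<in>UNIV. cst (of_int (A $ i $ j)) * xmul j (pdiff j f))"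

definition hyp_ideal ::
  "int ^ 'n::finite ^ 'd::finite \<Rightarrow> complex ^ 'd \<Rightarrow> 'n oper set" where
  "hyp_ideal A \<beta> = left_ideal
     (poly_diff ` toric_ideal A UNIV \<union> {\<lambda>f. euler A i f - cst (\<beta> $ i) * f | i. True})"

definition oper_poly :: "complex poly \<Rightarrow> 'n oper \<Rightarrow> 'n oper" where
  "oper_poly b T f = (\<Sum>i\<le>degree b. cst (coeff b i) * (T ^^ i) f)"

definition b_ideal ::
  "int ^ 'n::finite ^ 'd::finite \<Rightarrow> complex ^ 'd \<Rightarrow> 'n \<Rightarrow> complex poly set" where
  "b_ideal A \<beta> z = {b. \<exists>P\<in>hyp_ideal A \<beta>. \<exists>Q\<in>V_filtration z 1.
     oper_poly b (xmul z \<circ> pdiff z) = (\<lambda>f. P f + Q f)}"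

definition is_b_function ::
  "int ^ 'n::finite ^ 'd::finite \<Rightarrow> complex ^ 'd \<Rightarrow> 'n \<Rightarrow> complex poly \<Rightarrow> bool" where
  "is_b_function A \<beta> z b \<longleftrightarrow> lead_coeff b = 1 \<and> b \<in> b_ideal A \<beta> z \<and>
     (\<forall>q \<in> b_ideal A \<beta> z. lead_coeff q = 1 \<longrightarrow> degree b \<le> degree q)"

text \<open>The intersection of \<open>- Q + \<beta>\<close> with the line spanned by column \<open>z\<close>, as a set of parameters.\<close>

definition line_locus ::
  "int ^ 'n::finite ^ 'd::finite \<Rightarrow> complex ^ 'd \<Rightarrow> 'n \<Rightarrow> (complex ^ 'd) set \<Rightarrow> complex set" where
  "line_locus A \<beta> z Q =
     {\<epsilon>. \<epsilon> *s vec_of_int (column z A) \<in> (\<lambda>q. - q + \<beta>) ` Q}"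

end

theory Submission
  imports Defs "HOL-Analysis.Kronecker_Approximation_Theorem"
begin

text \<open>
  Write \<open>\<theta> = x\<^sub>0\<partial>\<^sub>0\<close> and \<open>L = H\<^sub>A(\<beta>) + V\<^sup>1D\<^sub>A\<close>, which is stable under left multiplication by
  \<open>\<theta>\<close> and by the Weyl algebra of \<open>A'\<close>. If \<open>\<partial>\<^sub>0\<^sup>k \<partial>\<^sup>u\<close> is congruent to an element of \<open>R\<^sub>A\<^sub>'\<close> modulo
  the toric ideal, then \<open>\<theta>(\<theta> - 1)\<cdots>(\<theta> - k + 1) \<partial>\<^sup>u = x\<^sub>0\<^sup>k \<partial>\<^sub>0\<^sup>k \<partial>\<^sup>u\<close> lies in \<open>L\<close>. Hence the
  \<open>f \<in> R\<^sub>A\<^sub>'\<close> with \<open>g(\<theta>) f \<in> L\<close> for some polynomial \<open>g\<close> with roots in the asserted set \<open>T\<close> form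
  an ideal containing \<open>J\<close>. If it is proper, some monomial \<open>\<partial>\<^sup>u\<close> outside it has as annihilator modulo
  this ideal the prime generated by the \<open>\<partial>\<^sub>j\<close>, \<open>j \<notin> F\<close>. Then the degree of \<open>\<partial>\<^sup>u\<close> plus the span of
  \<open>a\<^sub>j\<close>, \<open>j \<in> F\<close>, consists of quasi-degrees, and a linear functional vanishing on this span turns the
  Euler operators into a nonzero polynomial of degree at most one in \<open>\<theta>\<close>, with roots in \<open>T\<close>,
  that carries \<open>\<partial>\<^sup>u\<close> into the ideal, a contradiction.

  If \<open>a\<^sub>0\<close> lies in the cone of \<open>A'\<close>, Dirichlet approximation gives \<open>t \<ge> 1\<close> with \<open>t a\<^sub>0 \<in> \<nat>A'\<close>, so
  \<open>1 \<in> J\<close>. If the dimension drops, \<open>a\<^sub>0\<close> is not in the span of \<open>A'\<close>, and the functional \<open>c\<close> with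
  \<open>c(a\<^sub>0) = 1\<close> that vanishes on \<open>A'\<close> gives \<open>\<theta> - c(\<beta>) \<in> L\<close>. Finally \<open>1 \<notin> L\<close>, because \<open>H\<^sub>A(\<beta>)\<close>
  annihilates the formal \<open>\<Gamma>\<close>-series with support \<open>\<gamma> + ker A\<close>, all of whose terms have the same
  exponent of \<open>x\<^sub>0\<close>, while \<open>V\<^sup>1D\<^sub>A\<close> raises this exponent.
\<close>

subsection \<open>Polynomial rings and toric ideals\<close>

lemma poly_mapping_sum_single:
  fixes f :: "'a \<Rightarrow>\<^sub>0 'b::comm_monoid_add"
  shows "f = (\<Sum>u\<in>Poly_Mapping.keys f. Poly_Mapping.single u (Poly_Mapping.lookup f u))"
  by (intro poly_mapping_eqI) (auto simp: lookup_sum lookup_single when_def in_keys_iff)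

lemma poly_mapping_induct_keys [consumes 1, case_names zero single add]:
  fixes f :: "'a \<Rightarrow>\<^sub>0 'b::comm_monoid_add"
  assumes "Poly_Mapping.keys f \<subseteq> U" and "P 0"
    and single: "\<And>u c. u \<in> U \<Longrightarrow> P (Poly_Mapping.single u c)"
    and add: "\<And>f g. P f \<Longrightarrow> P g \<Longrightarrow> P (f + g)"
  shows "P f"
proof -
  have "P (\<Sum>u\<in>V. Poly_Mapping.single u (Poly_Mapping.lookup f u))" if "finite V" "V \<subseteq> U" for V
    using that by (induction V) (use assms in auto)
  from this[of "Poly_Mapping.keys f"] show ?thesis
    using assms(1) poly_mapping_sum_single[of f] by simp
qed

lemma poly_mapping_induct_single [case_names zero single add]:
  fixes f :: "'a \<Rightarrow>\<^sub>0 'b::comm_monoid_add"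
  assumes "P 0" and "\<And>u c. P (Poly_Mapping.single u c)"
    and "\<And>f g. P f \<Longrightarrow> P g \<Longrightarrow> P (f + g)"
  shows "P f"
  using poly_mapping_induct_keys[of f UNIV P] assms by simp

lemma single_sum: "Poly_Mapping.single u (\<Sum>i\<in>I. r i) = (\<Sum>i\<in>I. Poly_Mapping.single u (r i))"
  by (induction I rule: infinite_finite_induct) (auto simp: single_add)

section \<open>Linear functionals on polynomials and degrees of monomials\<close>

definition lin_ext :: "('u \<Rightarrow> complex) \<Rightarrow> ('u \<Rightarrow>\<^sub>0 complex) \<Rightarrow> complex" where
  "lin_ext \<phi> f = (\<Sum>u\<in>Poly_Mapping.keys f. Poly_Mapping.lookup f u * \<phi> u)"

lemma lin_ext_superset:
  assumes "finite U" "Poly_Mapping.keys f \<subseteq> U"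
  shows "lin_ext \<phi> f = (\<Sum>u\<in>U. Poly_Mapping.lookup f u * \<phi> u)"
  unfolding lin_ext_def using assms by (intro sum.mono_neutral_left) (auto simp: in_keys_iff)

lemma lin_ext_0 [simp]: "lin_ext \<phi> 0 = 0"
  by (simp add: lin_ext_def)

lemma lin_ext_single [simp]: "lin_ext \<phi> (Poly_Mapping.single u c) = c * \<phi> u"
  by (simp add: lin_ext_def)

lemma lin_ext_add: "lin_ext \<phi> (f + g) = lin_ext \<phi> f + lin_ext \<phi> g"
proof -
  let ?U = "Poly_Mapping.keys f \<union> Poly_Mapping.keys g"
  have "Poly_Mapping.keys (f + g) \<subseteq> ?U" by (rule keys_add)
  then show ?thesis
    by (simp add: lin_ext_superset[of ?U] lookup_add distrib_right sum.distrib)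
qed

lemma lin_ext_uminus: "lin_ext \<phi> (- f) = - lin_ext \<phi> f"
  by (simp add: lin_ext_def sum_negf)

lemma lin_ext_diff: "lin_ext \<phi> (f - g) = lin_ext \<phi> f - lin_ext \<phi> g"
  using lin_ext_add[of \<phi> f "- g"] by (simp add: lin_ext_uminus)

lemma lin_ext_sum: "lin_ext \<phi> (\<Sum>i\<in>I. f i) = (\<Sum>i\<in>I. lin_ext \<phi> (f i))"
  by (induction I rule: infinite_finite_induct) (auto simp: lin_ext_add)

lemma lin_ext_single_mult:
  "lin_ext \<phi> (Poly_Mapping.single u c * f) = c * lin_ext (\<lambda>v. \<phi> (u + v)) f"
  by (induction f rule: poly_mapping_induct_single)
    (auto simp: distrib_left lin_ext_add mult_single)

lemma lin_ext_cong:
  assumes "\<And>u. u \<in> Poly_Mapping.keys f \<Longrightarrow> \<phi> u = \<psi> u"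
  shows "lin_ext \<phi> f = lin_ext \<psi> f"
  unfolding lin_ext_def using assms by (intro sum.cong) auto

lemma mono_degree_0 [simp]: "mono_degree A 0 = 0"
  by (simp add: mono_degree_def)

lemma mono_degree_add: "mono_degree A (u + v) = mono_degree A u + mono_degree A v"
  by (simp add: mono_degree_def lookup_add sum.distrib vector_space_over_itself.scale_left_distrib
      vec_eq_iff algebra_simps)

lemma mono_degree_nth:
  "mono_degree A u $ i = (\<Sum>j\<in>UNIV. int (Poly_Mapping.lookup u j) * A $ i $ j)"
  by (simp add: mono_degree_def column_def)

lemma mono_degree_single:
  "mono_degree A (Poly_Mapping.single j k) = int k *s column j A"
proof -
  have "(\<Sum>i\<in>UNIV. int (Poly_Mapping.lookup (Poly_Mapping.single j k) i) * A $ r $ i) =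
      (\<Sum>i\<in>UNIV. if i = j then int k * A $ r $ j else 0)" for r
    by (intro sum.cong) (auto simp: lookup_single when_def)
  then show ?thesis
    by (simp add: vec_eq_iff mono_degree_nth column_def)
qed

text \<open>The coefficient of t^\<alpha> in the image of a polynomial under the monomial map that
  sends \<partial>^u to t^(A u).\<close>

definition fib :: "int ^ 'n::finite ^ 'd::finite \<Rightarrow> int ^ 'd \<Rightarrow> 'n mpol \<Rightarrow> complex" where
  "fib A \<alpha> = lin_ext (\<lambda>u. if mono_degree A u = \<alpha> then 1 else 0)"

lemma fib_single_mult: "fib A \<alpha> (Poly_Mapping.single u c * f) = c * fib A (\<alpha> - mono_degree A u) f"
proof -
  have "mono_degree A (u + v) = \<alpha> \<longleftrightarrow> mono_degree A v = \<alpha> - mono_degree A u" for v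
    by (auto simp: mono_degree_add algebra_simps)
  then show ?thesis
    by (simp add: fib_def lin_ext_single_mult)
qed

section \<open>Polynomial rings in subsets of the variables and their ideals\<close>

lemma carrier_mpol_ring: "f \<in> carrier (mpol_ring J) \<longleftrightarrow> (\<forall>u\<in>Poly_Mapping.keys f. Poly_Mapping.keys u \<subseteq> J)"
  by (simp add: mpol_ring_def)

lemma mpol_ring_simps [simp]:
  "f \<oplus>\<^bsub>mpol_ring J\<^esub> g = f + g" "f \<otimes>\<^bsub>mpol_ring J\<^esub> g = f * g"
  "\<zero>\<^bsub>mpol_ring J\<^esub> = 0" "\<one>\<^bsub>mpol_ring J\<^esub> = 1"
  by (simp_all add: mpol_ring_def)

lemma ring_mpol_ring: "ring (mpol_ring J)"
  using cring_mpol_ring by (rule cring.axioms(1))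

lemma single_mem_carrier: "Poly_Mapping.keys u \<subseteq> J \<Longrightarrow> Poly_Mapping.single u c \<in> carrier (mpol_ring J)"
  by (simp add: carrier_mpol_ring)

lemma carrier_mpol_ring_induct [consumes 1, case_names zero single add]:
  assumes "f \<in> carrier (mpol_ring J)" and "P 0"
    and "\<And>u c. Poly_Mapping.keys u \<subseteq> J \<Longrightarrow> P (Poly_Mapping.single u c)"
    and "\<And>f g. P f \<Longrightarrow> P g \<Longrightarrow> P (f + g)"
  shows "P f"
  by (rule poly_mapping_induct_keys[of f "{u. Poly_Mapping.keys u \<subseteq> J}"])
    (use assms in \<open>auto simp: carrier_mpol_ring\<close>)

text \<open>Every polynomial is a sum of terms, so closure under multiplication by terms extends to
  the whole ring; additive inverses are multiples by the constant -1.\<close>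

lemma mpol_idealI:
  assumes sub: "I \<subseteq> carrier (mpol_ring J)" and zero: "0 \<in> I"
    and add: "\<And>f g. f \<in> I \<Longrightarrow> g \<in> I \<Longrightarrow> f + g \<in> I"
    and mult: "\<And>u c f. Poly_Mapping.keys u \<subseteq> J \<Longrightarrow> f \<in> I \<Longrightarrow> Poly_Mapping.single u c * f \<in> I"
  shows "ideal I (mpol_ring J)"
proof -
  interpret cring "mpol_ring J" by (rule cring_mpol_ring)
  have m: "h * f \<in> I" if "h \<in> carrier (mpol_ring J)" "f \<in> I" for f h
    using that by (induction h rule: carrier_mpol_ring_induct) (auto simp: zero add mult distrib_right)
  show ?thesis
  proof (rule idealI)
    show "subgroup I (add_monoid (mpol_ring J))"
    proof (rule add.subgroupI)
      fix f assume f: "f \<in> I"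
      have "\<ominus>\<^bsub>mpol_ring J\<^esub> f = - f"
      proof (rule minus_equality)
        have "cst (-1) * f \<in> I" using f by (intro mult) auto
        then show "- f \<in> carrier (mpol_ring J)" using sub by (auto simp: single_uminus)
      qed (use f sub in auto)
      moreover have "cst (-1) * f \<in> I" using f by (intro mult) auto
      ultimately show "\<ominus>\<^bsub>mpol_ring J\<^esub> f \<in> I" by (simp add: single_uminus)
    qed (use sub zero add in auto)
  next
    show "h \<otimes>\<^bsub>mpol_ring J\<^esub> f \<in> I" "f \<otimes>\<^bsub>mpol_ring J\<^esub> h \<in> I"
      if "f \<in> I" "h \<in> carrier (mpol_ring J)" for f h
      using m[OF that(2,1)] by (simp_all add: mult.commute)
  qed (rule ring_mpol_ring)
qed

lemma mpol_ideal_closed: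
  assumes "ideal I (mpol_ring J)"
  shows "I \<subseteq> carrier (mpol_ring J)" "0 \<in> I" "f \<in> I \<Longrightarrow> g \<in> I \<Longrightarrow> f + g \<in> I"
    "f \<in> I \<Longrightarrow> h \<in> carrier (mpol_ring J) \<Longrightarrow> h * f \<in> I"
    "f \<in> I \<Longrightarrow> - f \<in> I" "f \<in> I \<Longrightarrow> g \<in> I \<Longrightarrow> f - g \<in> I"
proof -
  interpret ideal I "mpol_ring J" by (rule assms)
  show "I \<subseteq> carrier (mpol_ring J)" "0 \<in> I"
    using a_subset additive_subgroup.zero_closed[OF is_additive_subgroup] by auto
  show add: "f \<in> I \<Longrightarrow> g \<in> I \<Longrightarrow> f + g \<in> I" for f g using additive_subgroup.a_closed[OF is_additive_subgroup, of f g] by simp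
  show mult: "f \<in> I \<Longrightarrow> h \<in> carrier (mpol_ring J) \<Longrightarrow> h * f \<in> I" for f h using I_l_closed[of f h] by simp
  show neg: "f \<in> I \<Longrightarrow> - f \<in> I" for f
    using mult[of f "cst (-1)"] single_mem_carrier[of 0 J "-1"] by (simp add: single_uminus)
  show "f \<in> I \<Longrightarrow> g \<in> I \<Longrightarrow> f - g \<in> I" using add[of f "- g"] neg[of g] by simp
qed

section \<open>The toric ideal as the kernel of a monomial map\<close>

lemma lookup_pos_part: "Poly_Mapping.lookup (pos_part v) j = nat (v $ j)"
  by (simp add: pos_part_def)

lemma mono_degree_pos_part_diff:
  "mono_degree A (pos_part v) - mono_degree A (pos_part (- v)) = A *v v"
proof -
  have "(\<Sum>j\<in>UNIV. int (nat (v $ j)) * A $ i $ j) - (\<Sum>j\<in>UNIV. int (nat (- v $ j)) * A $ i $ j)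
     = (A *v v) $ i" for i
    unfolding matrix_vector_mult_def by (simp flip: sum_subtractf) (auto intro!: sum.cong)
  then show ?thesis
    by (simp add: vec_eq_iff mono_degree_nth lookup_pos_part)
qed

text \<open>Splitting off the greatest common monomial factor of \<open>u\<close> and
  \<open>u'\<close> leaves the positive and the negative part of the integer vector u - u', which
  lies in the kernel of \<open>A\<close>; their difference is a generator of the ideal.\<close>

lemma mon_diff_in_toric_ideal:
  assumes "Poly_Mapping.keys u \<subseteq> J" "Poly_Mapping.keys u' \<subseteq> J" "mono_degree A u = mono_degree A u'"
  shows "mon u - mon u' \<in> toric_ideal A J"
proof -
  define v :: "int ^ 'a" where
    "v = (\<chi> j. int (Poly_Mapping.lookup u j) - int (Poly_Mapping.lookup u' j))"
  \<comment> \<open>Subtraction of exponents is truncated, so \<open>w\<close> is the componentwise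
    minimum of \<open>u\<close> and \<open>u'\<close>.\<close>
  define w where "w = u - pos_part v"
  have u: "u = w + pos_part v" "u' = w + pos_part (- v)"
    by (auto intro!: poly_mapping_eqI simp: w_def v_def lookup_add lookup_minus lookup_pos_part)
  have "A *v v = 0"
    using assms(3) by (simp add: vec_eq_iff mono_degree_nth matrix_vector_mult_def v_def
        algebra_simps sum_subtractf)
  moreover have "\<forall>j. j \<notin> J \<longrightarrow> v $ j = 0"
    using assms(1,2) by (metis (no_types, lifting) diff_self in_keys_iff of_nat_0 subsetD v_def vec_lambda_beta)
  ultimately have g: "mon (pos_part v) - mon (pos_part (- v)) \<in>
    {mon (pos_part v) - mon (pos_part (- v)) | v. A *v v = 0 \<and> (\<forall>j. j \<notin> J \<longrightarrow> v $ j = 0)}"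
    by blast
  interpret cring "mpol_ring J" by (rule cring_mpol_ring)
  have "mon (pos_part v) - mon (pos_part (- v)) \<in> toric_ideal A J"
    if "{mon (pos_part v) - mon (pos_part (- v)) | v. A *v v = 0 \<and> (\<forall>j. j \<notin> J \<longrightarrow> v $ j = 0)} 
      \<subseteq> carrier (mpol_ring J)"
    unfolding toric_ideal_def using genideal_self[OF that] g by blast
  moreover have "{mon (pos_part v) - mon (pos_part (- v)) | v. A *v v = 0 \<and> (\<forall>j. j \<notin> J \<longrightarrow> v $ j = 0)} 
      \<subseteq> carrier (mpol_ring J)"
  proof safe
    fix v :: "int ^ 'a" assume v: "\<forall>j. j \<notin> J \<longrightarrow> v $ j = 0"
    have "Poly_Mapping.keys (pos_part v) \<subseteq> J" "Poly_Mapping.keys (pos_part (- v)) \<subseteq> J"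
      using v by (auto simp: in_keys_iff lookup_pos_part subset_iff)
    then show "mon (pos_part v) - mon (pos_part (- v)) \<in> carrier (mpol_ring J)"
      using keys_diff[of "mon (pos_part v)" "mon (pos_part (- v)) :: 'a mpol"]
      by (auto simp: carrier_mpol_ring)
  qed
  ultimately have "mon (pos_part v) - mon (pos_part (- v)) \<in> toric_ideal A J" by blast
  moreover have "Poly_Mapping.keys w \<subseteq> J"
    using assms(1) by (force simp: w_def in_keys_iff lookup_minus)
  ultimately have "mon w * (mon (pos_part v) - mon (pos_part (- v))) \<in> toric_ideal A J"
    by (intro mpol_ideal_closed(4)[OF ideal_toric_ideal] single_mem_carrier)
  then show ?thesis by (simp add: u right_diff_distrib mult_single)
qed

text \<open>One inclusion is checked on generators. For the other, each monomial of \<open>f\<close>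
  is exchanged for a fixed one of the same degree, at the cost of binomials of the ideal; what
  remains has the vanishing fibre sums as coefficients.\<close>

lemma toric_ideal_iff:
  "f \<in> toric_ideal A J \<longleftrightarrow> f \<in> carrier (mpol_ring J) \<and> (\<forall>\<alpha>. fib A \<alpha> f = 0)"
proof
  let ?K = "{f \<in> carrier (mpol_ring J). \<forall>\<alpha>. fib A \<alpha> f = 0}"
  interpret cring "mpol_ring J" by (rule cring_mpol_ring)
  have K: "ideal ?K (mpol_ring J)"
  proof (rule mpol_idealI)
    show "0 \<in> ?K" by (simp add: carrier_mpol_ring fib_def)
    show "f + g \<in> ?K" if "f \<in> ?K" "g \<in> ?K" for f g
      using that add.m_closed[of f g] by (simp add: fib_def lin_ext_add)
    show "Poly_Mapping.single u c * f \<in> ?K" if "Poly_Mapping.keys u \<subseteq> J" "f \<in> ?K" for u c f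
      using that carrier_mpol_ring_mult[OF single_mem_carrier[of u J c], of f]
      by (simp add: fib_single_mult)
  qed auto
  have "toric_ideal A J \<subseteq> ?K" unfolding toric_ideal_def
  proof (rule genideal_minimal[OF K], safe)
    fix v :: "int ^ 'a" assume v: "\<forall>j. j \<notin> J \<longrightarrow> v $ j = 0" and A: "A *v v = 0"
    have ks: "Poly_Mapping.keys (pos_part v) \<subseteq> J" "Poly_Mapping.keys (pos_part (- v)) \<subseteq> J"
      using v by (auto simp: in_keys_iff lookup_pos_part subset_iff)
    have d: "mono_degree A (pos_part v) = mono_degree A (pos_part (- v))"
      using mono_degree_pos_part_diff[of A v] A by simp
    from mon_diff_in_toric_ideal[OF ks d] show "mon (pos_part v) - mon (pos_part (- v)) \<in> carrier (mpol_ring J)"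
      using mpol_ideal_closed(1)[OF ideal_toric_ideal] by blast
    show "fib A \<alpha> (mon (pos_part v) - mon (pos_part (- v))) = 0" for \<alpha>
      by (simp add: fib_def lin_ext_diff d)
  qed
  then show "f \<in> toric_ideal A J \<Longrightarrow> f \<in> carrier (mpol_ring J) \<and> (\<forall>\<alpha>. fib A \<alpha> f = 0)" by blast
next
  assume f: "f \<in> carrier (mpol_ring J) \<and> (\<forall>\<alpha>. fib A \<alpha> f = 0)"
  let ?d = "mono_degree A"
  \<comment> \<open>The representative of a degree is taken from the support of \<open>f\<close>, so
    that it involves only variables in \<open>J\<close>.\<close>
  define r where "r \<alpha> = (SOME u. u \<in> Poly_Mapping.keys f \<and> ?d u = \<alpha>)" for \<alpha>
  have r: "r (?d u) \<in> Poly_Mapping.keys f" "?d (r (?d u)) = ?d u" if "u \<in> Poly_Mapping.keys f" for u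
    using someI[of "\<lambda>v. v \<in> Poly_Mapping.keys f \<and> ?d v = ?d u" u] that by (auto simp: r_def)
  note I = mpol_ideal_closed[OF ideal_toric_ideal[of A J]]
  have "(\<Sum>u\<in>Poly_Mapping.keys f. Poly_Mapping.single (r (?d u)) (Poly_Mapping.lookup f u))
     = (\<Sum>\<alpha>\<in>?d ` Poly_Mapping.keys f. \<Sum>u\<in>{u\<in>Poly_Mapping.keys f. ?d u = \<alpha>}. Poly_Mapping.single (r \<alpha>) (Poly_Mapping.lookup f u))"
    by (subst sum.image_gen[of _ _ ?d]) (auto intro!: sum.cong)
  also have "\<dots> = (\<Sum>\<alpha>\<in>?d ` Poly_Mapping.keys f. Poly_Mapping.single (r \<alpha>) (fib A \<alpha> f))"
  proof (intro sum.cong refl)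
    fix \<alpha>
    have "fib A \<alpha> f = (\<Sum>u\<in>{u\<in>Poly_Mapping.keys f. ?d u = \<alpha>}. Poly_Mapping.lookup f u)"
      by (simp add: fib_def lin_ext_def if_distrib sum.If_cases Int_def cong: if_cong)
    then show "(\<Sum>u\<in>{u\<in>Poly_Mapping.keys f. ?d u = \<alpha>}. Poly_Mapping.single (r \<alpha>) (Poly_Mapping.lookup f u)) 
       = Poly_Mapping.single (r \<alpha>) (fib A \<alpha> f)" by (simp add: single_sum)
  qed
  also have "\<dots> = 0" using f by simp
  finally have z: "(\<Sum>u\<in>Poly_Mapping.keys f. Poly_Mapping.single (r (?d u)) (Poly_Mapping.lookup f u)) = 0" .
  have f_eq: "f = (\<Sum>u\<in>Poly_Mapping.keys f. cst (Poly_Mapping.lookup f u) * (mon u - mon (r (?d u))))"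
    using poly_mapping_sum_single[of f] z by (simp add: right_diff_distrib mult_single sum_subtractf)
  have term_mem: "cst c * (mon u - mon (r (?d u))) \<in> toric_ideal A J" if "u \<in> Poly_Mapping.keys f" for u c
    using f r[OF that] that
    by (intro I(4) mon_diff_in_toric_ideal single_mem_carrier) (auto simp: carrier_mpol_ring)
  have sum_mem: "(\<Sum>u\<in>U. cst (Poly_Mapping.lookup f u) * (mon u - mon (r (?d u)))) \<in> toric_ideal A J"
    if "U \<subseteq> Poly_Mapping.keys f" for U
    using finite_subset[OF that finite_keys] that
  proof (induction U rule: finite_induct)
    case (insert u U)
    then show ?case using I(3) term_mem by simp
  qed (simp add: I(2))
  show "f \<in> toric_ideal A J" using sum_mem[OF subset_refl] f_eq by simp
qed

subsection \<open>Differential operators and the V-filtration\<close>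

lemma lookup_mon_mult:
  "Poly_Mapping.lookup (mon u * f) m =
     (if \<forall>j. Poly_Mapping.lookup u j \<le> Poly_Mapping.lookup m j then Poly_Mapping.lookup f (m - u) else 0)"
proof (induction f rule: poly_mapping_induct_single)
  case (single v c)
  have "u + v = m \<longleftrightarrow> (\<forall>j. Poly_Mapping.lookup u j \<le> Poly_Mapping.lookup m j) \<and> v = m - u"
  proof safe
    assume *: "\<forall>j. Poly_Mapping.lookup u j \<le> Poly_Mapping.lookup m j"
    show "u + (m - u) = m"
      using * by (intro poly_mapping_eqI) (simp add: lookup_add lookup_minus)
  qed (simp_all add: lookup_add)
  then show ?case
    by (auto simp: mult_single lookup_single when_def)
qed (auto simp: distrib_left lookup_add)

lemma pdiff_single:
  "pdiff j (Poly_Mapping.single u c) =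
     Poly_Mapping.single (u - Poly_Mapping.single j 1) (of_nat (Poly_Mapping.lookup u j) * c)"
  by (simp add: pdiff_def)

lemma pdiff_0 [simp]: "pdiff j 0 = 0"
  by (simp add: pdiff_def)

lemma pdiff_mult: "pdiff j (f * g) = pdiff j f * g + f * pdiff j g"
proof (induction f rule: poly_mapping_induct_single)
  case (single u c)
  show ?case
  proof (induction g rule: poly_mapping_induct_single)
    case (single v d)
    let ?e = "Poly_Mapping.single j (1::nat)"
    have "u - ?e + v = u + v - ?e" if "Poly_Mapping.lookup u j \<noteq> 0"
      using that by (intro poly_mapping_eqI) (auto simp: lookup_add lookup_minus lookup_single when_def)
    moreover have "u + (v - ?e) = u + v - ?e" if "Poly_Mapping.lookup v j \<noteq> 0"
      using that by (intro poly_mapping_eqI) (auto simp: lookup_add lookup_minus lookup_single when_def)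
    ultimately show ?case
      by (cases "Poly_Mapping.lookup u j = 0"; cases "Poly_Mapping.lookup v j = 0")
        (simp_all add: mult_single pdiff_single lookup_add algebra_simps flip: single_add)
  qed (simp_all add: distrib_left pdiff_add)
qed (simp_all add: distrib_right pdiff_add)

lemma pdiff_cst_mult: "pdiff j (cst c * f) = cst c * pdiff j f"
  by (simp add: pdiff_mult pdiff_single)

lemma pdiff_mon_mult:
  "pdiff j (mon u * g) =
     cst (of_nat (Poly_Mapping.lookup u j)) * (mon (u - Poly_Mapping.single j 1) * g) + mon u * pdiff j g"
  by (simp add: pdiff_mult pdiff_single mult_single del: single_of_nat flip: mult.assoc)

lemma pdiff_xmul: "pdiff i (xmul j f) = (if i = j then f else 0) + xmul j (pdiff i f)"
  by (auto simp: xmul_def pdiff_mon_mult lookup_single)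

text \<open>The type \<open>oper\<close> consists of arbitrary maps, so linearity is recovered from
  membership in \<open>weyl\<close>.\<close>

definition mpol_linear :: "'n oper \<Rightarrow> bool" where
  "mpol_linear P \<longleftrightarrow> (\<forall>f g. P (f + g) = P f + P g) \<and> (\<forall>c f. P (cst c * f) = cst c * P f)"

lemma mpol_linearD:
  assumes "mpol_linear P"
  shows "P (f + g) = P f + P g" "P (cst c * f) = cst c * P f" "P 0 = 0"
    "P (\<Sum>i\<in>I. h i) = (\<Sum>i\<in>I. P (h i))"
proof -
  show 1: "P (f + g) = P f + P g" and 2: "P (cst c * f) = cst c * P f" for f g c
    using assms by (auto simp: mpol_linear_def)
  show 3: "P 0 = 0" using 2[of 0 0] by simp
  show "P (\<Sum>i\<in>I. h i) = (\<Sum>i\<in>I. P (h i))"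
    by (induction I rule: infinite_finite_induct) (auto simp: 1 3)
qed

lemma mpol_linear_weyl: "P \<in> weyl \<Longrightarrow> mpol_linear P"
  by (induction rule: weyl.induct)
    (simp_all add: mpol_linear_def distrib_left xmul_def pdiff_add pdiff_cst_mult mult.left_commute)

lemma weyl_id: "id \<in> weyl"
proof -
  have "(\<lambda>f::'a mpol. cst 1 * f) = id" by auto
  then show "(id :: 'a oper) \<in> weyl" using weyl.const[of 1] by metis
qed

lemma weyl_comp': "P \<in> weyl \<Longrightarrow> Q \<in> weyl \<Longrightarrow> (\<lambda>f. P (Q f)) \<in> weyl"
  using weyl.comp[of P Q] by (simp add: o_def)

lemma weyl_zero: "(\<lambda>f. 0) \<in> weyl"
proof -
  have "(\<lambda>f::'a mpol. cst 0 * f) = (\<lambda>f. 0)" by simp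
  then show "(\<lambda>f::'a mpol. 0) \<in> weyl" using weyl.const[of 0] by metis
qed

lemma mono_diff_0 [simp]: "mono_diff 0 = id"
  by (simp add: mono_diff_def)

text \<open>The predicate refers to the exponent as well as to the operator, because some rules,
  such as the commutation with \<open>euler\<close>, depend on the degree.\<close>

lemma mono_diff_induct [consumes 1, case_names id pdiff comp]:
  assumes "Poly_Mapping.keys u \<subseteq> J" and "P 0 id"
    and "\<And>j. j \<in> J \<Longrightarrow> P (Poly_Mapping.single j 1) (pdiff j)"
    and "\<And>u v. P u (mono_diff u) \<Longrightarrow> P v (mono_diff v) \<Longrightarrow> P (u + v) (mono_diff u \<circ> mono_diff v)"
  shows "P u (mono_diff u)"
proof (rule poly_mapping_induct_keys[OF assms(1)])
  show "P 0 (mono_diff 0)" using assms(2) by simp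
  show "P (u + v) (mono_diff (u + v))" if "P u (mono_diff u)" "P v (mono_diff v)" for u v
    using assms(4)[OF that] by (simp add: mono_diff_add)
  show "P (Poly_Mapping.single j r) (mono_diff (Poly_Mapping.single j r))" if "j \<in> J" for j r
  proof (induction r)
    case (Suc r)
    then show ?case
      using assms(3)[OF that] assms(4)[of "Poly_Mapping.single j 1" "Poly_Mapping.single j r"]
      by (simp add: mono_diff_single o_def flip: single_add)
  qed (use assms(2) in \<open>simp add: id_def\<close>)
qed

lemma mono_diff_weyl: "mono_diff u \<in> weyl"
  using subset_UNIV
proof (induction rule: mono_diff_induct)
  case (comp u v)
  then show ?case by (rule weyl.comp)
qed (rule weyl_id weyl.diff)+

lemmas mono_diff_linear = mpol_linearD[OF mpol_linear_weyl[OF mono_diff_weyl]]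

lemma pdiff_mono_diff: "pdiff j (mono_diff u f) = mono_diff (Poly_Mapping.single j 1 + u) f"
  using mono_diff_add[of "Poly_Mapping.single j 1" u] mono_diff_single[of j 1] by simp

lemma poly_diff_superset:
  assumes "finite U" "Poly_Mapping.keys f \<subseteq> U"
  shows "poly_diff f g = (\<Sum>u\<in>U. cst (Poly_Mapping.lookup f u) * mono_diff u g)"
  unfolding poly_diff_def using assms by (intro sum.mono_neutral_left) (auto simp: in_keys_iff)

lemma poly_diff_add: "poly_diff (f + g) h = poly_diff f h + poly_diff g h"
proof -
  let ?U = "Poly_Mapping.keys f \<union> Poly_Mapping.keys g"
  have "Poly_Mapping.keys (f + g) \<subseteq> ?U" by (rule keys_add)
  then show ?thesis
    by (simp add: poly_diff_superset[of ?U] lookup_add single_add distrib_right sum.distrib)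
qed

lemma poly_diff_single: "poly_diff (Poly_Mapping.single u c) g = cst c * mono_diff u g"
  by (simp add: poly_diff_def)

lemma poly_diff_0 [simp]: "poly_diff 0 g = 0"
  by (simp add: poly_diff_def)

lemma poly_diff_diff: "poly_diff (f - g) h = poly_diff f h - poly_diff g h"
  using poly_diff_add[of "f - g" g h] by simp

lemma poly_diff_single_mult: "poly_diff (Poly_Mapping.single u c * f) g = cst c * mono_diff u (poly_diff f g)"
  by (induction f rule: poly_mapping_induct_single)
    (simp_all add: mult_single poly_diff_single mono_diff_add distrib_left poly_diff_add
      mono_diff_linear flip: mult.assoc)

text \<open>Left multiples are built in only for the generators; for sums, additivity of the members
  of \<open>weyl\<close> carries \<open>W\<close> inside.\<close>

lemma left_ideal_comp: "P \<in> left_ideal G \<Longrightarrow> W \<in> weyl \<Longrightarrow> (\<lambda>f. W (P f)) \<in> left_ideal G"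
proof (induction rule: left_ideal.induct)
  case zero
  then show ?case using left_ideal.zero[of G] by (simp add: mpol_linearD[OF mpol_linear_weyl])
next
  case (gen P g)
  then show ?case using left_ideal.gen[of "W \<circ> P" g G] weyl.comp[of W P] by (simp add: o_def)
next
  case (add P Q)
  then show ?case
    using left_ideal.add[OF add.IH] by (simp add: mpol_linearD[OF mpol_linear_weyl])
qed

lemma left_ideal_base: "g \<in> G \<Longrightarrow> g \<in> left_ideal G"
  using left_ideal.gen[OF weyl_id, of g G] by simp

section \<open>Normal forms and the V-filtration\<close>

lemma normal_form_superset:
  assumes "finite U" "Poly_Mapping.keys p \<subseteq> U"
  shows "normal_form p f = (\<Sum>(\<mu>, \<nu>)\<in>U. cst (Poly_Mapping.lookup p (\<mu>, \<nu>)) * (mon \<mu> * mono_diff \<nu> f))"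
  unfolding normal_form_def using assms by (intro sum.mono_neutral_left) (auto simp: in_keys_iff)

lemma normal_form_add: "normal_form (p + q) f = normal_form p f + normal_form q f"
proof -
  let ?U = "Poly_Mapping.keys p \<union> Poly_Mapping.keys q"
  have "Poly_Mapping.keys (p + q) \<subseteq> ?U" by (rule keys_add)
  then show ?thesis
    by (simp add: normal_form_superset[of ?U] lookup_add single_add distrib_right sum.distrib case_prod_unfold)
qed

lemma V_filtration_zero: "(\<lambda>f. 0) \<in> V_filtration z i"
  unfolding V_filtration_def by (rule image_eqI[of _ _ 0]) (auto simp: normal_form_def)

lemma V_filtration_monomial:
  assumes "int (Poly_Mapping.lookup \<mu> z) - int (Poly_Mapping.lookup \<nu> z) \<ge> i"
  shows "(\<lambda>f. cst c * (mon \<mu> * mono_diff \<nu> f)) \<in> V_filtration z i"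
  unfolding V_filtration_def
  by (rule image_eqI[of _ _ "Poly_Mapping.single (\<mu>, \<nu>) c"]) (use assms in \<open>auto simp: normal_form_def\<close>)

lemma V_filtration_add:
  assumes "P \<in> V_filtration z i" "Q \<in> V_filtration z i"
  shows "(\<lambda>f. P f + Q f) \<in> V_filtration z i"
proof -
  let ?K = "{p. \<forall>(\<mu>, \<nu>)\<in>Poly_Mapping.keys p.
     int (Poly_Mapping.lookup \<mu> z) - int (Poly_Mapping.lookup \<nu> z) \<ge> i}"
  obtain p q where pq: "p \<in> ?K" "q \<in> ?K" "P = normal_form p" "Q = normal_form q"
    using assms by (auto simp: V_filtration_def)
  then have "p + q \<in> ?K"
    using keys_add[of p q] by blast
  then show ?thesis
    using pq unfolding V_filtration_def by (intro image_eqI[of _ _ "p + q"]) (auto simp: normal_form_add)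
qed

text \<open>A normal form is a finite sum of normally ordered terms, so claims about the
  V-filtration reduce to a single such term.\<close>

lemma V_filtration_induct [consumes 1, case_names zero monomial add]:
  assumes "Q \<in> V_filtration z i" and "R (\<lambda>f. 0)"
    and "\<And>c \<mu> \<nu>. int (Poly_Mapping.lookup \<mu> z) - int (Poly_Mapping.lookup \<nu> z) \<ge> i
      \<Longrightarrow> R (\<lambda>f. cst c * (mon \<mu> * mono_diff \<nu> f))"
    and "\<And>P Q. R P \<Longrightarrow> R Q \<Longrightarrow> R (\<lambda>f. P f + Q f)"
  shows "R Q"
proof -
  obtain p where Q: "Q = normal_form p" and p: "\<forall>(\<mu>, \<nu>)\<in>Poly_Mapping.keys p.
     int (Poly_Mapping.lookup \<mu> z) - int (Poly_Mapping.lookup \<nu> z) \<ge> i"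
    using assms(1) by (auto simp: V_filtration_def)
  have "R (\<lambda>f. \<Sum>(\<mu>, \<nu>)\<in>U. cst (Poly_Mapping.lookup p (\<mu>, \<nu>)) * (mon \<mu> * mono_diff \<nu> f))"
    if "finite U" "U \<subseteq> Poly_Mapping.keys p" for U
    using that
  proof (induction U)
    case (insert x U)
    obtain \<mu> \<nu> where x: "x = (\<mu>, \<nu>)" by (cases x) auto
    have "R (\<lambda>f. cst (Poly_Mapping.lookup p (\<mu>, \<nu>)) * (mon \<mu> * mono_diff \<nu> f))"
      using insert p by (intro assms(3)) (auto simp: x)
    from assms(4)[OF this insert.IH] show ?case
      using insert by (simp add: x)
  qed (simp add: assms(2))
  from this[OF finite_keys subset_refl] show ?thesis
    by (simp add: Q normal_form_def[abs_def])
qed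

lemma V_filtration_antimono:
  assumes "Q \<in> V_filtration z i" "i' \<le> i"
  shows "Q \<in> V_filtration z i'"
  using assms by (induction rule: V_filtration_induct)
    (auto intro: V_filtration_zero V_filtration_add V_filtration_monomial)

lemma V_filtration_cst:
  assumes "Q \<in> V_filtration z i"
  shows "(\<lambda>f. cst c * Q f) \<in> V_filtration z i"
  using assms
proof (induction rule: V_filtration_induct)
  case (monomial d \<mu> \<nu>)
  from V_filtration_monomial[OF this, of "c * d"] show ?case
    by (simp add: mult_single flip: mult.assoc)
next
  case (add P Q)
  from V_filtration_add[OF this] show ?case by (simp add: distrib_left)
qed (simp add: V_filtration_zero)

lemma V_filtration_xmul:
  assumes "Q \<in> V_filtration z i"
  shows "(\<lambda>f. xmul j (Q f)) \<in> V_filtration z (if j = z then i + 1 else i)"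
  using assms
proof (induction rule: V_filtration_induct)
  case (monomial c \<mu> \<nu>)
  have "xmul j (cst c * (mon \<mu> * mono_diff \<nu> f)) =
      cst c * (mon (Poly_Mapping.single j 1 + \<mu>) * mono_diff \<nu> f)" for f
    by (simp add: xmul_def mult_single flip: mult.assoc)
  then show ?case
    using monomial by (auto intro!: V_filtration_monomial simp: lookup_add lookup_single)
next
  case (add P Q)
  from V_filtration_add[OF this] show ?case by (simp add: xmul_def distrib_left)
qed (simp add: V_filtration_zero xmul_def)

text \<open>By the Leibniz rule, the derivative of a normally ordered term consists of one term with
  an \<open>x\<close> less and one with a derivative more. Where the truncated exponent
  \<open>\<mu> - ?e\<close> does not drop, its coefficient is 0.\<close>

lemma V_filtration_pdiff:
  assumes "Q \<in> V_filtration z i"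
  shows "(\<lambda>f. pdiff j (Q f)) \<in> V_filtration z (if j = z then i - 1 else i)"
  using assms
proof (induction rule: V_filtration_induct)
  case (monomial c \<mu> \<nu>)
  let ?e = "Poly_Mapping.single j (1::nat)"
  have "pdiff j (cst c * (mon \<mu> * mono_diff \<nu> f)) =
      cst (c * of_nat (Poly_Mapping.lookup \<mu> j)) * (mon (\<mu> - ?e) * mono_diff \<nu> f) +
      cst c * (mon \<mu> * mono_diff (?e + \<nu>) f)" for f
    unfolding pdiff_cst_mult pdiff_mon_mult pdiff_mono_diff
    by (simp add: distrib_left mult_single del: single_of_nat flip: mult.assoc)
  then show ?case
    using monomial by (auto intro!: V_filtration_add V_filtration_monomial simp: lookup_add lookup_minus lookup_single)
next
  case (add P Q)
  from V_filtration_add[OF this] show ?case by (simp add: pdiff_add)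
qed (simp add: V_filtration_zero)

section \<open>Polynomials in one operator, and the operator theta\<close>

lemma oper_poly_superset:
  assumes "degree p \<le> n"
  shows "oper_poly p T f = (\<Sum>i\<le>n. cst (coeff p i) * (T ^^ i) f)"
  unfolding oper_poly_def using assms by (intro sum.mono_neutral_left) (auto simp: coeff_eq_0)

lemma oper_poly_0 [simp]: "oper_poly 0 T f = 0"
  by (simp add: oper_poly_def)

lemma oper_poly_add: "oper_poly (p + q) T f = oper_poly p T f + oper_poly q T f"
proof -
  let ?n = "max (degree p) (degree q)"
  have "degree (p + q) \<le> ?n" by (rule degree_add_le_max)
  then show ?thesis
    by (simp add: oper_poly_superset[of _ ?n] single_add distrib_right sum.distrib)
qed

lemma oper_poly_smult: "oper_poly (smult c p) T f = cst c * oper_poly p T f"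
  using oper_poly_superset[of "smult c p" "degree p" T f] degree_smult_le[of c p]
  by (simp add: oper_poly_def sum_distrib_left mult_single flip: mult.assoc)

lemma oper_poly_diff: "oper_poly (p - q) T f = oper_poly p T f - oper_poly q T f"
  using oper_poly_add[of "p - q" q T f] by simp

lemma oper_poly_pCons:
  assumes "mpol_linear T"
  shows "oper_poly (pCons a p) T f = cst a * f + T (oper_poly p T f)"
proof -
  have "oper_poly (pCons a p) T f = (\<Sum>i\<le>Suc (degree p). cst (coeff (pCons a p) i) * (T ^^ i) f)"
    by (rule oper_poly_superset) (rule degree_pCons_le)
  then show ?thesis
    by (subst (asm) sum.atMost_Suc_shift) (simp add: oper_poly_def mpol_linearD[OF assms])
qed

lemma oper_poly_mult:
  assumes "mpol_linear T"
  shows "oper_poly (p * q) T f = oper_poly p T (oper_poly q T f)"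
proof (induction p)
  case (pCons a p)
  then show ?case
    by (simp add: oper_poly_pCons[OF assms] oper_poly_add oper_poly_smult)
qed simp

lemma oper_poly_commute:
  assumes "mpol_linear P" "\<And>f. T (P f) = P (T f)"
  shows "oper_poly p T (P f) = P (oper_poly p T f)"
proof -
  have "(T ^^ i) (P f) = P ((T ^^ i) f)" for i
    by (induction i) (simp_all add: assms(2))
  then show ?thesis
    by (simp add: oper_poly_def mpol_linearD[OF assms(1)])
qed

definition theta :: "'n \<Rightarrow> 'n oper" where
  "theta z f = xmul z (pdiff z f)"

lemma theta_weyl: "theta z \<in> weyl"
  unfolding theta_def[abs_def] by (rule weyl_comp'[OF weyl.var weyl.diff])

lemmas theta_linear = mpol_linear_weyl[OF theta_weyl]

lemma pdiff_pdiff: "pdiff i (pdiff j f) = pdiff j (pdiff i f)"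
  using pdiff_commute[of i j] by (simp add: fun_eq_iff)

lemma theta_mono_diff:
  assumes "Poly_Mapping.keys u \<subseteq> - {z}"
  shows "theta z (mono_diff u f) = mono_diff u (theta z f)"
proof -
  have "\<forall>f. theta z (mono_diff u f) = mono_diff u (theta z f)"
    using assms
    by (induction rule: mono_diff_induct) (auto simp: theta_def pdiff_xmul pdiff_pdiff[of z])
  then show ?thesis by blast
qed

definition falling :: "nat \<Rightarrow> complex poly" where
  "falling k = (\<Prod>i<k. [:- of_nat i, 1:])"

lemma poly_falling_eq_0_iff: "poly (falling k) x = 0 \<longleftrightarrow> x \<in> of_nat ` {0..<k}"
  by (auto simp: falling_def poly_prod)

text \<open>Induction on \<open>k\<close>: by the Leibniz rule theta x_0^k = x_0^k (theta + k), so
  the factor theta - k turns x_0^k \<partial>_0^k into x_0^(k+1) \<partial>_0^(k+1).\<close>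

lemma oper_poly_falling:
  "oper_poly (falling k) (theta z) f =
     mon (Poly_Mapping.single z k) * mono_diff (Poly_Mapping.single z k) f"
proof (induction k)
  case 0
  then show ?case by (simp add: falling_def oper_poly_def)
next
  case (Suc k)
  \<comment> \<open>False for k = 0 because of the truncated subtraction; there the coefficient
    \<open>of_nat k\<close> vanishes instead.\<close>
  have *: "Poly_Mapping.single z (Suc 0) + (Poly_Mapping.single z k - Poly_Mapping.single z (Suc 0)) =
      Poly_Mapping.single z k" if "k \<noteq> 0"
    using that by (simp flip: single_diff single_add)
  have "theta z (mon (Poly_Mapping.single z k) * g) =
      cst (of_nat k) * (mon (Poly_Mapping.single z k) * g) + mon (Poly_Mapping.single z (Suc k)) * pdiff z g" for g
    by (cases "k = 0")
      (simp_all add: theta_def pdiff_mon_mult xmul_def distrib_left mult_single * del: single_of_nat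
        flip: mult.assoc single_add)
  moreover have "pdiff z (mono_diff (Poly_Mapping.single z k) f) = mono_diff (Poly_Mapping.single z (Suc k)) f"
    by (simp add: mono_diff_single)
  ultimately have "theta z (oper_poly (falling k) (theta z) f) - cst (of_nat k) * oper_poly (falling k) (theta z) f
    = mon (Poly_Mapping.single z (Suc k)) * mono_diff (Poly_Mapping.single z (Suc k)) f"
    unfolding Suc by simp
  moreover have "oper_poly (falling (Suc k)) (theta z) f =
      theta z (oper_poly (falling k) (theta z) f) - cst (of_nat k) * oper_poly (falling k) (theta z) f"
  proof -
    have "falling (Suc k) = [:- of_nat k, 1:] * falling k"
      by (simp add: falling_def mult.commute)
    then show ?thesis
      by (simp only: oper_poly_mult[OF theta_linear])
        (simp add: oper_poly_pCons[OF theta_linear] single_uminus mpol_linearD[OF theta_linear])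
  qed
  ultimately show ?case by simp
qed

lemma pdiff_euler: "pdiff k (euler A i f) = euler A i (pdiff k f) + cst (of_int (A $ i $ k)) * pdiff k f"
proof -
  have swap: "pdiff k (xmul j (pdiff j f)) = (if k = j then pdiff k f else 0) + xmul j (pdiff j (pdiff k f))" for j
    by (simp add: pdiff_xmul pdiff_pdiff[of j k])
  have "pdiff k (euler A i f) = (\<Sum>j\<in>UNIV. cst (of_int (A $ i $ j)) * xmul j (pdiff j (pdiff k f)) +
      (if j = k then cst (of_int (A $ i $ k)) * pdiff k f else 0))"
    unfolding euler_def mpol_linearD(4)[OF mpol_linear_weyl[OF weyl.diff]]
    by (intro sum.cong) (auto simp: pdiff_cst_mult swap distrib_left simp del: single_of_int)
  then show ?thesis by (simp add: sum.distrib euler_def)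
qed

text \<open>Each factor \<partial>_k contributes the entry of \<open>A\<close> in row i and column k
  to the commutator, and commutators with the Euler operator add up along products, as degrees
  do.\<close>

lemma mono_diff_euler:
  "mono_diff u (euler A i f) = euler A i (mono_diff u f) + cst (of_int (mono_degree A u $ i)) * mono_diff u f"
proof -
  have "\<forall>f. mono_diff u (euler A i f) = euler A i (mono_diff u f) + cst (of_int (mono_degree A u $ i)) * mono_diff u f"
    using subset_UNIV
  proof (induction rule: mono_diff_induct)
    case (pdiff j)
    then show ?case by (simp add: pdiff_euler mono_degree_single column_def)
  next
    case (comp u v)
    then show ?case
      by (simp add: mono_diff_linear mono_degree_add single_add distrib_right del: single_of_int)
  qed simp
  then show ?thesis by blast
qed

subsection \<open>Polynomials in the Euler operator modulo the hypergeometric ideal\<close>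

definition hyp_V :: "int ^ 'n::finite ^ 'd::finite \<Rightarrow> complex ^ 'd \<Rightarrow> 'n \<Rightarrow> 'n oper set" where
  "hyp_V A \<beta> z = {W. \<exists>P\<in>hyp_ideal A \<beta>. \<exists>Q\<in>V_filtration z 1. W = (\<lambda>f. P f + Q f)}"

lemma hyp_ideal_subset_hyp_V: "P \<in> hyp_ideal A \<beta> \<Longrightarrow> P \<in> hyp_V A \<beta> z"
  unfolding hyp_V_def using V_filtration_zero[of z 1] by force

lemma V_filtration_subset_hyp_V: "Q \<in> V_filtration z 1 \<Longrightarrow> Q \<in> hyp_V A \<beta> z"
  unfolding hyp_V_def hyp_ideal_def using left_ideal.zero by force

lemma hyp_VI: "P \<in> hyp_ideal A \<beta> \<Longrightarrow> Q \<in> V_filtration z 1 \<Longrightarrow> (\<lambda>f. P f + Q f) \<in> hyp_V A \<beta> z"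
  unfolding hyp_V_def by (intro CollectI bexI[of _ P] bexI[of _ Q] refl)

lemma hyp_V_add:
  assumes "P \<in> hyp_V A \<beta> z" "Q \<in> hyp_V A \<beta> z"
  shows "(\<lambda>f. P f + Q f) \<in> hyp_V A \<beta> z"
proof -
  obtain P1 P2 Q1 Q2 where *: "P1 \<in> hyp_ideal A \<beta>" "P2 \<in> V_filtration z 1" "P = (\<lambda>f. P1 f + P2 f)"
    "Q1 \<in> hyp_ideal A \<beta>" "Q2 \<in> V_filtration z 1" "Q = (\<lambda>f. Q1 f + Q2 f)"
    using assms unfolding hyp_V_def by blast
  have "(\<lambda>f. P1 f + Q1 f) \<in> hyp_ideal A \<beta>"
    using *(1,4) unfolding hyp_ideal_def by (rule left_ideal.add)
  moreover have "(\<lambda>f. P2 f + Q2 f) \<in> V_filtration z 1"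
    using *(2,5) by (rule V_filtration_add)
  ultimately have "(\<lambda>f. (P1 f + Q1 f) + (P2 f + Q2 f)) \<in> hyp_V A \<beta> z"
    by (rule hyp_VI)
  then show ?thesis by (simp add: * algebra_simps)
qed

lemma hyp_V_sum: "(\<And>i. i \<in> I \<Longrightarrow> P i \<in> hyp_V A \<beta> z) \<Longrightarrow> (\<lambda>f. \<Sum>i\<in>I. P i f) \<in> hyp_V A \<beta> z"
proof (induction I rule: infinite_finite_induct)
  case (insert i I)
  then show ?case using hyp_V_add[of "P i" A \<beta> z "\<lambda>f. \<Sum>i\<in>I. P i f"] by simp
qed (simp_all add: V_filtration_subset_hyp_V V_filtration_zero)

text \<open>\<open>pdiff z\<close> lowers the V-filtration by one, so multiplication from the left
  on \<open>hyp_V\<close> is restricted to operators that preserve V^1.\<close>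

definition V_stable :: "'n \<Rightarrow> 'n oper set" where
  "V_stable z = {U \<in> weyl. \<forall>Q\<in>V_filtration z 1. (\<lambda>f. U (Q f)) \<in> V_filtration z 1}"

lemma V_stableI:
  assumes "U \<in> weyl" "\<And>Q. Q \<in> V_filtration z 1 \<Longrightarrow> (\<lambda>f. U (Q f)) \<in> V_filtration z 1"
  shows "U \<in> V_stable z"
  using assms by (simp add: V_stable_def)

lemma hyp_V_stable:
  assumes "U \<in> V_stable z" "W \<in> hyp_V A \<beta> z"
  shows "(\<lambda>f. U (W f)) \<in> hyp_V A \<beta> z"
proof -
  obtain P Q where *: "P \<in> hyp_ideal A \<beta>" "Q \<in> V_filtration z 1" "W = (\<lambda>f. P f + Q f)"
    using assms(2) unfolding hyp_V_def by blast
  have U: "U \<in> weyl" "(\<lambda>f. U (Q f)) \<in> V_filtration z 1"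
    using assms(1) *(2) by (auto simp: V_stable_def)
  have "(\<lambda>f. U (P f)) \<in> hyp_ideal A \<beta>"
    using *(1) U(1) unfolding hyp_ideal_def by (rule left_ideal_comp)
  then have "(\<lambda>f. U (P f) + U (Q f)) \<in> hyp_V A \<beta> z"
    using U(2) by (rule hyp_VI)
  then show ?thesis
    by (simp add: * mpol_linearD[OF mpol_linear_weyl[OF U(1)]])
qed

lemma V_stable_comp:
  assumes "U \<in> V_stable z" "W \<in> V_stable z"
  shows "(\<lambda>f. U (W f)) \<in> V_stable z"
proof (rule V_stableI)
  show "(\<lambda>f. U (W f)) \<in> weyl" using assms weyl_comp'[of U W] by (simp add: V_stable_def)
  show "(\<lambda>f. U (W (Q f))) \<in> V_filtration z 1" if "Q \<in> V_filtration z 1" for Q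
  proof -
    have "(\<lambda>f. W (Q f)) \<in> V_filtration z 1" using that assms(2) by (auto simp: V_stable_def)
    then show ?thesis using assms(1) by (auto simp: V_stable_def)
  qed
qed

lemma V_stable_cst: "(\<lambda>f. cst c * f) \<in> V_stable z"
  by (rule V_stableI) (auto intro: weyl.const V_filtration_cst)

lemma V_stable_xmul: "xmul j \<in> V_stable z"
proof (rule V_stableI)
  show "(\<lambda>f. xmul j (Q f)) \<in> V_filtration z 1" if "Q \<in> V_filtration z 1" for Q
    by (rule V_filtration_antimono[OF V_filtration_xmul[OF that]]) simp
qed (rule weyl.var)

lemma V_stable_pdiff: "j \<noteq> z \<Longrightarrow> pdiff j \<in> V_stable z"
  using V_filtration_pdiff[of _ z 1 j] by (intro V_stableI weyl.diff) auto

lemma V_stable_theta: "theta z \<in> V_stable z"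
proof (rule V_stableI)
  show "(\<lambda>f. theta z (Q f)) \<in> V_filtration z 1" if "Q \<in> V_filtration z 1" for Q
    using V_filtration_xmul[OF V_filtration_pdiff[OF that, of z], of z] by (simp add: theta_def)
qed (rule theta_weyl)

lemma V_stable_add:
  assumes "U \<in> V_stable z" "W \<in> V_stable z"
  shows "(\<lambda>f. U f + W f) \<in> V_stable z"
  using assms V_filtration_add[of _ z 1] by (auto simp: V_stable_def intro: weyl.add)

lemma V_stable_zero: "(\<lambda>f. 0) \<in> V_stable z"
  by (rule V_stableI) (auto intro: weyl_zero V_filtration_zero)

lemma V_stable_sum: "(\<And>i. i \<in> I \<Longrightarrow> P i \<in> V_stable z) \<Longrightarrow> (\<lambda>f. \<Sum>i\<in>I. P i f) \<in> V_stable z"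
proof (induction I rule: infinite_finite_induct)
  case (insert i I)
  then show ?case using V_stable_add[of "P i" z "\<lambda>f. \<Sum>i\<in>I. P i f"] by simp
qed (simp_all add: V_stable_zero)

lemma V_stable_id: "id \<in> V_stable z"
  by (rule V_stableI) (auto simp: weyl_id)

lemma V_stable_mono_diff:
  assumes "Poly_Mapping.keys u \<subseteq> - {z}"
  shows "mono_diff u \<in> V_stable z"
  using assms
proof (induction rule: mono_diff_induct)
  case (comp u v)
  from V_stable_comp[OF this] show ?case by (simp only: o_def)
qed (rule V_stable_id, rule V_stable_pdiff, simp)

lemma V_stable_funpow: "U \<in> V_stable z \<Longrightarrow> U ^^ k \<in> V_stable z"
proof (induction k)
  case (Suc k)
  from V_stable_comp[OF Suc.prems Suc.IH[OF Suc.prems]] show ?case by (simp add: o_def)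
qed (use V_stable_id in \<open>simp add: id_def\<close>)

lemma V_stable_oper_poly: "oper_poly g (theta z) \<in> V_stable z"
  unfolding oper_poly_def[abs_def]
  by (rule V_stable_sum, rule V_stable_comp[OF V_stable_cst V_stable_funpow[OF V_stable_theta]])

lemma oper_poly_weyl: "oper_poly g (theta z) \<in> weyl"
  using V_stable_oper_poly[of g z] by (simp add: V_stable_def)

lemmas oper_poly_linear = mpol_linearD[OF mpol_linear_weyl[OF oper_poly_weyl]]

lemma b_ideal_iff: "b \<in> b_ideal A \<beta> z \<longleftrightarrow> oper_poly b (theta z) \<in> hyp_V A \<beta> z"
proof -
  have "xmul z \<circ> pdiff z = theta z"
    by (auto simp: theta_def)
  then show ?thesis
    by (simp add: b_ideal_def hyp_V_def)
qed

lemma poly_diff_toric_hyp: "f \<in> toric_ideal A UNIV \<Longrightarrow> poly_diff f \<in> hyp_ideal A \<beta>"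
  unfolding hyp_ideal_def by (intro left_ideal_base) auto

lemma theta_commute_oper_poly:
  "oper_poly g (theta z) (oper_poly h (theta z) f) = oper_poly h (theta z) (oper_poly g (theta z) f)"
  by (simp add: mult.commute flip: oper_poly_mult[OF theta_linear])

text \<open>The polynomial g = 0 is admissible exactly if \<open>T\<close> contains all complex
  numbers, and the set is then the whole ring. That case occurs when the whole line lies in the
  locus.\<close>

definition theta_torsion :: "int ^ 'n::finite ^ 'd::finite \<Rightarrow> complex ^ 'd \<Rightarrow> 'n \<Rightarrow> complex set \<Rightarrow> 'n mpol set" where
  "theta_torsion A \<beta> z T = {f \<in> carrier (mpol_ring (- {z})). \<exists>g. (\<forall>\<epsilon>. poly g \<epsilon> = 0 \<longrightarrow> \<epsilon> \<in> T) \<and>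
     (\<lambda>h. oper_poly g (theta z) (poly_diff f h)) \<in> hyp_V A \<beta> z}"

lemma theta_torsionI:
  assumes "f \<in> carrier (mpol_ring (- {z}))" "\<And>\<epsilon>. poly g \<epsilon> = 0 \<Longrightarrow> \<epsilon> \<in> T"
    "(\<lambda>h. oper_poly g (theta z) (poly_diff f h)) \<in> hyp_V A \<beta> z"
  shows "f \<in> theta_torsion A \<beta> z T"
  using assms by (auto simp: theta_torsion_def)

lemma oper_poly_1: "oper_poly 1 T f = f"
  by (simp add: oper_poly_def)

text \<open>Polynomials in theta commute with each other, so the product of two annihilators serves
  a sum; they also commute with the derivatives other than \<partial>_0, so an annihilator of
  \<open>f\<close> serves its multiples.\<close>

lemma ideal_theta_torsion: "ideal (theta_torsion A \<beta> z T) (mpol_ring (- {z}))"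
proof (rule mpol_idealI)
  show "0 \<in> theta_torsion A \<beta> z T"
    by (rule theta_torsionI[of _ _ 1])
      (auto simp: carrier_mpol_ring oper_poly_1 intro: V_filtration_subset_hyp_V V_filtration_zero)
next
  fix f1 f2 assume "f1 \<in> theta_torsion A \<beta> z T" "f2 \<in> theta_torsion A \<beta> z T"
  then obtain g1 g2 where *: "f1 \<in> carrier (mpol_ring (- {z}))" "f2 \<in> carrier (mpol_ring (- {z}))"
    "\<forall>\<epsilon>. poly g1 \<epsilon> = 0 \<longrightarrow> \<epsilon> \<in> T" "\<forall>\<epsilon>. poly g2 \<epsilon> = 0 \<longrightarrow> \<epsilon> \<in> T"
    "(\<lambda>h. oper_poly g1 (theta z) (poly_diff f1 h)) \<in> hyp_V A \<beta> z"
    "(\<lambda>h. oper_poly g2 (theta z) (poly_diff f2 h)) \<in> hyp_V A \<beta> z"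
    unfolding theta_torsion_def by blast
  have "oper_poly (g1 * g2) (theta z) (poly_diff (f1 + f2) h) =
     oper_poly g2 (theta z) (oper_poly g1 (theta z) (poly_diff f1 h)) +
     oper_poly g1 (theta z) (oper_poly g2 (theta z) (poly_diff f2 h))" for h
    by (simp add: oper_poly_mult[OF theta_linear] poly_diff_add oper_poly_linear theta_commute_oper_poly[of g2])
  then have "(\<lambda>h. oper_poly (g1 * g2) (theta z) (poly_diff (f1 + f2) h)) \<in> hyp_V A \<beta> z"
    using hyp_V_add[OF hyp_V_stable[OF V_stable_oper_poly *(5), of g2] hyp_V_stable[OF V_stable_oper_poly *(6), of g1]]
    by simp
  moreover have "f1 + f2 \<in> carrier (mpol_ring (- {z}))"
    using * keys_add[of f1 f2] by (auto simp: carrier_mpol_ring)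
  ultimately show "f1 + f2 \<in> theta_torsion A \<beta> z T"
    using * by (intro theta_torsionI[of _ _ "g1 * g2"]) auto
next
  fix u :: "'a mono" and c f assume u: "Poly_Mapping.keys u \<subseteq> - {z}" and "f \<in> theta_torsion A \<beta> z T"
  then obtain g where *: "f \<in> carrier (mpol_ring (- {z}))" "\<forall>\<epsilon>. poly g \<epsilon> = 0 \<longrightarrow> \<epsilon> \<in> T"
    "(\<lambda>h. oper_poly g (theta z) (poly_diff f h)) \<in> hyp_V A \<beta> z"
    unfolding theta_torsion_def by blast
  have "oper_poly g (theta z) (poly_diff (Poly_Mapping.single u c * f) h) =
     cst c * mono_diff u (oper_poly g (theta z) (poly_diff f h))" for h
    by (simp add: poly_diff_single_mult oper_poly_linear theta_mono_diff[OF u]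
      oper_poly_commute[OF mpol_linear_weyl[OF mono_diff_weyl]])
  then have "(\<lambda>h. oper_poly g (theta z) (poly_diff (Poly_Mapping.single u c * f) h)) \<in> hyp_V A \<beta> z"
    using hyp_V_stable[OF V_stable_cst hyp_V_stable[OF V_stable_mono_diff[OF u] *(3)], of c] by simp
  then show "Poly_Mapping.single u c * f \<in> theta_torsion A \<beta> z T"
    using * carrier_mpol_ring_mult[OF single_mem_carrier[OF u, of c] *(1)] by (intro theta_torsionI[of _ _ g]) auto
qed (auto simp: theta_torsion_def)

lemma toric_ideal_mono: "f \<in> toric_ideal A J \<Longrightarrow> J \<subseteq> K \<Longrightarrow> f \<in> toric_ideal A K"
  by (auto simp: toric_ideal_iff carrier_mpol_ring)

lemma toric_ideal_subset_theta_torsion: "toric_ideal A (- {z}) \<subseteq> theta_torsion A \<beta> z T"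
proof
  fix f assume f: "f \<in> toric_ideal A (- {z})"
  then have "poly_diff f \<in> hyp_V A \<beta> z"
    by (intro hyp_ideal_subset_hyp_V poly_diff_toric_hyp toric_ideal_mono[OF f]) auto
  then show "f \<in> theta_torsion A \<beta> z T"
    using f by (intro theta_torsionI[of _ _ 1]) (auto simp: oper_poly_1 toric_ideal_iff)
qed

section \<open>Residue classes in toric rings and the ideals J\<close>

lemma mem_toric_class: "x \<in> toric_class A J f \<longleftrightarrow> x - f \<in> toric_ideal A J"
proof -
  have "x \<in> toric_class A J f \<longleftrightarrow> (\<exists>h\<in>toric_ideal A J. x = h + f)"
    by (auto simp: toric_class_def a_r_coset_def r_coset_def)
  then show ?thesis by (metis add_diff_cancel diff_add_cancel)
qed

lemma toric_class_eq_iff: "toric_class A J f = toric_class A J g \<longleftrightarrow> f - g \<in> toric_ideal A J"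
proof
  note I = mpol_ideal_closed[OF ideal_toric_ideal[of A J]]
  assume "toric_class A J f = toric_class A J g"
  moreover have "f \<in> toric_class A J f" by (simp add: mem_toric_class I)
  ultimately show "f - g \<in> toric_ideal A J" by (simp add: mem_toric_class)
next
  note I = mpol_ideal_closed[OF ideal_toric_ideal[of A J]]
  assume fg: "f - g \<in> toric_ideal A J"
  have "x - f \<in> toric_ideal A J \<longleftrightarrow> x - g \<in> toric_ideal A J" for x
    using I(3)[OF fg, of "x - f"] I(6)[OF _ fg, of "x - g"] by (auto simp: algebra_simps)
  then show "toric_class A J f = toric_class A J g" by (auto simp: mem_toric_class)
qed

lemma toric_class_hom: "ring_hom_ring (mpol_ring J) (toric_ring A J) (toric_class A J)"
proof -
  have "toric_class A J = (+>\<^bsub>mpol_ring J\<^esub>) (toric_ideal A J)"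
    by (auto simp: toric_class_def)
  then show ?thesis
    unfolding toric_ring_def by (simp add: ideal.rcos_ring_hom_ring[OF ideal_toric_ideal])
qed

lemma carrier_toric_ring: "carrier (toric_ring A J) = toric_class A J ` carrier (mpol_ring J)"
  by (auto simp: toric_ring_def FactRing_def A_RCOSETS_def' toric_class_def)

lemma toric_ring_simps:
  assumes "f \<in> carrier (mpol_ring J)" "g \<in> carrier (mpol_ring J)"
  shows "toric_class A J f \<oplus>\<^bsub>toric_ring A J\<^esub> toric_class A J g = toric_class A J (f + g)"
    "toric_class A J f \<otimes>\<^bsub>toric_ring A J\<^esub> toric_class A J g = toric_class A J (f * g)"
    "toric_class A J f [^]\<^bsub>toric_ring A J\<^esub> (k::nat) = toric_class A J (f ^ k)"
    "\<zero>\<^bsub>toric_ring A J\<^esub> = toric_class A J 0" "\<one>\<^bsub>toric_ring A J\<^esub> = toric_class A J 1"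
proof -
  interpret ring_hom_ring "mpol_ring J" "toric_ring A J" "toric_class A J" by (rule toric_class_hom)
  have "f [^]\<^bsub>mpol_ring J\<^esub> k = f ^ k"
    by (induction k) (simp_all add: mult.commute)
  then show "toric_class A J f [^]\<^bsub>toric_ring A J\<^esub> (k::nat) = toric_class A J (f ^ k)"
    using hom_nat_pow[OF assms(1), of k] by simp
  show "toric_class A J f \<oplus>\<^bsub>toric_ring A J\<^esub> toric_class A J g = toric_class A J (f + g)"
    "toric_class A J f \<otimes>\<^bsub>toric_ring A J\<^esub> toric_class A J g = toric_class A J (f * g)"
    "\<zero>\<^bsub>toric_ring A J\<^esub> = toric_class A J 0" "\<one>\<^bsub>toric_ring A J\<^esub> = toric_class A J 1"
    using hom_add[OF assms] hom_mult[OF assms] hom_zero hom_one by simp_all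
qed

text \<open>The inclusion \<open>x\<^sub>0\<^sup>k R\<^sub>A\<^sub>' \<subseteq> V\<^sup>1\<close> is where the hypothesis \<open>k \<ge> 1\<close> enters.\<close>

lemma falling_in_hyp_V:
  assumes p: "p \<in> carrier (mpol_ring (- {z}))" and k: "k \<ge> 1"
    and I: "mon (Poly_Mapping.single z k + u) - p \<in> toric_ideal A UNIV"
  shows "(\<lambda>f. oper_poly (falling k) (theta z) (mono_diff u f)) \<in> hyp_V A \<beta> z"
proof -
  let ?x = "mon (Poly_Mapping.single z k) :: 'a mpol"
  have x: "(\<lambda>f. ?x * f) \<in> V_stable z"
  proof -
    have "(xmul z ^^ m) f = mon (Poly_Mapping.single z m) * f" for m f
      by (induction m) (simp_all add: xmul_def mult_single flip: mult.assoc single_add)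
    then have "xmul z ^^ k = (\<lambda>f. ?x * f)" by blast
    then show ?thesis
      using V_stable_funpow[OF V_stable_xmul, of k z z] by simp
  qed
  have "(\<lambda>f. ?x * poly_diff (mon (Poly_Mapping.single z k + u) - p) f) \<in> hyp_V A \<beta> z"
    by (rule hyp_V_stable[OF x]) (intro hyp_ideal_subset_hyp_V poly_diff_toric_hyp I)
  moreover have "(\<lambda>f. ?x * poly_diff p f) \<in> hyp_V A \<beta> z"
    using p
  proof (induction rule: carrier_mpol_ring_induct)
    case zero
    then show ?case by (simp add: V_filtration_subset_hyp_V V_filtration_zero)
  next
    case (single v c)
    have "(\<lambda>f. cst c * (?x * mono_diff v f)) \<in> V_filtration z 1"
    proof (rule V_filtration_monomial)
      have "Poly_Mapping.lookup v z = 0" using single by (auto simp: in_keys_iff)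
      then show "1 \<le> int (Poly_Mapping.lookup (Poly_Mapping.single z k) z) - int (Poly_Mapping.lookup v z)"
        using k by simp
    qed
    then show ?case
      by (simp add: poly_diff_single V_filtration_subset_hyp_V mult.left_commute)
  next
    case (add f g)
    from hyp_V_add[OF this] show ?case by (simp add: poly_diff_add distrib_left)
  qed
  ultimately have "(\<lambda>f. ?x * poly_diff (mon (Poly_Mapping.single z k + u) - p) f + ?x * poly_diff p f) \<in> hyp_V A \<beta> z"
    by (rule hyp_V_add)
  moreover have "?x * poly_diff (mon (Poly_Mapping.single z k + u) - p) f + ?x * poly_diff p f
      = oper_poly (falling k) (theta z) (mono_diff u f)" for f
    by (simp add: poly_diff_diff poly_diff_single oper_poly_falling mono_diff_add flip: distrib_left)
  ultimately show ?thesis by simp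
qed

text \<open>Membership in \<open>J_k\<close> is tested on classes, so \<open>f\<close> is first
  replaced by a congruent \<open>f'\<close> each of whose monomials meets the condition. For these,
  \<open>falling k\<close> is an annihilator with roots 0, ..., k - 1.\<close>

lemma J_k_subset_theta_torsion:
  assumes k: "k \<ge> 1" and T: "of_nat ` {0..<k} \<subseteq> T"
  shows "J_k A z k \<subseteq> theta_torsion A \<beta> z T"
proof
  fix f assume "f \<in> J_k A z k"
  then obtain f' where f: "f \<in> carrier (mpol_ring (- {z}))"
    and cl: "toric_class A (- {z}) f = toric_class A (- {z}) f'"
    and f': "\<forall>u\<in>Poly_Mapping.keys f'. Poly_Mapping.lookup u z = 0 \<and>
        toric_class A UNIV (mon (Poly_Mapping.single z 1)) [^]\<^bsub>toric_ring A UNIV\<^esub> k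
          \<otimes>\<^bsub>toric_ring A UNIV\<^esub> toric_class A UNIV (mon u) \<in> toric_subring A z"
    by (auto simp: J_k_def J_bar_k_def)
  note I = mpol_ideal_closed[OF ideal_theta_torsion[of A \<beta> z T]]
  have mon_theta_torsion: "mon u \<in> theta_torsion A \<beta> z T" if u: "u \<in> Poly_Mapping.keys f'" for u
  proof -
    have c: "h \<in> carrier (mpol_ring UNIV)" for h :: "'a mpol" by (simp add: carrier_mpol_ring)
    have pow: "mon (Poly_Mapping.single z 1) ^ k = (mon (Poly_Mapping.single z k) :: 'a mpol)"
      by (induction k) (simp_all add: mult_single flip: single_add)
    have uz: "Poly_Mapping.keys u \<subseteq> - {z}" using f' u by (auto simp: in_keys_iff)
    \<comment> \<open>A polynomial without \<partial>_0 that represents \<partial>_0^k \<partial>^u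
      in the toric ring of \<open>A\<close>.\<close>
    obtain p where p: "p \<in> carrier (mpol_ring (- {z}))"
      "toric_class A UNIV (mon (Poly_Mapping.single z k + u)) = toric_class A UNIV p"
    proof -
      have "toric_class A UNIV (mon (Poly_Mapping.single z 1)) [^]\<^bsub>toric_ring A UNIV\<^esub> k
          \<otimes>\<^bsub>toric_ring A UNIV\<^esub> toric_class A UNIV (mon u) =
          toric_class A UNIV (mon (Poly_Mapping.single z k + u))"
        by (simp only: toric_ring_simps[OF c c] pow mult_single) simp
      moreover have "toric_class A UNIV (mon (Poly_Mapping.single z 1)) [^]\<^bsub>toric_ring A UNIV\<^esub> k
          \<otimes>\<^bsub>toric_ring A UNIV\<^esub> toric_class A UNIV (mon u) \<in> toric_subring A z"
        using f' u by blast
      ultimately show ?thesis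
        using that unfolding toric_subring_def by (metis imageE)
    qed
    then have "(\<lambda>f. oper_poly (falling k) (theta z) (mono_diff u f)) \<in> hyp_V A \<beta> z"
      using k by (intro falling_in_hyp_V[of p]) (auto simp: toric_class_eq_iff)
    then show ?thesis using T uz
      by (intro theta_torsionI[of _ _ "falling k"] single_mem_carrier)
       (auto simp: poly_falling_eq_0_iff poly_diff_single)
  qed
  have "f' \<in> theta_torsion A \<beta> z T"
    using subset_refl
  proof (induction rule: poly_mapping_induct_keys)
    case (single u c)
    then have "cst c * mon u \<in> theta_torsion A \<beta> z T"
      by (intro I(4) mon_theta_torsion single_mem_carrier) auto
    then show ?case by (simp add: mult_single)
  qed (auto intro: I)
  moreover have "f - f' \<in> theta_torsion A \<beta> z T"
    using cl toric_ideal_subset_theta_torsion[of A z \<beta> T] by (auto simp: toric_class_eq_iff)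
  ultimately show "f \<in> theta_torsion A \<beta> z T"
    using I(3)[of f' "f - f'"] by simp
qed

lemma J_sum_subset_theta_torsion:
  assumes "\<And>k. k \<in> K \<Longrightarrow> k \<ge> 1 \<and> of_nat ` {0..<k} \<subseteq> T"
  shows "J_sum A z K \<subseteq> theta_torsion A \<beta> z T"
proof -
  interpret cring "mpol_ring (- {z})" by (rule cring_mpol_ring)
  show ?thesis
    unfolding J_sum_def using assms by (intro genideal_minimal[OF ideal_theta_torsion] UN_least J_k_subset_theta_torsion) auto
qed

subsection \<open>Quasi-degrees and Euler operators\<close>

text \<open>
  Replaces the existence of an associated prime: \<open>G\<close> is an ideal of monomials, and the ideal of those
  \<open>w\<close> with \<open>u + w \<in> G\<close> contains the variables outside \<open>F\<close> and no monomial in the variables \<open>F\<close>.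
\<close>

lemma monomial_ideal_face:
  fixes G :: "'n mono set"
  assumes "finite J" and zero: "0 \<notin> G"
    and up: "\<And>u v. u \<in> G \<Longrightarrow> Poly_Mapping.keys v \<subseteq> J \<Longrightarrow> u + v \<in> G"
  obtains u F where "Poly_Mapping.keys u \<subseteq> J" "F \<subseteq> J"
    "\<And>w. Poly_Mapping.keys w \<subseteq> F \<Longrightarrow> u + w \<notin> G"
    "\<And>j. j \<in> J - F \<Longrightarrow> u + Poly_Mapping.single j 1 \<in> G"
proof -
  let ?P = "\<lambda>F u. Poly_Mapping.keys u \<subseteq> J \<and> (\<forall>w. Poly_Mapping.keys w \<subseteq> F \<longrightarrow> u + w \<notin> G)"
  \<comment> \<open>The sets \<open>F\<close> for which some \<open>u\<close> has all its translates
    by monomials in \<open>F\<close> outside \<open>G\<close>; for a maximal one, every further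
    variable leads into \<open>G\<close>.\<close>
  define S where "S = {F. F \<subseteq> J \<and> (\<exists>u. ?P F u)}"
  have "finite S" using finite_subset[of S "Pow J"] \<open>finite J\<close> by (auto simp: S_def)
  moreover have "{} \<in> S" using zero by (auto simp: S_def intro!: exI[of _ 0])
  ultimately have "\<exists>F\<in>S. {} \<subseteq> F \<and> (\<forall>F'\<in>S. F \<subseteq> F' \<longrightarrow> F = F')"
    by (rule finite_has_maximal2)
  then obtain F where F': "F \<in> S" "\<And>F'. F' \<in> S \<Longrightarrow> F \<subseteq> F' \<Longrightarrow> F = F'"
    by auto
  have F: "F \<subseteq> J" "\<exists>u. ?P F u" using F'(1) by (auto simp: S_def)
  have "\<exists>u. ?P F u \<and> (\<forall>j\<in>R. u + Poly_Mapping.single j 1 \<in> G)" if "finite R" "R \<subseteq> J - F" for R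
    using that
  proof (induction R)
    case empty
    then show ?case using F(2) by blast
  next
    case (insert j R)
    then obtain u where u: "?P F u" "\<forall>j\<in>R. u + Poly_Mapping.single j 1 \<in> G" by auto
    have j: "j \<in> J" "j \<notin> F" using insert by auto
    have "insert j F \<notin> S" using F'(2)[of "insert j F"] j by auto
    then obtain w where w: "Poly_Mapping.keys w \<subseteq> insert j F" "u + w \<in> G"
      using u(1) j F(1) by (auto simp: S_def)
    \<comment> \<open>The powers of variable \<open>j\<close> that enter \<open>G\<close> up to
      monomials in \<open>F\<close>. The least one is positive, and the power before it yields the
      new \<open>u'\<close>: still outside \<open>G\<close>, but inside after one more step in
      direction \<open>j\<close>.\<close>
    let ?Q = "\<lambda>m. \<exists>w. Poly_Mapping.keys w \<subseteq> F \<and> u + w + Poly_Mapping.single j m \<in> G"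
    define w' where "w' = w - Poly_Mapping.single j (Poly_Mapping.lookup w j)"
    have "w = w' + Poly_Mapping.single j (Poly_Mapping.lookup w j)"
      by (intro poly_mapping_eqI) (auto simp: w'_def lookup_add lookup_minus lookup_single when_def)
    moreover have "Poly_Mapping.keys w' \<subseteq> F"
    proof
      fix x assume "x \<in> Poly_Mapping.keys w'"
      then have "x \<noteq> j" "x \<in> Poly_Mapping.keys w"
        by (auto simp: w'_def in_keys_iff lookup_minus lookup_single when_def split: if_splits)
      then show "x \<in> F" using w(1) by blast
    qed
    ultimately have "?Q (Poly_Mapping.lookup w j)"
      using w(2) by (metis add.assoc)
    then have Q: "?Q (LEAST m. ?Q m)" by (rule LeastI)
    define m where "m = (LEAST m. ?Q m)"
    obtain v where v: "Poly_Mapping.keys v \<subseteq> F" "u + v + Poly_Mapping.single j m \<in> G"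
      using Q unfolding m_def by blast
    have "m \<noteq> 0" using u(1) v by (metis add.right_neutral single_zero)
    then obtain m' where m': "m = Suc m'" by (cases m) auto
    have nQ: "\<not> ?Q m'" using not_less_Least[of m' ?Q] m' m_def by simp
    define u' where "u' = u + v + Poly_Mapping.single j m'"
    have "Poly_Mapping.keys u' \<subseteq> J"
    proof -
      have "Poly_Mapping.keys u' \<subseteq> Poly_Mapping.keys u \<union> Poly_Mapping.keys v \<union> {j}"
        using keys_add[of "u + v" "Poly_Mapping.single j m'"] keys_add[of u v]
        unfolding u'_def by (auto split: if_splits)
      then show ?thesis using u(1) v(1) F(1) j by blast
    qed
    moreover have "u' + w \<notin> G" if "Poly_Mapping.keys w \<subseteq> F" for w
    proof
      assume "u' + w \<in> G"
      then have "u + (v + w) + Poly_Mapping.single j m' \<in> G" by (simp add: u'_def ac_simps)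
      moreover have "Poly_Mapping.keys (v + w) \<subseteq> F" using that v(1) keys_add[of v w] by blast
      ultimately show False using nQ by blast
    qed
    moreover have "u' + Poly_Mapping.single j 1 \<in> G"
      using v(2) by (simp add: u'_def m' add.assoc flip: single_add)
    moreover have "u' + Poly_Mapping.single i 1 \<in> G" if "i \<in> R" for i
    proof -
      have "Poly_Mapping.keys (v + Poly_Mapping.single j m') \<subseteq> J"
        using v(1) F(1) j keys_add[of v "Poly_Mapping.single j m'"] by (auto split: if_splits)
      from up[OF u(2)[rule_format, OF that] this] show ?thesis
        by (simp add: u'_def ac_simps)
    qed
    ultimately show ?case by blast
  qed
  from this[of "J - F"] obtain u where "?P F u" "\<forall>j\<in>J - F. u + Poly_Mapping.single j 1 \<in> G"
    using \<open>finite J\<close> by auto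
  then show ?thesis using that[of u F] F(1) by blast
qed

section \<open>Functions polynomial in each variable, and Zariski closures\<close>

definition sep_poly :: "(('n \<Rightarrow> complex) \<Rightarrow> complex) \<Rightarrow> bool" where
  "sep_poly h \<longleftrightarrow> (\<forall>x j. \<exists>q. \<forall>t. h (x(j := t)) = poly q t)"

lemma sep_poly_const: "sep_poly (\<lambda>x. c)"
  by (auto simp: sep_poly_def intro!: exI[of _ "[:c:]"])

lemma sep_poly_proj: "sep_poly (\<lambda>x. x i)"
  unfolding sep_poly_def
proof (intro allI)
  fix x :: "'a \<Rightarrow> complex" and j
  show "\<exists>q. \<forall>t. (x(j := t)) i = poly q t"
    by (intro exI[of _ "if i = j then [:0, 1:] else [:x i:]"]) auto
qed

lemma sep_poly_add:
  assumes "sep_poly h" "sep_poly k"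
  shows "sep_poly (\<lambda>x. h x + k x)"
  unfolding sep_poly_def
proof (intro allI)
  fix x j
  obtain p q where "\<forall>t. h (x(j := t)) = poly p t" "\<forall>t. k (x(j := t)) = poly q t"
    using assms unfolding sep_poly_def by metis
  then show "\<exists>q. \<forall>t. h (x(j := t)) + k (x(j := t)) = poly q t"
    by (intro exI[of _ "p + q"]) simp
qed

lemma sep_poly_mult:
  assumes "sep_poly h" "sep_poly k"
  shows "sep_poly (\<lambda>x. h x * k x)"
  unfolding sep_poly_def
proof (intro allI)
  fix x j
  obtain p q where "\<forall>t. h (x(j := t)) = poly p t" "\<forall>t. k (x(j := t)) = poly q t"
    using assms unfolding sep_poly_def by metis
  then show "\<exists>q. \<forall>t. h (x(j := t)) * k (x(j := t)) = poly q t"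
    by (intro exI[of _ "p * q"]) simp
qed

lemma sep_poly_sum: "(\<And>i. i \<in> I \<Longrightarrow> sep_poly (h i)) \<Longrightarrow> sep_poly (\<lambda>x. \<Sum>i\<in>I. h i x)"
  by (induction I rule: infinite_finite_induct) (auto intro: sep_poly_const sep_poly_add)

lemma sep_poly_prod: "(\<And>i. i \<in> I \<Longrightarrow> sep_poly (h i)) \<Longrightarrow> sep_poly (\<lambda>x. \<Prod>i\<in>I. h i x)"
  by (induction I rule: infinite_finite_induct) (auto intro: sep_poly_const sep_poly_mult)

lemma sep_poly_power: "sep_poly h \<Longrightarrow> sep_poly (\<lambda>x. h x ^ k)"
  by (induction k) (auto intro: sep_poly_const sep_poly_mult)

text \<open>The variables are released one at a time: with the others fixed, a polynomial in one
  variable with infinitely many zeros is 0. Hence being polynomial in each variable separately is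
  enough.\<close>

lemma sep_poly_eq_0:
  fixes h :: "('n::finite \<Rightarrow> complex) \<Rightarrow> complex"
  assumes h: "sep_poly h" and X: "\<And>j. infinite (X j)"
    and zero: "\<And>x. (\<And>j. x j \<in> X j) \<Longrightarrow> h x = 0"
  shows "h x = 0"
proof -
  have "\<forall>x. (\<forall>j. j \<notin> K \<longrightarrow> x j \<in> X j) \<longrightarrow> h x = 0" if "finite K" for K
    using that
  proof (induction K)
    case (insert i K)
    show ?case
    proof (intro allI impI)
      fix x assume x: "\<forall>j. j \<notin> insert i K \<longrightarrow> x j \<in> X j"
      obtain q where q: "\<forall>t. h (x(i := t)) = poly q t" using h unfolding sep_poly_def by metis
      have "h (x(i := t)) = 0" if "t \<in> X i" for t
        using insert.IH x that by auto
      then have "X i \<subseteq> {t. poly q t = 0}" using q by auto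
      then have "q = 0" using X[of i] poly_roots_finite[of q] finite_subset by blast
      then show "h x = 0" using q[rule_format, of "x i"] by simp
    qed
  qed (use zero in auto)
  from this[of UNIV] show ?thesis by simp
qed

lemma mem_zariski_closure_iff:
  "p \<in> zariski_closure X \<longleftrightarrow> (\<forall>f. (\<forall>x\<in>X. mpol_eval f x = 0) \<longrightarrow> mpol_eval f p = 0)"
proof
  assume p: "p \<in> zariski_closure X"
  show "\<forall>f. (\<forall>x\<in>X. mpol_eval f x = 0) \<longrightarrow> mpol_eval f p = 0"
  proof (intro allI impI)
    fix f assume f: "\<forall>x\<in>X. mpol_eval f x = 0"
    have "zariski_closed {p. mpol_eval f p = 0}"
      unfolding zariski_closed_def by (intro exI[of _ "{f}"]) simp
    moreover have "X \<subseteq> {p. mpol_eval f p = 0}" using f by auto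
    ultimately have "zariski_closure X \<subseteq> {p. mpol_eval f p = 0}"
      unfolding zariski_closure_def by (intro hull_minimal)
    then show "mpol_eval f p = 0" using p by auto
  qed
next
  assume *: "\<forall>f. (\<forall>x\<in>X. mpol_eval f x = 0) \<longrightarrow> mpol_eval f p = 0"
  show "p \<in> zariski_closure X"
    unfolding zariski_closure_def hull_def
  proof safe
    fix Z assume "zariski_closed Z" "X \<subseteq> Z"
    then show "p \<in> Z" using * by (auto simp: zariski_closed_def subset_iff)
  qed
qed

lemma vec_of_int_add: "vec_of_int (a + b) = vec_of_int a + vec_of_int b"
  by (simp add: vec_of_int_def vec_eq_iff)

lemma vec_of_int_mono_degree:
  "(vec_of_int (mono_degree A u) :: complex ^ 'd::finite) =
     (\<Sum>j\<in>UNIV. of_nat (Poly_Mapping.lookup u j) *s vec_of_int (column j A))"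
  by (simp add: vec_eq_iff vec_of_int_def mono_degree_nth column_def)

text \<open>At parameters with natural entries the translate consists of degrees in
  \<open>Q\<close>; a polynomial vanishing there vanishes at all complex parameters, because there
  are infinitely many natural numbers.\<close>

lemma translate_in_zariski_closure:
  fixes F :: "'n::finite set" and A :: "int ^ 'n ^ 'd::finite"
  assumes "\<And>w. Poly_Mapping.keys w \<subseteq> F \<Longrightarrow> vec_of_int (mono_degree A (u + w)) \<in> Q"
  shows "vec_of_int (mono_degree A u) + (\<Sum>j\<in>F. t j *s vec_of_int (column j A)) \<in> zariski_closure Q"
  unfolding mem_zariski_closure_iff
proof (intro allI impI)
  fix f assume f: "\<forall>x\<in>Q. mpol_eval f x = 0"
  define p where "p x = vec_of_int (mono_degree A u) + (\<Sum>j\<in>F. x j *s vec_of_int (column j A))"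
    for x :: "'n \<Rightarrow> complex"
  have sep: "sep_poly (\<lambda>x. mpol_eval f (p x))"
    unfolding mpol_eval_def p_def vector_add_component sum_component vector_smult_component
    by (intro sep_poly_sum sep_poly_mult sep_poly_prod sep_poly_power sep_poly_add sep_poly_const sep_poly_proj)
  have inf: "infinite (range (of_nat :: nat \<Rightarrow> complex))"
    by (simp add: finite_image_iff inj_on_def)
  have zero: "mpol_eval f (p x) = 0" if x: "\<And>j. x j \<in> range of_nat" for x
  proof -
    have "\<exists>r. \<forall>j. x j = of_nat (r j)"
      using x by (intro choice allI) (auto simp: image_iff)
    then obtain r where r: "\<And>j. x j = of_nat (r j)" by blast
    define w where "w = Abs_poly_mapping (\<lambda>j. if j \<in> F then r j else 0)"
    have w: "Poly_Mapping.lookup w j = (if j \<in> F then r j else 0)" for j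
      by (simp add: w_def)
    have "p x = vec_of_int (mono_degree A (u + w))"
      by (auto simp: p_def mono_degree_add vec_of_int_add vec_of_int_mono_degree[of A w] w r
          intro!: sum.mono_neutral_cong_left)
    moreover have "Poly_Mapping.keys w \<subseteq> F" by (auto simp: in_keys_iff w split: if_splits)
    ultimately show ?thesis using f assms by auto
  qed
  have "mpol_eval f (p t) = 0" by (rule sep_poly_eq_0[OF sep inf]) (use zero in blast)
  then show "mpol_eval f (vec_of_int (mono_degree A u) + (\<Sum>j\<in>F. t j *s vec_of_int (column j A))) = 0"
    by (simp add: p_def)
qed

section \<open>Linear functionals and combinations of Euler operators\<close>

lemma separating_functional:
  fixes y :: "'a::field ^ 'd::finite"
  assumes S: "vec.subspace S" and y: "y \<notin> S"
  obtains c where "\<And>s. s \<in> S \<Longrightarrow> (\<Sum>i\<in>UNIV. c i * s $ i) = 0" "(\<Sum>i\<in>UNIV. c i * y $ i) = 1"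
proof -
  obtain B where B: "B \<subseteq> S" "vec.independent B" "S \<subseteq> vec.span B"
    using vec.maximal_independent_subset by blast
  have span: "vec.span B = S" using B S by (metis vec.span_minimal subset_antisym)
  then have ind: "vec.independent (insert y B)" using y B by (simp add: vec.independent_insertI)
  \<comment> \<open>A linear map may be prescribed on a basis of \<open>S\<close> together with
    \<open>y\<close>. Its value at \<open>y\<close> is the all-one vector, so that any row of its
    matrix serves as the functional.\<close>
  obtain g where g: "Vector_Spaces.linear (*s) (*s) g"
    "\<forall>x\<in>insert y B. g x = (if x = y then \<chi> i. 1 else 0 :: 'a ^ 'd)"
    using vec.linear_independent_extend[OF ind, of "\<lambda>x. if x = y then \<chi> i. 1 else 0 :: 'a ^ 'd"] by blast
  obtain i :: 'd where True by simp
  define c where "c = row i (matrix g)"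
  have c: "(\<Sum>k\<in>UNIV. c $ k * v $ k) = g v $ i" for v
  proof -
    have "g v = matrix g *v v" using matrix_works[OF g(1)] by simp
    then show ?thesis by (simp add: c_def row_def matrix_vector_mult_def)
  qed
  have "g s = 0" if "s \<in> S" for s
  proof -
    interpret g: Vector_Spaces.linear "(*s)" "(*s)" g by (rule g)
    have "b \<noteq> y" if "b \<in> B" for b using that B(1) y by auto
    then have "g b = 0" if "b \<in> B" for b using that g(2) by auto
    then show ?thesis using g.eq_0_on_span[of B s] that span by auto
  qed
  then show ?thesis using that[of "\<lambda>k. c $ k"] c g(2) by auto
qed

text \<open>The coefficients are indexed by \<open>F\<close> and not by vectors, since different
  columns may coincide.\<close>

lemma span_image_sum:
  assumes "finite F" "y \<in> vec.span (a ` F)"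
  shows "\<exists>t. y = (\<Sum>j\<in>F. t j *s a j)"
  using assms
proof (induction F arbitrary: y)
  case (insert i F)
  then obtain k where "y - k *s a i \<in> vec.span (a ` F)"
    by (auto simp: vec.span_breakdown_eq)
  from insert.IH[OF this] obtain t where "y - k *s a i = (\<Sum>j\<in>F. t j *s a j)" by blast
  moreover have "(\<Sum>j\<in>F. t j *s a j) = (\<Sum>j\<in>F. (t(i := k)) j *s a j)"
    using insert by (intro sum.cong) auto
  ultimately have "y = (\<Sum>j\<in>insert i F. (t(i := k)) j *s a j)"
    using insert by (simp add: algebra_simps)
  then show ?case by blast
qed simp

text \<open>The combination has the coefficient c . a_j at x_j \<partial>_j, which is 0 for j in
  \<open>F\<close>; the summand j = z is a multiple of theta.\<close>

lemma sum_euler_eq: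
  fixes c :: "'d::finite \<Rightarrow> complex" and A :: "int ^ 'n::finite ^ 'd::finite"
  assumes F: "\<And>j. j \<in> F \<Longrightarrow> (\<Sum>i\<in>UNIV. c i * of_int (A $ i $ j)) = 0" and z: "z \<notin> F"
  shows "(\<Sum>i\<in>UNIV. cst (c i) * euler A i f) =
    cst (\<Sum>i\<in>UNIV. c i * of_int (A $ i $ z)) * theta z f +
    (\<Sum>j\<in>- {z} - F. cst (\<Sum>i\<in>UNIV. c i * of_int (A $ i $ j)) * xmul j (pdiff j f))"
proof -
  define k where "k j = (\<Sum>i\<in>UNIV. c i * of_int (A $ i $ j))" for j
  have "(\<Sum>i\<in>UNIV. cst (c i) * euler A i f) =
      (\<Sum>j\<in>UNIV. \<Sum>i\<in>UNIV. cst (c i) * (cst (of_int (A $ i $ j)) * xmul j (pdiff j f)))"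
    unfolding euler_def sum_distrib_left by (rule sum.swap)
  also have "\<dots> = (\<Sum>j\<in>UNIV. cst (k j) * xmul j (pdiff j f))"
    by (simp add: k_def single_sum sum_distrib_right mult_single del: single_of_int flip: mult.assoc)
  also have "\<dots> = (\<Sum>j\<in>insert z (- {z} - F). cst (k j) * xmul j (pdiff j f))"
    using F by (intro sum.mono_neutral_right) (auto simp: k_def)
  also have "\<dots> = cst (k z) * theta z f + (\<Sum>j\<in>- {z} - F. cst (k j) * xmul j (pdiff j f))"
    by (subst sum.insert) (auto simp: theta_def)
  finally show ?thesis by (simp add: k_def)
qed

lemma euler_shift_hyp:
  "(\<lambda>f. euler A i (mono_diff u f) + cst (of_int (mono_degree A u $ i) - \<beta> $ i) * mono_diff u f)
     \<in> hyp_ideal A \<beta>"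
proof -
  have "(\<lambda>f. mono_diff u (euler A i f - cst (\<beta> $ i) * f)) \<in> hyp_ideal A \<beta>"
    unfolding hyp_ideal_def by (rule left_ideal_comp[OF left_ideal_base mono_diff_weyl]) auto
  moreover have "mono_diff u (euler A i f - cst (\<beta> $ i) * f) =
      euler A i (mono_diff u f) + cst (of_int (mono_degree A u $ i) - \<beta> $ i) * mono_diff u f" for f
  proof -
    have "euler A i f - cst (\<beta> $ i) * f = euler A i f + cst (- (\<beta> $ i)) * f"
      by (simp add: single_uminus)
    then have "mono_diff u (euler A i f - cst (\<beta> $ i) * f) =
        mono_diff u (euler A i f) + cst (- (\<beta> $ i)) * mono_diff u f"
      by (simp only: mono_diff_linear)
    then show ?thesis
      by (simp add: mono_diff_euler single_diff single_uminus algebra_simps)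
  qed
  ultimately show ?thesis by simp
qed

text \<open>The combination of the \<partial>^u (E_i - \<beta>_i) with coefficients \<open>c\<close>
  equals l(theta) \<partial>^u plus multiples of x_j \<partial>_j \<partial>^u with j outside
  \<open>F\<close> and different from z. The annihilators of \<partial>_j \<partial>^u commute with
  x_j, so their product times \<open>l\<close> annihilates \<partial>^u.\<close>

lemma theta_torsion_euler_step:
  fixes c :: "'d::finite \<Rightarrow> complex" and A :: "int ^ 'n::finite ^ 'd::finite"
  assumes F: "\<And>j. j \<in> F \<Longrightarrow> (\<Sum>i\<in>UNIV. c i * of_int (A $ i $ j)) = 0" "z \<notin> F"
    and u: "Poly_Mapping.keys u \<subseteq> - {z}"
    and theta_torsion: "\<And>j. j \<in> - {z} - F \<Longrightarrow> mon (u + Poly_Mapping.single j 1) \<in> theta_torsion A \<beta> z T"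
    and l: "l = [:- (\<Sum>i\<in>UNIV. c i * (\<beta> $ i - of_int (mono_degree A u $ i))),
        \<Sum>i\<in>UNIV. c i * of_int (A $ i $ z):]"
    and roots: "\<And>\<epsilon>. poly l \<epsilon> = 0 \<Longrightarrow> \<epsilon> \<in> T"
  shows "mon u \<in> theta_torsion A \<beta> z T"
proof -
  define R where "R = - {z} - F"
  define k where "k j = (\<Sum>i\<in>UNIV. c i * of_int (A $ i $ j))" for j
  define D where "D f = (\<Sum>i\<in>UNIV. cst (c i) *
    (euler A i (mono_diff u f) + cst (of_int (mono_degree A u $ i) - \<beta> $ i) * mono_diff u f))" for f
  have D: "D \<in> hyp_V A \<beta> z"
    unfolding D_def
    by (rule hyp_V_sum, rule hyp_V_stable[OF V_stable_cst], rule hyp_ideal_subset_hyp_V, rule euler_shift_hyp)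
  have "\<forall>j\<in>R. \<exists>g. (\<forall>\<epsilon>. poly g \<epsilon> = 0 \<longrightarrow> \<epsilon> \<in> T) \<and>
     (\<lambda>h. oper_poly g (theta z) (poly_diff (mon (u + Poly_Mapping.single j 1)) h)) \<in> hyp_V A \<beta> z"
    using theta_torsion by (auto simp: R_def theta_torsion_def)
  then obtain g where g: "\<And>j \<epsilon>. j \<in> R \<Longrightarrow> poly (g j) \<epsilon> = 0 \<Longrightarrow> \<epsilon> \<in> T"
    "\<And>j. j \<in> R \<Longrightarrow> (\<lambda>h. oper_poly (g j) (theta z) (mono_diff (u + Poly_Mapping.single j 1) h)) \<in> hyp_V A \<beta> z"
    unfolding bchoice_iff by (auto simp: poly_diff_single)
  define G where "G = (\<Prod>j\<in>R. g j)"
  have D_eq: "D f = oper_poly l (theta z) (mono_diff u f) +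
      (\<Sum>j\<in>R. cst (k j) * xmul j (mono_diff (u + Poly_Mapping.single j 1) f))" for f
  proof -
    have lin: "oper_poly l (theta z) g = cst (- (\<Sum>i\<in>UNIV. c i * (\<beta> $ i - of_int (mono_degree A u $ i)))) * g
        + cst (k z) * theta z g" for g
      by (simp add: l k_def oper_poly_pCons[OF theta_linear] mpol_linearD[OF theta_linear])
    have "D f = (\<Sum>i\<in>UNIV. cst (c i) * euler A i (mono_diff u f)) +
      (\<Sum>i\<in>UNIV. cst (c i * (of_int (mono_degree A u $ i) - \<beta> $ i))) * mono_diff u f"
      by (simp only: D_def distrib_left sum.distrib sum_distrib_right mult_single mult.assoc[symmetric]) simp
    also have "(\<Sum>i\<in>UNIV. cst (c i * (of_int (mono_degree A u $ i) - \<beta> $ i))) =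
       cst (- (\<Sum>i\<in>UNIV. c i * (\<beta> $ i - of_int (mono_degree A u $ i))))"
      by (simp add: algebra_simps flip: sum_negf single_sum)
    also have "(\<Sum>i\<in>UNIV. cst (c i) * euler A i (mono_diff u f)) = cst (k z) * theta z (mono_diff u f) +
       (\<Sum>j\<in>R. cst (k j) * xmul j (mono_diff (u + Poly_Mapping.single j 1) f))"
      by (simp only: sum_euler_eq[OF F] pdiff_mono_diff R_def k_def add.commute[of u])
    finally show ?thesis
      by (simp only: lin add_ac)
  qed
  \<comment> \<open>The sum over \<open>R\<close> moves to the other side, hence
    \<open>- k j\<close>; in each summand \<open>G\<close> is split into \<open>g j\<close>, which
    annihilates, and the remaining factors.\<close>
  have "oper_poly (G * l) (theta z) (mono_diff u f) = oper_poly G (theta z) (D f) +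
      (\<Sum>j\<in>R. cst (- k j) * xmul j (oper_poly (prod g (R - {j})) (theta z)
         (oper_poly (g j) (theta z) (mono_diff (u + Poly_Mapping.single j 1) f))))" for f
  proof -
    have comm: "oper_poly p (theta z) (xmul j f) = xmul j (oper_poly p (theta z) f)" if "j \<in> R" for j p f
    proof (rule oper_poly_commute[OF mpol_linear_weyl[OF weyl.var]])
      show "theta z (xmul j f) = xmul j (theta z f)" for f
      proof -
        have "pdiff z (xmul j f) = xmul j (pdiff z f)"
          using that by (auto simp: pdiff_xmul R_def)
        then show ?thesis by (simp add: theta_def) (simp add: xmul_def mult.left_commute)
      qed
    qed
    have G: "oper_poly G (theta z) h = oper_poly (prod g (R - {j})) (theta z) (oper_poly (g j) (theta z) h)"
      if "j \<in> R" for j h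
      using that by (simp add: G_def prod.remove[of R j] mult.commute flip: oper_poly_mult[OF theta_linear])
    have "oper_poly G (theta z) (oper_poly l (theta z) (mono_diff u f)) = oper_poly G (theta z) (D f +
      (\<Sum>j\<in>R. cst (- k j) * xmul j (mono_diff (u + Poly_Mapping.single j 1) f)))"
      by (simp add: D_eq single_uminus sum_negf)
    also have "\<dots> = oper_poly G (theta z) (D f) +
      (\<Sum>j\<in>R. cst (- k j) * xmul j (oper_poly G (theta z) (mono_diff (u + Poly_Mapping.single j 1) f)))"
      by (simp add: oper_poly_linear comm del: One_nat_def)
    finally show ?thesis
      by (simp add: oper_poly_mult[OF theta_linear] G del: One_nat_def)
  qed
  moreover have "(\<lambda>f. oper_poly G (theta z) (D f) +
      (\<Sum>j\<in>R. cst (- k j) * xmul j (oper_poly (prod g (R - {j})) (theta z)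
         (oper_poly (g j) (theta z) (mono_diff (u + Poly_Mapping.single j 1) f))))) \<in> hyp_V A \<beta> z"
    by (rule hyp_V_add, rule hyp_V_stable[OF V_stable_oper_poly D], rule hyp_V_sum,
        rule hyp_V_stable[OF V_stable_cst], rule hyp_V_stable[OF V_stable_xmul],
        rule hyp_V_stable[OF V_stable_oper_poly], rule g(2))
  ultimately have "(\<lambda>f. oper_poly (G * l) (theta z) (poly_diff (mon u) f)) \<in> hyp_V A \<beta> z"
    by (simp add: poly_diff_single)
  then show ?thesis
    using u g(1) roots by (intro theta_torsionI[of _ _ "G * l"] single_mem_carrier) (auto simp: G_def poly_prod R_def)
qed

text \<open>Otherwise \<open>monomial_ideal_face\<close> supplies a monomial \<partial>^u outside
  the ideal. Depending on how the line through \<open>p\<close> in direction a_z lies relative to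
  the span of the columns in \<open>F\<close>, a functional is chosen for which
  \<open>theta_torsion_euler_step\<close> puts \<partial>^u into the ideal after all.\<close>

lemma one_in_theta_torsion:
  fixes A :: "int ^ 'n::finite ^ 'd::finite"
  assumes Q: "\<And>u. Poly_Mapping.keys u \<subseteq> - {z} \<Longrightarrow> mon u \<notin> theta_torsion A \<beta> z T \<Longrightarrow> vec_of_int (mono_degree A u) \<in> Q"
    and T: "line_locus A \<beta> z (zariski_closure Q) \<subseteq> T"
  shows "mon 0 \<in> theta_torsion A \<beta> z T"
proof (rule ccontr)
  assume zero: "mon 0 \<notin> theta_torsion A \<beta> z T"
  note I = mpol_ideal_closed[OF ideal_theta_torsion[of A \<beta> z T]]
  have up: "u + v \<in> {u. mon u \<in> theta_torsion A \<beta> z T}" if "u \<in> {u. mon u \<in> theta_torsion A \<beta> z T}" "Poly_Mapping.keys v \<subseteq> - {z}" for u v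
    using I(4)[of "mon u" "mon v"] that single_mem_carrier[of v "- {z}" 1]
    by (simp add: mult_single add.commute)
  define G where "G = {u. mon u \<in> theta_torsion A \<beta> z T}"
  have "0 \<notin> G" using zero by (simp only: G_def mem_Collect_eq not_False_eq_True)
  then obtain u F where u: "Poly_Mapping.keys u \<subseteq> - {z}" and F: "F \<subseteq> - {z}"
    and *: "\<And>w. Poly_Mapping.keys w \<subseteq> F \<Longrightarrow> u + w \<notin> G"
    and **: "\<And>j. j \<in> - {z} - F \<Longrightarrow> u + Poly_Mapping.single j 1 \<in> G"
    using monomial_ideal_face[OF finite _ up, folded G_def] by blast
  have nG: "\<And>w. Poly_Mapping.keys w \<subseteq> F \<Longrightarrow> mon (u + w) \<notin> theta_torsion A \<beta> z T"
    and G: "\<And>j. j \<in> - {z} - F \<Longrightarrow> mon (u + Poly_Mapping.single j 1) \<in> theta_torsion A \<beta> z T"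
    using * ** by (simp_all only: G_def mem_Collect_eq not_False_eq_True)
  have Qu: "vec_of_int (mono_degree A (u + w)) \<in> Q" if "Poly_Mapping.keys w \<subseteq> F" for w
    using nG[OF that] keys_add[of u w] u that F by (intro Q) auto
  define a :: "'n \<Rightarrow> complex ^ 'd" where "a j = vec_of_int (column j A)" for j
  define p where "p = \<beta> - vec_of_int (mono_degree A u)"
  define S where "S = vec.span (a ` F)"
  \<comment> \<open>A parameter at which the line meets \<open>S\<close> comes from a quasi-degree,
    since degrees in \<open>Q\<close> are dense in the translate of \<open>S\<close>.\<close>
  have locus: "\<epsilon> \<in> T" if \<epsilon>: "p - \<epsilon> *s a z \<in> S" for \<epsilon>
  proof -
    obtain t where t: "p - \<epsilon> *s a z = (\<Sum>j\<in>F. t j *s a j)"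
      using span_image_sum[OF finite \<epsilon>[unfolded S_def]] by blast
    define q where "q = vec_of_int (mono_degree A u) + (\<Sum>j\<in>F. t j *s a j)"
    have q: "q \<in> zariski_closure Q"
      unfolding q_def a_def by (rule translate_in_zariski_closure[OF Qu])
    have "\<epsilon> *s a z = - q + \<beta>"
      using t by (simp add: p_def q_def algebra_simps)
    then have "\<epsilon> \<in> line_locus A \<beta> z (zariski_closure Q)"
      using q unfolding line_locus_def a_def by blast
    then show ?thesis using T by blast
  qed
  have a_in_S: "a j \<in> S" if "j \<in> F" for j
    using that by (auto simp: S_def vec.span_base)
  have dot: "(\<Sum>i\<in>UNIV. c i * of_int (A $ i $ j)) = (\<Sum>i\<in>UNIV. c i * a j $ i)" for c j
    by (simp add: a_def vec_of_int_def column_def)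
  have dotp: "(\<Sum>i\<in>UNIV. c i * (\<beta> $ i - of_int (mono_degree A u $ i))) = (\<Sum>i\<in>UNIV. c i * p $ i)" for c
    by (simp add: p_def vec_of_int_def)
  have dot_line: "(\<Sum>i\<in>UNIV. c i * (s + \<epsilon> *s b) $ i) = (\<Sum>i\<in>UNIV. c i * s $ i) + \<epsilon> * (\<Sum>i\<in>UNIV. c i * b $ i)"
    for c s \<epsilon> and b :: "complex ^ 'd"
    by (simp add: distrib_left sum.distrib sum_distrib_left mult.left_commute)
  have step: "mon u \<in> theta_torsion A \<beta> z T"
    if c: "\<And>j. j \<in> F \<Longrightarrow> (\<Sum>i\<in>UNIV. c i * a j $ i) = 0"
      and "\<And>\<epsilon>. poly [:- (\<Sum>i\<in>UNIV. c i * p $ i), \<Sum>i\<in>UNIV. c i * a z $ i:] \<epsilon> = 0 \<Longrightarrow> \<epsilon> \<in> T" for c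
    by (rule theta_torsion_euler_step[of F c A z u \<beta> T, OF _ _ u G refl]) (use that F in \<open>auto simp: dot dotp\<close>)
  have "mon u \<in> theta_torsion A \<beta> z T"
  proof (cases "\<exists>\<epsilon>. p - \<epsilon> *s a z \<in> S")
    \<comment> \<open>The line misses \<open>S\<close>: a functional that kills \<open>S\<close> and
      a_z but has value 1 at \<open>p\<close> makes the polynomial the constant -1, which has no
      roots.\<close>
    case False
    then have "p \<notin> vec.span (insert (a z) (a ` F))"
      by (simp add: S_def vec.span_breakdown_eq)
    then obtain c where c: "\<And>s. s \<in> vec.span (insert (a z) (a ` F)) \<Longrightarrow> (\<Sum>i\<in>UNIV. c i * s $ i) = 0"
      "(\<Sum>i\<in>UNIV. c i * p $ i) = 1"
      using separating_functional[OF vec.subspace_span] by blast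
    then show ?thesis by (intro step[of c]) (auto simp: vec.span_base)
  next
    case True
    then obtain \<epsilon>0 where e0: "p - \<epsilon>0 *s a z \<in> S" by blast
    show ?thesis
    proof (cases "a z \<in> S")
      \<comment> \<open>The line lies in \<open>S\<close>: every parameter is in \<open>T\<close>,
        and the zero functional with the zero polynomial suffices.\<close>
      case True
      have "\<epsilon> \<in> T" for \<epsilon>
      proof (rule locus)
        have "(p - \<epsilon>0 *s a z) + (\<epsilon>0 - \<epsilon>) *s a z \<in> S"
          using e0 True unfolding S_def by (intro vec.span_add vec.span_scale)
        then show "p - \<epsilon> *s a z \<in> S"
          by (simp add: vec.scale_left_diff_distrib)
      qed
      then show ?thesis by (intro step[of "\<lambda>_. 0"]) auto
    next
      \<comment> \<open>The line meets \<open>S\<close> only at the parameter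
        \<open>\<epsilon>0\<close>, and the functional yields the polynomial with this single
        root.\<close>
      case False
      then obtain c where c: "\<And>s. s \<in> S \<Longrightarrow> (\<Sum>i\<in>UNIV. c i * s $ i) = 0" "(\<Sum>i\<in>UNIV. c i * a z $ i) = 1"
        using separating_functional[OF vec.subspace_span] unfolding S_def by blast
      have "(\<Sum>i\<in>UNIV. c i * p $ i) = \<epsilon>0"
        using c(1)[OF e0] dot_line[of c "p - \<epsilon>0 *s a z" \<epsilon>0 "a z"] c(2) by simp
      then show ?thesis using c locus[OF e0] a_in_S by (intro step[of c]) auto
    qed
  qed
  then show False using nG[of 0] by simp
qed

subsection \<open>Roots of the b-function\<close>

lemma b_ideal_closed:
  assumes "p \<in> b_ideal A \<beta> z"
  shows "q \<in> b_ideal A \<beta> z \<Longrightarrow> p - q \<in> b_ideal A \<beta> z" "r * p \<in> b_ideal A \<beta> z"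
proof -
  have p: "oper_poly p (theta z) \<in> hyp_V A \<beta> z" using assms by (simp add: b_ideal_iff)
  have "oper_poly (r * p) (theta z) = (\<lambda>f. oper_poly r (theta z) (oper_poly p (theta z) f))"
    by (auto simp: oper_poly_mult[OF theta_linear])
  then show "r * p \<in> b_ideal A \<beta> z"
    using hyp_V_stable[OF V_stable_oper_poly p, of r] by (simp add: b_ideal_iff)
  assume "q \<in> b_ideal A \<beta> z"
  then have q: "oper_poly q (theta z) \<in> hyp_V A \<beta> z" by (simp add: b_ideal_iff)
  have "oper_poly (p - q) (theta z) = (\<lambda>f. oper_poly p (theta z) f + cst (-1) * oper_poly q (theta z) f)"
    by (auto simp: oper_poly_diff single_uminus)
  then show "p - q \<in> b_ideal A \<beta> z"
    using hyp_V_add[OF p hyp_V_stable[OF V_stable_cst q, of "-1"]] by (simp add: b_ideal_iff)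
qed

text \<open>Division with remainder: a nonzero remainder, made monic, would be an element of the
  ideal of smaller degree.\<close>

lemma is_b_function_dvd:
  assumes b: "is_b_function A \<beta> z b" and q: "q \<in> b_ideal A \<beta> z"
  shows "b dvd q"
proof (rule ccontr)
  assume "\<not> b dvd q"
  have b0: "b \<noteq> 0" "b \<in> b_ideal A \<beta> z" using b by (auto simp: is_b_function_def)
  define r where "r = q mod b"
  have r0: "r \<noteq> 0" using \<open>\<not> b dvd q\<close> by (simp add: r_def mod_eq_0_iff_dvd)
  then have deg: "degree r < degree b"
    using degree_mod_less[OF b0(1), of q] by (simp add: r_def)
  have "r = q - (q div b) * b" by (simp add: r_def minus_div_mult_eq_mod)
  then have "r \<in> b_ideal A \<beta> z" using b_ideal_closed q b0(2) by metis
  then have "[:inverse (lead_coeff r):] * r \<in> b_ideal A \<beta> z" by (rule b_ideal_closed(2))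
  moreover have "lead_coeff ([:inverse (lead_coeff r):] * r) = 1" using r0 by simp
  ultimately have "degree b \<le> degree ([:inverse (lead_coeff r):] * r)"
    using b by (auto simp: is_b_function_def)
  then show False using deg r0 by simp
qed

lemma is_b_function_root:
  assumes "is_b_function A \<beta> z b" "q \<in> b_ideal A \<beta> z" "poly b \<epsilon> = 0"
  shows "poly q \<epsilon> = 0"
  using is_b_function_dvd[OF assms(1,2)] assms(3) by auto

lemma is_b_function_root_theta_torsion:
  assumes b: "is_b_function A \<beta> z b" and "mon 0 \<in> theta_torsion A \<beta> z T" and \<epsilon>: "poly b \<epsilon> = 0"
  shows "\<epsilon> \<in> T"
proof -
  obtain g where g: "\<forall>\<epsilon>. poly g \<epsilon> = 0 \<longrightarrow> \<epsilon> \<in> T"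
    "(\<lambda>h. oper_poly g (theta z) (poly_diff (mon 0) h)) \<in> hyp_V A \<beta> z"
    using assms(2) unfolding theta_torsion_def by blast
  have "poly_diff (mon 0) h = h" for h :: "'a mpol"
    by (simp only: poly_diff_single mono_diff_0) simp
  then have "g \<in> b_ideal A \<beta> z" using g(2) by (simp add: b_ideal_iff)
  from is_b_function_root[OF b this \<epsilon>] show ?thesis using g(1) by blast
qed

text \<open>The torsion ideal contains both J and the toric ideal, so a monomial outside it is not
  congruent to any element of J, and its class survives in the quotient of the toric ring of
  A'.\<close>

lemma degree_mem_quotient_degrees:
  assumes u: "Poly_Mapping.keys u \<subseteq> - {z}" and notin: "mon u \<notin> theta_torsion A \<beta> z T"
    and J: "J_ideal A z \<subseteq> theta_torsion A \<beta> z T"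
  shows "vec_of_int (mono_degree A u) \<in> {vec_of_int \<alpha> | \<alpha>.
     \<exists>y\<in>(\<lambda>y. J_bar A z +>\<^bsub>toric_ring A (- {z})\<^esub> y) ` toric_component A (- {z}) \<alpha>.
       y \<noteq> \<zero>\<^bsub>toric_ring A (- {z}) Quot J_bar A z\<^esub>}"
proof -
  let ?S = "toric_ring A (- {z})" and ?cl = "toric_class A (- {z})"
  have mu: "mon u \<in> carrier (mpol_ring (- {z}))" using u by (rule single_mem_carrier)
  have "?cl (mon u) \<in> toric_component A (- {z}) (mono_degree A u)"
    using mu by (auto simp: toric_component_def)
  moreover have "J_bar A z +>\<^bsub>?S\<^esub> ?cl (mon u) \<noteq> \<zero>\<^bsub>?S Quot J_bar A z\<^esub>"
  proof
    assume "J_bar A z +>\<^bsub>?S\<^esub> ?cl (mon u) = \<zero>\<^bsub>?S Quot J_bar A z\<^esub>"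
    then have eq: "J_bar A z +>\<^bsub>?S\<^esub> ?cl (mon u) = J_bar A z" by (simp add: FactRing_def)
    interpret cring "mpol_ring (- {z})" by (rule cring_mpol_ring)
    have Jid: "ideal (J_ideal A z) (mpol_ring (- {z}))"
      unfolding J_ideal_def J_sum_def by (rule genideal_ideal) (auto simp: J_k_def)
    have zero: "0 \<in> carrier (mpol_ring (- {z}))" by (simp add: carrier_mpol_ring)
    have "?cl 0 \<in> J_bar A z"
      using mpol_ideal_closed(2)[OF Jid] by (auto simp: J_bar_def)
    then have "?cl 0 \<oplus>\<^bsub>?S\<^esub> ?cl (mon u) \<in> J_bar A z +>\<^bsub>?S\<^esub> ?cl (mon u)"
      by (auto simp: a_r_coset_def r_coset_def)
    then have "?cl (mon u) \<in> J_bar A z"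
      unfolding eq by (simp add: toric_ring_simps[OF zero mu])
    then obtain f where f: "f \<in> J_ideal A z" "?cl (mon u) = ?cl f" by (auto simp: J_bar_def)
    then have "mon u - f \<in> theta_torsion A \<beta> z T"
      using toric_ideal_subset_theta_torsion[of A z \<beta> T] by (auto simp: toric_class_eq_iff)
    then have "mon u - f + f \<in> theta_torsion A \<beta> z T"
      using f(1) J by (intro mpol_ideal_closed(3)[OF ideal_theta_torsion]) auto
    then show False using notin by simp
  qed
  ultimately show ?thesis by blast
qed

text \<open>\<open>X\<close> takes the exceptional integers and \<open>K\<close> the indices of the
  ideals that sum up to J; the claim with all natural numbers and the claim with a bound k are both
  instances.\<close>

lemma b_function_roots:
  assumes b: "is_b_function A \<beta> z b" and \<epsilon>: "poly b \<epsilon> = 0"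
    and J: "J_ideal A z = J_sum A z K"
    and K: "\<And>k. k \<in> K \<Longrightarrow> k \<ge> 1 \<and> of_nat ` {0..<k} \<subseteq> X"
  shows "\<epsilon> \<in> X \<or> \<epsilon> \<in> line_locus A \<beta> z (qdeg_toric_quot A (- {z}) (J_bar A z))"
proof -
  let ?T = "X \<union> line_locus A \<beta> z (qdeg_toric_quot A (- {z}) (J_bar A z))"
  have "J_ideal A z \<subseteq> theta_torsion A \<beta> z ?T"
    unfolding J using K by (intro J_sum_subset_theta_torsion) auto
  note deg = degree_mem_quotient_degrees[OF _ _ this]
  have "mon 0 \<in> theta_torsion A \<beta> z ?T"
    by (rule one_in_theta_torsion, rule deg, assumption, assumption)
      (auto simp: qdeg_toric_quot_def qdeg_def)
  from is_b_function_root_theta_torsion[OF b this \<epsilon>] show ?thesis by blast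
qed

section \<open>The case of a column in the cone of the others\<close>

lemma integer_combination:
  fixes A :: "int ^ 'n::finite ^ 'd::finite" and y :: "int ^ 'd"
  assumes y: "(vec_of_int y :: real ^ 'd) = (\<Sum>j\<in>J. w j *\<^sub>R vec_of_int (column j A))"
  obtains q p where "q > 0" "\<And>j. j \<in> J \<Longrightarrow> w j \<ge> 0 \<Longrightarrow> p j \<ge> (0::int)"
    "q *s y = (\<Sum>j\<in>J. p j *s column j A)"
proof -
  \<comment> \<open>\<open>N\<close> exceeds the sum of the absolute values of all entries. Rounding
    the \<open>q\<close>-fold coefficients with errors below 1/N then changes each coordinate by
    less than 1, and as both sides are integers the rounded relation is exact.\<close>
  define N where "N = Suc (nat (\<Sum>i\<in>UNIV. \<Sum>j\<in>UNIV. \<bar>A $ i $ j\<bar>))"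
  obtain h :: "nat \<Rightarrow> 'n" where h: "bij_betw h {0..<CARD('n)} UNIV"
    using ex_bij_betw_nat_finite[of "UNIV :: 'n set"] by auto
  have "N > 0" by (simp add: N_def)
  then obtain q p' where q: "0 < q" and p': "\<And>i. i < CARD('n) \<Longrightarrow> \<bar>of_int q * w (h i) - of_int (p' i)\<bar> < 1 / real N"
    by (rule Dirichlet_approx_simult[of N "CARD('n)" "\<lambda>i. w (h i)"]) auto
  define p where "p j = p' (inv_into {0..<CARD('n)} h j)" for j
  have p: "\<bar>of_int q * w j - of_int (p j)\<bar> < 1 / real N" for j
  proof -
    have "j \<in> h ` {0..<CARD('n)}" using h by (simp add: bij_betw_def)
    then show ?thesis
      using p'[of "inv_into {0..<CARD('n)} h j"] inv_into_into[of j h "{0..<CARD('n)}"] f_inv_into_f[of j h "{0..<CARD('n)}"]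
      by (simp add: p_def)
  qed
  \<comment> \<open>The rounding error is below 1, so an integer approximating a nonnegative number
    is greater than -1.\<close>
  have pos: "p j \<ge> 0" if "w j \<ge> 0" for j
  proof -
    have "1 / real N \<le> 1" by (simp add: N_def)
    moreover have "of_int q * w j \<ge> 0" using that q by simp
    ultimately have "real_of_int (p j) > - 1" using p[of j] by linarith
    then show ?thesis by linarith
  qed
  have "q * y $ i = (\<Sum>j\<in>J. p j * A $ i $ j)" for i
  proof -
    have yi: "real_of_int (y $ i) = (\<Sum>j\<in>J. w j * of_int (A $ i $ j))"
      using arg_cong[OF y, of "\<lambda>v. v $ i"] by (simp add: vec_of_int_def column_def)
    have "\<bar>real_of_int (q * y $ i - (\<Sum>j\<in>J. p j * A $ i $ j))\<bar> =
        \<bar>\<Sum>j\<in>J. (of_int q * w j - of_int (p j)) * of_int (A $ i $ j)\<bar>"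
      by (simp add: yi sum_distrib_left left_diff_distrib sum_subtractf mult.assoc)
    also have "\<dots> \<le> (\<Sum>j\<in>J. \<bar>of_int q * w j - of_int (p j)\<bar> * \<bar>of_int (A $ i $ j)\<bar>)"
      by (rule order_trans[OF sum_abs]) (simp add: abs_mult)
    also have "\<dots> \<le> (\<Sum>j\<in>J. 1 / real N * \<bar>of_int (A $ i $ j)\<bar>)"
      using p by (intro sum_mono mult_right_mono) (auto intro: less_imp_le)
    also have "\<dots> = 1 / real N * of_int (\<Sum>j\<in>J. \<bar>A $ i $ j\<bar>)"
      by (simp add: sum_distrib_left)
    also have "\<dots> < 1"
    proof -
      have "(\<Sum>j\<in>J. \<bar>A $ i $ j\<bar>) \<le> (\<Sum>j\<in>UNIV. \<bar>A $ i $ j\<bar>)"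
        by (intro sum_mono2) auto
      also have "\<dots> \<le> (\<Sum>i\<in>UNIV. \<Sum>j\<in>UNIV. \<bar>A $ i $ j\<bar>)"
        by (rule member_le_sum[of i UNIV "\<lambda>i. \<Sum>j\<in>UNIV. \<bar>A $ i $ j\<bar>"]) (auto intro: sum_nonneg)
      also have "\<dots> < int N" by (simp add: N_def)
      finally have "real_of_int (\<Sum>j\<in>J. \<bar>A $ i $ j\<bar>) < real N" by linarith
      then show ?thesis using \<open>N > 0\<close> by (simp add: divide_simps)
    qed
    finally show ?thesis by linarith
  qed
  then have "q *s y = (\<Sum>j\<in>J. p j *s column j A)"
    by (simp add: vec_eq_iff column_def)
  then show ?thesis using that[of q p] q pos by auto
qed

lemma multiple_in_semigroup:
  assumes "(vec_of_int (column z A) :: real ^ 'd::finite) \<in> real_cone A (- {z})"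
  shows "\<exists>t::nat. 1 \<le> t \<and> int t *s column z A \<in> semigroup_of A (- {z})"
proof -
  obtain w where w: "(vec_of_int (column z A) :: real ^ 'd) = (\<Sum>j\<in>- {z}. w j *\<^sub>R vec_of_int (column j A))"
    "\<forall>j\<in>- {z}. w j \<ge> 0"
    using assms by (auto simp: real_cone_def)
  obtain q p where q: "q > 0" "\<And>j. j \<in> - {z} \<Longrightarrow> w j \<ge> 0 \<Longrightarrow> p j \<ge> (0::int)"
    "q *s column z A = (\<Sum>j\<in>- {z}. p j *s column j A)"
    by (rule integer_combination[OF w(1)]) blast
  define v where "v = Abs_poly_mapping (\<lambda>j. if j = z then 0 else nat (p j))"
  have v: "Poly_Mapping.lookup v j = (if j = z then 0 else nat (p j))" for j
    by (simp add: v_def)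
  have "mono_degree A v = (\<Sum>j\<in>- {z}. p j *s column j A)"
    unfolding mono_degree_def using q(2) w(2) by (intro sum.mono_neutral_cong_right) (auto simp: v)
  moreover have "Poly_Mapping.keys v \<subseteq> - {z}" by (auto simp: in_keys_iff v)
  ultimately have "int (nat q) *s column z A \<in> semigroup_of A (- {z})"
    using q(1,3) by (auto simp: semigroup_of_def image_iff intro!: exI[of _ v])
  then show ?thesis using q(1) by (intro exI[of _ "nat q"]) auto
qed

text \<open>The case u = 0 of \<open>falling_in_hyp_V\<close>: \<partial>_0^t is congruent to a
  monomial in the variables of A'.\<close>

lemma falling_in_b_ideal:
  assumes "1 \<le> t" "int t *s column z A \<in> semigroup_of A (- {z})"
  shows "falling t \<in> b_ideal A \<beta> z"
proof -
  obtain v where v: "Poly_Mapping.keys v \<subseteq> - {z}" "int t *s column z A = mono_degree A v"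
    using assms(2) by (auto simp: semigroup_of_def)
  have "mon (Poly_Mapping.single z t + 0) - mon v \<in> toric_ideal A UNIV"
    by (rule mon_diff_in_toric_ideal) (auto simp: mono_degree_single v(2))
  from falling_in_hyp_V[OF single_mem_carrier[OF v(1)] assms(1) this] show ?thesis
    by (simp add: b_ideal_iff)
qed

lemma b_function_roots_cone:
  assumes b: "is_b_function A \<beta> z b" and \<epsilon>: "poly b \<epsilon> = 0"
    and cone: "(vec_of_int (column z A) :: real ^ 'd::finite) \<in> real_cone A (- {z})"
  shows "\<epsilon> \<in> of_nat ` {0..<(LEAST t. 1 \<le> t \<and> int t *s column z A \<in> semigroup_of A (- {z}))}"
proof -
  let ?P = "\<lambda>t::nat. 1 \<le> t \<and> int t *s column z A \<in> semigroup_of A (- {z})"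
  have "?P (LEAST t. ?P t)" using multiple_in_semigroup[OF cone] by (rule LeastI_ex)
  then have "falling (LEAST t. ?P t) \<in> b_ideal A \<beta> z"
    using falling_in_b_ideal by blast
  from is_b_function_root[OF b this \<epsilon>] show ?thesis by (simp add: poly_falling_eq_0_iff)
qed

subsection \<open>A formal series annihilated by the hypergeometric ideal\<close>

text \<open>
  The operators act on formal series \<open>\<Sum>\<^sub>w \<psi>(w) x\<^sup>\<gamma>\<^sup>+\<^sup>w / \<Gamma>(\<gamma> + w + 1)\<close> over \<open>w \<in> \<int>\<^sup>n\<^sup>+\<^sup>1\<close>; in these
  coordinates the formulas make sense for every exponent \<open>\<gamma>\<close>.
\<close>

inductive series_action ::
  "'n oper \<Rightarrow> (('n \<Rightarrow> complex) \<Rightarrow> (('n \<Rightarrow> int) \<Rightarrow> complex) \<Rightarrow> ('n \<Rightarrow> int) \<Rightarrow> complex) \<Rightarrow> bool" where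
  const: "series_action (\<lambda>f. cst c * f) (\<lambda>\<gamma> \<psi> w. c * \<psi> w)"
| var: "series_action (xmul j) (\<lambda>\<gamma> \<psi> w. (\<gamma> j + of_int (w j)) * \<psi> (w(j := w j - 1)))"
| diff: "series_action (pdiff j) (\<lambda>\<gamma> \<psi> w. \<psi> (w(j := w j + 1)))"
| add: "series_action P S \<Longrightarrow> series_action Q T \<Longrightarrow>
    series_action (\<lambda>f. P f + Q f) (\<lambda>\<gamma> \<psi> w. S \<gamma> \<psi> w + T \<gamma> \<psi> w)"
| comp: "series_action P S \<Longrightarrow> series_action Q T \<Longrightarrow>
    series_action (P \<circ> Q) (\<lambda>\<gamma> \<psi>. S \<gamma> (T \<gamma> \<psi>))"

text \<open>Only existence: an operator has many expressions through the generators, and that all of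
  them act alike is the content of \<open>series_action_unique\<close>.\<close>

lemma weyl_series_action: "P \<in> weyl \<Longrightarrow> \<exists>T. series_action P T"
proof (induction rule: weyl.induct)
  case (add P Q)
  then obtain S T where "series_action P S" "series_action Q T" by blast
  from series_action.add[OF this] show ?case
    by (rule exI[of _ "\<lambda>\<gamma> \<psi> w. S \<gamma> \<psi> w + T \<gamma> \<psi> w"])
next
  case (comp P Q)
  then obtain S T where "series_action P S" "series_action Q T" by blast
  from series_action.comp[OF this] show ?case by (rule exI[of _ "\<lambda>\<gamma> \<psi>. S \<gamma> (T \<gamma> \<psi>)"])
qed (rule exI, rule series_action.intros)+

text \<open>The formulas involve the exponent only through \<gamma> + w, so an integer shift can be
  moved from \<open>w\<close> to \<open>\<gamma>\<close>.\<close>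

lemma series_action_translate:
  assumes "series_action P T"
  shows "T \<gamma> \<psi> (\<lambda>j. w j + k j) = T (\<lambda>j. \<gamma> j + of_int (k j)) (\<lambda>v. \<psi> (\<lambda>j. v j + k j)) w"
  using assms
proof (induction arbitrary: \<psi> w)
  case (const c)
  show ?case by simp
next
  case (var j)
  have upd: "(\<lambda>j. w j + k j)(j := w j + k j - 1) = (\<lambda>i. (w(j := w j - 1)) i + k i)" by auto
  show ?case by (simp only: upd of_int_add add.assoc add.commute[of "of_int (k j)"])
next
  case (diff j)
  have upd: "(\<lambda>j. w j + k j)(j := w j + k j + 1) = (\<lambda>i. (w(j := w j + 1)) i + k i)" by auto
  show ?case by (simp only: upd)
next
  case (comp P S Q T)
  have "(\<lambda>v. T \<gamma> \<psi> (\<lambda>j. v j + k j)) = T (\<lambda>j. \<gamma> j + of_int (k j)) (\<lambda>v. \<psi> (\<lambda>j. v j + k j))"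
    using comp.IH(2) by blast
  then show ?case using comp.IH(1)[of "T \<gamma> \<psi>" w] by simp
next
  case (add P S Q T)
  then show ?case by metis
qed

lemma series_action_sep_poly:
  assumes "series_action P T" "\<And>w. sep_poly (\<lambda>\<gamma>. \<Psi> \<gamma> w)"
  shows "sep_poly (\<lambda>\<gamma>. T \<gamma> (\<Psi> \<gamma>) w)"
  using assms
proof (induction arbitrary: \<Psi> w)
  case (const c)
  show ?case by (intro sep_poly_mult sep_poly_const const)
next
  case (var j)
  show ?case by (intro sep_poly_mult sep_poly_add sep_poly_const sep_poly_proj var)
next
  case (add P S Q T)
  show ?case by (intro sep_poly_add add.IH add.prems)
next
  case (comp P S Q T)
  show ?case by (rule comp.IH(1)[of "\<lambda>\<gamma>. T \<gamma> (\<Psi> \<gamma>)"], rule comp.IH(2), rule comp.prems)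
qed

text \<open>Each generator reads \<open>\<psi>\<close> within distance one of \<open>w\<close>, and
  radii add up under composition. The radius depends neither on \<open>\<gamma>\<close> nor on
  \<open>\<psi>\<close>, which makes it possible to cut \<open>\<psi>\<close> off.\<close>

lemma series_action_local:
  fixes P :: "'n oper"
  assumes "series_action P T"
  shows "\<exists>N\<ge>0. \<forall>\<gamma> \<psi> \<psi>' w. (\<forall>v. (\<forall>j. \<bar>v j - w j\<bar> \<le> N) \<longrightarrow> \<psi> v = \<psi>' v) \<longrightarrow> T \<gamma> \<psi> w = T \<gamma> \<psi>' w"
  using assms
proof induction
  case (const c)
  then show ?case by (intro exI[of _ 0]) auto
next
  case (var j)
  then show ?case by (intro exI[of _ 1]) auto
next
  case (diff j)
  then show ?case by (intro exI[of _ 1]) auto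
next
  case (add P S Q T)
  then obtain M N where *: "M \<ge> 0" "N \<ge> 0"
    "\<And>\<gamma> \<psi> \<psi>' w. (\<And>v. (\<And>j. \<bar>v j - w j\<bar> \<le> M) \<Longrightarrow> \<psi> v = \<psi>' v) \<Longrightarrow> S \<gamma> \<psi> w = S \<gamma> \<psi>' w"
    "\<And>\<gamma> \<psi> \<psi>' w. (\<And>v. (\<And>j. \<bar>v j - w j\<bar> \<le> N) \<Longrightarrow> \<psi> v = \<psi>' v) \<Longrightarrow> T \<gamma> \<psi> w = T \<gamma> \<psi>' w"
    by blast
  show ?case
  proof (intro exI[of _ "M + N"] conjI allI impI)
    fix \<gamma> and \<psi> \<psi>' :: "('n \<Rightarrow> int) \<Rightarrow> complex" and w
    assume a: "\<forall>v. (\<forall>j. \<bar>v j - w j\<bar> \<le> M + N) \<longrightarrow> \<psi> v = \<psi>' v"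
    have "\<psi> v = \<psi>' v" if "\<And>j. \<bar>v j - w j\<bar> \<le> M" for v
      using a that *(2) by (meson add_increasing2)
    moreover have "\<psi> v = \<psi>' v" if "\<And>j. \<bar>v j - w j\<bar> \<le> N" for v
      using a that *(1) by (meson add_increasing)
    ultimately show "S \<gamma> \<psi> w + T \<gamma> \<psi> w = S \<gamma> \<psi>' w + T \<gamma> \<psi>' w"
      using *(3,4) by metis
  qed (use * in auto)
next
  case (comp P S Q T)
  then obtain M N where *: "M \<ge> 0" "N \<ge> 0"
    "\<And>\<gamma> \<psi> \<psi>' w. (\<And>v. (\<And>j. \<bar>v j - w j\<bar> \<le> M) \<Longrightarrow> \<psi> v = \<psi>' v) \<Longrightarrow> S \<gamma> \<psi> w = S \<gamma> \<psi>' w"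
    "\<And>\<gamma> \<psi> \<psi>' w. (\<And>v. (\<And>j. \<bar>v j - w j\<bar> \<le> N) \<Longrightarrow> \<psi> v = \<psi>' v) \<Longrightarrow> T \<gamma> \<psi> w = T \<gamma> \<psi>' w"
    by blast
  show ?case
  proof (intro exI[of _ "M + N"] conjI allI impI)
    fix \<gamma> and \<psi> \<psi>' :: "('n \<Rightarrow> int) \<Rightarrow> complex" and w
    assume a: "\<forall>v. (\<forall>j. \<bar>v j - w j\<bar> \<le> M + N) \<longrightarrow> \<psi> v = \<psi>' v"
    show "S \<gamma> (T \<gamma> \<psi>) w = S \<gamma> (T \<gamma> \<psi>') w"
    proof (rule *(3))
      fix v assume v: "\<And>j. \<bar>v j - w j\<bar> \<le> M"
      show "T \<gamma> \<psi> v = T \<gamma> \<psi>' v"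
      proof (rule *(4))
        fix v' assume v': "\<And>j. \<bar>v' j - v j\<bar> \<le> N"
        have "\<bar>v' j - w j\<bar> \<le> M + N" for j using v[of j] v'[of j] by linarith
        then show "\<psi> v' = \<psi>' v'" using a by blast
      qed
    qed
  qed (use * in auto)
qed

section \<open>Comparison with the action on polynomials\<close>

definition mfact :: "'n::finite mono \<Rightarrow> complex" where
  "mfact m = (\<Prod>j\<in>UNIV. fact (Poly_Mapping.lookup m j))"

lemma mfact_nonzero: "mfact m \<noteq> 0"
  by (simp add: mfact_def)

lemma mfact_add_single:
  "mfact (m + Poly_Mapping.single j 1) = of_nat (Poly_Mapping.lookup m j + 1) * mfact m"
proof -
  have "(\<Prod>i\<in>UNIV - {j}. fact (Poly_Mapping.lookup (m + Poly_Mapping.single j 1) i) :: complex) =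
      (\<Prod>i\<in>UNIV - {j}. fact (Poly_Mapping.lookup m i))"
    by (intro prod.cong) (auto simp: lookup_add lookup_single)
  then show ?thesis
    by (simp add: mfact_def prod.remove[of UNIV j] lookup_add)
qed

definition int_exp :: "'n mono \<Rightarrow> 'n \<Rightarrow> int" where
  "int_exp m j = int (Poly_Mapping.lookup m j)"

text \<open>At natural exponents the normalising \<Gamma>-factor is \<open>mfact\<close>. Values of
  \<open>\<psi>\<close> outside the natural vectors do not matter: only \<open>xmul j\<close> could
  reach them, from an entry 0 of the exponent, where its factor is 0.\<close>

lemma series_action_polynomial:
  assumes "series_action P T" "\<And>m. \<psi> (int_exp m) = mfact m * Poly_Mapping.lookup f m"
  shows "T (\<lambda>_. 0) \<psi> (int_exp m) = mfact m * Poly_Mapping.lookup (P f) m"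
  using assms
proof (induction arbitrary: \<psi> f m)
  case (const c)
  have "Poly_Mapping.lookup (cst c * f) m = c * Poly_Mapping.lookup f m"
    by (induction f rule: poly_mapping_induct_single)
      (auto simp: distrib_left lookup_add mult_single lookup_single when_def)
  then show ?case by (simp add: const)
next
  case (var j)
  show ?case
  proof (cases "Poly_Mapping.lookup m j = 0")
    case True
    then show ?thesis
      by (auto simp: int_exp_def xmul_def lookup_mon_mult lookup_single dest: spec[of _ j])
  next
    case False
    define n where "n = m - Poly_Mapping.single j 1"
    have m: "m = n + Poly_Mapping.single j 1"
      using False by (intro poly_mapping_eqI) (auto simp: n_def lookup_add lookup_minus lookup_single when_def)
    have "(int_exp m)(j := int_exp m j - 1) = int_exp n"
      by (auto simp: int_exp_def m lookup_add lookup_single fun_eq_iff)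
    moreover have "Poly_Mapping.lookup (xmul j f) m = Poly_Mapping.lookup f n"
      by (auto simp: xmul_def lookup_mon_mult m lookup_add)
    moreover have "of_int (int_exp m j) = (of_nat (Poly_Mapping.lookup n j + 1) :: complex)"
      by (simp add: int_exp_def m lookup_add)
    ultimately show ?thesis
      by (simp add: var m mfact_add_single del: of_nat_add One_nat_def)
  qed
next
  case (diff j)
  have "(int_exp m)(j := int_exp m j + 1) = int_exp (m + Poly_Mapping.single j 1)"
    by (auto simp: int_exp_def lookup_add lookup_single fun_eq_iff)
  then show ?case
    by (simp add: diff lookup_pdiff mfact_add_single mult.left_commute del: of_nat_add One_nat_def)
next
  case (add P S Q T)
  show ?case
    by (simp only: add.IH(1)[OF add.prems] add.IH(2)[OF add.prems] lookup_add distrib_left)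
next
  case (comp P S Q T)
  show ?case
    using comp.IH(1)[of "T (\<lambda>_. 0) \<psi>" "Q f", OF comp.IH(2)[OF comp.prems]] by simp
qed

lemma finite_bounded_monos: "finite {m :: 'n::finite mono. \<forall>j. Poly_Mapping.lookup m j \<le> B}"
proof (rule finite_imageD)
  have "Poly_Mapping.lookup ` {m :: 'n mono. \<forall>j. Poly_Mapping.lookup m j \<le> B} \<subseteq> PiE UNIV (\<lambda>_. {..B})"
    by auto
  then show "finite (Poly_Mapping.lookup ` {m :: 'n mono. \<forall>j. Poly_Mapping.lookup m j \<le> B})"
    by (rule finite_subset) (auto intro: finite_PiE)
  show "inj_on Poly_Mapping.lookup {m :: 'n mono. \<forall>j. Poly_Mapping.lookup m j \<le> B}"
    by (rule inj_onI) (simp only: poly_mapping_eq_iff)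
qed

text \<open>
  By translation, the action at exponent \<open>\<gamma>\<close> with large natural entries is the action on polynomials;
  these \<open>\<gamma>\<close> determine a polynomial in \<open>\<gamma>\<close>.
\<close>

lemma series_action_unique:
  fixes P :: "'n::finite oper"
  assumes S: "series_action P S" and T: "series_action P T"
  shows "S \<gamma> \<psi> w = T \<gamma> \<psi> w"
proof -
  obtain M where M: "M \<ge> 0" "\<And>\<gamma> \<psi> \<psi>' w. (\<And>v. (\<And>j. \<bar>v j - w j\<bar> \<le> M) \<Longrightarrow> \<psi> v = \<psi>' v) \<Longrightarrow> S \<gamma> \<psi> w = S \<gamma> \<psi>' w"
    using series_action_local[OF S] by blast
  obtain N where N: "N \<ge> 0" "\<And>\<gamma> \<psi> \<psi>' w. (\<And>v. (\<And>j. \<bar>v j - w j\<bar> \<le> N) \<Longrightarrow> \<psi> v = \<psi>' v) \<Longrightarrow> T \<gamma> \<psi> w = T \<gamma> \<psi>' w"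
    using series_action_local[OF T] by blast
  define B where "B = nat (max M N)"
  have B: "M \<le> int B" "N \<le> int B" using M(1) N(1) by (auto simp: B_def)
  have "sep_poly (\<lambda>\<gamma>. S \<gamma> \<psi> w + (- 1) * T \<gamma> \<psi> w)"
    by (intro sep_poly_add sep_poly_mult sep_poly_const series_action_sep_poly[OF S] series_action_sep_poly[OF T])
  then have "S \<gamma> \<psi> w + (- 1) * T \<gamma> \<psi> w = 0"
  proof (rule sep_poly_eq_0)
    show "infinite (of_nat ` {k. \<bar>w j\<bar> + int B \<le> int k} :: complex set)" for j
    proof -
      have "infinite {k. nat (\<bar>w j\<bar> + int B) \<le> k}"
        using infinite_Ici[of "nat (\<bar>w j\<bar> + int B)"] by (simp add: atLeast_def)
      then have "infinite {k. \<bar>w j\<bar> + int B \<le> int k}" by (simp add: nat_le_iff)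
      then show ?thesis by (simp add: finite_image_iff inj_on_def)
    qed
    fix x assume "\<And>j. x j \<in> (of_nat ` {k. \<bar>w j\<bar> + int B \<le> int k} :: complex set)"
    then have "\<exists>k. \<forall>j. x j = of_nat (k j) \<and> \<bar>w j\<bar> + int B \<le> int (k j)"
      by (intro choice allI) (auto simp: image_iff)
    then obtain k where k: "\<And>j. x j = of_nat (k j)" "\<And>j. \<bar>w j\<bar> + int B \<le> int (k j)" by blast
    \<comment> \<open>The entries of \<open>k\<close> are so large that w + k is the exponent of a
      monomial.\<close>
    define m :: "'n mono" where "m = Abs_poly_mapping (\<lambda>j. nat (w j + int (k j)))"
    have m: "int_exp m = (\<lambda>j. w j + int (k j))"
    proof
      fix j
      have "w j + int (k j) \<ge> 0" using k(2)[of j] by linarith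
      then show "int_exp m j = w j + int (k j)" by (simp add: int_exp_def m_def)
    qed
    \<comment> \<open>Cutting \<open>\<psi>\<close> off outside a finite box yields, up to
      \<open>mfact\<close>, the coefficients of a polynomial \<open>f\<close>; by locality the
      values of \<open>S\<close> and \<open>T\<close> at the centre of the box do not
      change.\<close>
    define near where "near v \<longleftrightarrow> (\<forall>j. \<bar>v j - int_exp m j\<bar> \<le> int B)" for v
    define \<psi>1 where "\<psi>1 v = (if near v then \<psi> (\<lambda>j. v j - int (k j)) else 0)" for v
    define f :: "'n mpol" where "f = Abs_poly_mapping (\<lambda>n. \<psi>1 (int_exp n) / mfact n)"
    have "{n. \<psi>1 (int_exp n) / mfact n \<noteq> 0} \<subseteq> {n. \<forall>j. Poly_Mapping.lookup n j \<le> (\<Sum>i\<in>UNIV. nat (int_exp m i + int B))}"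
    proof safe
      fix n j assume "\<psi>1 (int_exp n) / mfact n \<noteq> 0"
      then have "near (int_exp n)" by (auto simp: \<psi>1_def split: if_splits)
      then have "int (Poly_Mapping.lookup n j) \<le> int_exp m j + int B"
        unfolding near_def int_exp_def[of n] by (smt (verit))
      then have "Poly_Mapping.lookup n j \<le> nat (int_exp m j + int B)" by linarith
      also have "\<dots> \<le> (\<Sum>i\<in>UNIV. nat (int_exp m i + int B))" by (rule member_le_sum) auto
      finally show "Poly_Mapping.lookup n j \<le> (\<Sum>i\<in>UNIV. nat (int_exp m i + int B))" .
    qed
    then have "finite {n. \<psi>1 (int_exp n) / mfact n \<noteq> 0}"
      using finite_bounded_monos finite_subset by blast
    then have f: "\<psi>1 (int_exp n) = mfact n * Poly_Mapping.lookup f n" for n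
      using mfact_nonzero[of n] by (simp add: f_def)
    have shift: "U x \<psi> w = U (\<lambda>_. 0) (\<lambda>v. \<psi> (\<lambda>j. v j - int (k j))) (int_exp m)" if "series_action P U" for U
      using series_action_translate[OF that, of "\<lambda>_. 0" "\<lambda>v. \<psi> (\<lambda>j. v j - int (k j))" w "\<lambda>j. int (k j)"]
      by (simp add: m flip: k(1))
    have "S x \<psi> w = S (\<lambda>_. 0) \<psi>1 (int_exp m)"
      unfolding shift[OF S]
    proof (rule M(2))
      fix v assume "\<And>j. \<bar>v j - int_exp m j\<bar> \<le> M"
      then have "near v" unfolding near_def using order_trans[OF _ B(1)] by blast
      then show "\<psi> (\<lambda>j. v j - int (k j)) = \<psi>1 v" by (simp add: \<psi>1_def)
    qed
    moreover have "T x \<psi> w = T (\<lambda>_. 0) \<psi>1 (int_exp m)"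
      unfolding shift[OF T]
    proof (rule N(2))
      fix v assume "\<And>j. \<bar>v j - int_exp m j\<bar> \<le> N"
      then have "near v" unfolding near_def using order_trans[OF _ B(2)] by blast
      then show "\<psi> (\<lambda>j. v j - int (k j)) = \<psi>1 v" by (simp add: \<psi>1_def)
    qed
    ultimately show "S x \<psi> w + - 1 * T x \<psi> w = 0"
      by (simp add: series_action_polynomial[OF S f] series_action_polynomial[OF T f])
  qed
  then show ?thesis by simp
qed

section \<open>Actions of the operators in the hypergeometric ideal and in the V-filtration\<close>

lemma series_action_zero: "series_action P T \<Longrightarrow> T \<gamma> (\<lambda>w. 0) = (\<lambda>w. 0)"
  by (induction rule: series_action.induct) auto

lemma series_action_id: "series_action id (\<lambda>\<gamma> \<psi>. \<psi>)"
proof -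
  have "(\<lambda>f::'a mpol. cst 1 * f) = id" by auto
  then show ?thesis using series_action.const[of 1, where 'n = 'a] by simp
qed

lemma series_action_0: "series_action (\<lambda>f. 0) (\<lambda>\<gamma> \<psi> w. 0)"
proof -
  have "(\<lambda>f::'a mpol. cst 0 * f) = (\<lambda>f. 0)" by auto
  then show ?thesis using series_action.const[of 0, where 'n = 'a] by simp
qed

lemma series_action_cst:
  assumes "series_action P T"
  shows "series_action (\<lambda>f. cst c * P f) (\<lambda>\<gamma> \<psi> w. c * T \<gamma> \<psi> w)"
  using series_action.comp[OF series_action.const[of c] assms] by (simp add: o_def)

lemma series_action_sum:
  assumes "\<And>i. i \<in> I \<Longrightarrow> series_action (P i) (T i)"
  shows "series_action (\<lambda>f. \<Sum>i\<in>I. P i f) (\<lambda>\<gamma> \<psi> w. \<Sum>i\<in>I. T i \<gamma> \<psi> w)"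
  using assms
proof (induction I rule: infinite_finite_induct)
  case (insert i I)
  then have "series_action (\<lambda>f. P i f + (\<Sum>i\<in>I. P i f)) (\<lambda>\<gamma> \<psi> w. T i \<gamma> \<psi> w + (\<Sum>i\<in>I. T i \<gamma> \<psi> w))"
    by (intro series_action.add) auto
  then show ?case using insert by simp
qed (simp_all add: series_action_0)

lemma series_action_mono_diff:
  "series_action (mono_diff u) (\<lambda>\<gamma> \<psi> w. \<psi> (\<lambda>j. w j + int_exp u j))"
  using subset_UNIV
proof (induction rule: mono_diff_induct)
  case id
  have "int_exp 0 = (\<lambda>j::'a. 0)" by (simp add: int_exp_def fun_eq_iff)
  from series_action_id show ?case by (simp only: \<open>int_exp 0 = _\<close> add_0_right)
next
  case (pdiff j)
  have "(\<lambda>i. w i + int_exp (Poly_Mapping.single j 1) i) = w(j := w j + 1)" for w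
    by (auto simp: int_exp_def lookup_single)
  then show ?case using series_action.diff[of j] by simp
next
  case (comp u v)
  from series_action.comp[OF this] show ?case
    by (simp only: int_exp_def lookup_add of_nat_add add.assoc)
qed

text \<open>Only the shift of the argument matters for the V-filtration, so the factor
  \<open>\<kappa>\<close> is left unspecified.\<close>

lemma series_action_mon_mult:
  "\<exists>\<kappa>. series_action (\<lambda>f. mon u * f) (\<lambda>\<gamma> \<psi> w. \<kappa> \<gamma> w * \<psi> (\<lambda>j. w j - int_exp u j))"
proof (induction u rule: poly_mapping_induct_single)
  case zero
  have "int_exp 0 = (\<lambda>j::'a. 0)" by (simp add: int_exp_def fun_eq_iff)
  then show ?case
    using series_action.const[of 1, where 'n = 'a] by (intro exI[of _ "\<lambda>_ _. 1"]) simp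
next
  case (add u v)
  then obtain \<kappa> \<kappa>' where "series_action (\<lambda>f. mon u * f) (\<lambda>\<gamma> \<psi> w. \<kappa> \<gamma> w * \<psi> (\<lambda>j. w j - int_exp u j))"
    "series_action (\<lambda>f. mon v * f) (\<lambda>\<gamma> \<psi> w. \<kappa>' \<gamma> w * \<psi> (\<lambda>j. w j - int_exp v j))" by blast
  note * = series_action.comp[OF this]
  have 1: "(\<lambda>f. mon u * f) \<circ> (\<lambda>f. mon v * f) = (\<lambda>f. mon (u + v) * f)"
    by (auto simp: mult_single simp flip: mult.assoc)
  have 2: "(\<lambda>j. w j - int_exp u j - int_exp v j) = (\<lambda>j. w j - int_exp (u + v) j)" for w
    by (simp add: int_exp_def lookup_add fun_eq_iff)
  show ?case
    using * unfolding 1 2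
    by (intro exI[of _ "\<lambda>\<gamma> w. \<kappa> \<gamma> w * \<kappa>' \<gamma> (\<lambda>j. w j - int_exp u j)"]) (simp only: mult.assoc)
next
  case (single j k)
  show ?case
  proof (induction k)
    case 0
    have "int_exp 0 = (\<lambda>j::'a. 0)" by (simp add: int_exp_def fun_eq_iff)
    then show ?case
      using series_action.const[of 1, where 'n = 'a] by (intro exI[of _ "\<lambda>_ _. 1"]) simp
  next
    case (Suc k)
    then obtain \<kappa> where "series_action (\<lambda>f. mon (Poly_Mapping.single j k) * f)
      (\<lambda>\<gamma> \<psi> w. \<kappa> \<gamma> w * \<psi> (\<lambda>i. w i - int_exp (Poly_Mapping.single j k) i))" by blast
    note * = series_action.comp[OF series_action.var[of j] this]
    have 1: "xmul j \<circ> (\<lambda>f. mon (Poly_Mapping.single j k) * f) = (\<lambda>f. mon (Poly_Mapping.single j (Suc k)) * f)"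
      by (auto simp: xmul_def mult_single simp flip: mult.assoc single_add)
    have 2: "(\<lambda>i. (w(j := w j - 1)) i - int_exp (Poly_Mapping.single j k) i) =
        (\<lambda>i. w i - int_exp (Poly_Mapping.single j (Suc k)) i)" for w
      by (auto simp: int_exp_def lookup_single)
    show ?case
      using * unfolding 1 2
      by (intro exI[of _ "\<lambda>\<gamma> w. (\<gamma> j + of_int (w j)) * \<kappa> \<gamma> (w(j := w j - 1))"]) (simp only: mult.assoc)
  qed
qed

text \<open>In the normalised coordinates, the coefficients of the \<Gamma>-series supported on
  \<gamma> + ker A are all 1.\<close>

definition kernel_series :: "int ^ 'n::finite ^ 'd::finite \<Rightarrow> ('n \<Rightarrow> int) \<Rightarrow> complex" where
  "kernel_series A w = (if A *v (\<chi> j. w j) = 0 then 1 else 0)"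

text \<open>Elements of the toric ideal act on this series through their fibre sums, which vanish;
  E_i - \<beta>_i multiplies the coefficient at w by (A w)_i, which is 0 on the support.\<close>

lemma hyp_ideal_kills_series:
  fixes A :: "int ^ 'n::finite ^ 'd::finite"
  assumes \<gamma>: "\<And>i. (\<Sum>j\<in>UNIV. of_int (A $ i $ j) * \<gamma> j) = \<beta> $ i" and P: "P \<in> hyp_ideal A \<beta>"
  shows "\<exists>T. series_action P T \<and> T \<gamma> (kernel_series A) = (\<lambda>w. 0)"
proof -
  have gen: "\<exists>T. series_action g T \<and> T \<gamma> (kernel_series A) = (\<lambda>w. 0)"
    if "g \<in> poly_diff ` toric_ideal A UNIV \<union> {\<lambda>f. euler A i f - cst (\<beta> $ i) * f | i. True}" for g
    using that
  proof safe
    fix f assume f: "f \<in> toric_ideal A UNIV"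
    let ?T = "\<lambda>\<gamma> \<psi> w. \<Sum>u\<in>Poly_Mapping.keys f. Poly_Mapping.lookup f u * \<psi> (\<lambda>j. w j + int_exp u j)"
    have "series_action (poly_diff f) ?T"
      unfolding poly_diff_def[abs_def]
      by (rule series_action_sum, rule series_action_cst, rule series_action_mono_diff)
    moreover have "?T \<gamma> (kernel_series A) w = 0" for w
    proof -
      have "A *v (\<chi> j. w j + int_exp u j) = A *v (\<chi> j. w j) + mono_degree A u" for u
        by (simp add: vec_eq_iff matrix_vector_mult_def mono_degree_nth int_exp_def algebra_simps sum.distrib)
      then have "A *v (\<chi> j. w j + int_exp u j) = 0 \<longleftrightarrow> mono_degree A u = - (A *v (\<chi> j. w j))" for u
        by (simp add: add_eq_0_iff)
      then have "?T \<gamma> (kernel_series A) w = fib A (- (A *v (\<chi> j. w j))) f"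
        by (simp add: fib_def lin_ext_def kernel_series_def)
      then show ?thesis using f by (simp add: toric_ideal_iff)
    qed
    ultimately show "\<exists>T. series_action (poly_diff f) T \<and> T \<gamma> (kernel_series A) = (\<lambda>w. 0)"
      by blast
  next
    fix i
    let ?T = "\<lambda>\<gamma> \<psi> w. (\<Sum>j\<in>UNIV. of_int (A $ i $ j) * ((\<gamma> j + of_int (w j)) * \<psi> w)) + (- (\<beta> $ i)) * \<psi> w"
    have "series_action (xmul j \<circ> pdiff j) (\<lambda>\<gamma> \<psi> w. (\<gamma> j + of_int (w j)) * \<psi> w)" for j :: 'n
      using series_action.comp[OF series_action.var[of j] series_action.diff[of j]] by simp
    then have *: "series_action (\<lambda>f. xmul j (pdiff j f)) (\<lambda>\<gamma> \<psi> w. (\<gamma> j + of_int (w j)) * \<psi> w)" for j :: 'n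
      by (simp add: o_def)
    have "series_action (\<lambda>f. euler A i f + cst (- (\<beta> $ i)) * f) ?T"
      unfolding euler_def
      by (rule series_action.add, rule series_action_sum, rule series_action_cst, rule *, rule series_action.const)
    moreover have "(\<lambda>f. euler A i f + cst (- (\<beta> $ i)) * f) = (\<lambda>f. euler A i f - cst (\<beta> $ i) * f)"
      by (simp add: single_uminus)
    moreover have "?T \<gamma> (kernel_series A) w = 0" for w
    proof (cases "A *v (\<chi> j. w j) = 0")
      case True
      have "(\<Sum>j\<in>UNIV. A $ i $ j * w j) = 0"
        using arg_cong[OF True, of "\<lambda>v. v $ i"] by (simp add: matrix_vector_mult_def)
      then have "(\<Sum>j\<in>UNIV. of_int (A $ i $ j) * of_int (w j) :: complex) = 0"
        by (metis (no_types, lifting) of_int_0 of_int_mult of_int_sum sum.cong)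
      then show ?thesis
        using \<gamma>[of i] True by (simp add: kernel_series_def distrib_left sum.distrib)
    qed (simp add: kernel_series_def)
    ultimately show "\<exists>T. series_action (\<lambda>f. euler A i f - cst (\<beta> $ i) * f) T \<and> T \<gamma> (kernel_series A) = (\<lambda>w. 0)"
      by (metis (no_types, lifting) ext)
  qed
  from P show ?thesis
    unfolding hyp_ideal_def
  proof (induction rule: left_ideal.induct)
    case zero
    show ?case using series_action_0 by blast
  next
    case (gen W g)
    obtain T where T: "series_action g T" "T \<gamma> (kernel_series A) = (\<lambda>w. 0)"
      using assms gen by (metis (no_types, lifting) \<open>\<And>g. _ \<Longrightarrow> \<exists>T. series_action g T \<and> _ T\<close>)
    obtain S where S: "series_action W S" using weyl_series_action[OF gen(1)] by blast
    show ?case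
      by (rule exI, rule conjI, rule series_action.comp[OF S T(1)]) (simp add: T(2) series_action_zero[OF S])
  next
    case (add P Q)
    then obtain S T where "series_action P S" "series_action Q T"
      and *: "S \<gamma> (kernel_series A) = (\<lambda>w. 0)" "T \<gamma> (kernel_series A) = (\<lambda>w. 0)" by blast
    from series_action.add[OF this(1,2)] show ?case
      by (intro exI[of _ "\<lambda>\<gamma> \<psi> w. S \<gamma> \<psi> w + T \<gamma> \<psi> w"] conjI) (simp_all add: *)
  qed
qed

text \<open>The value at 0 after a term x^\<mu> \<partial>^\<nu> is a multiple of
  \<open>\<psi>\<close> at \<nu> - \<mu>, whose entry at \<open>z\<close> is negative.\<close>

lemma V_filtration_action:
  assumes "Q \<in> V_filtration z 1" and \<psi>: "\<And>w. w z < 0 \<Longrightarrow> \<psi> w = 0"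
  shows "\<exists>T. series_action Q T \<and> T \<gamma> \<psi> (\<lambda>_. 0) = 0"
  using assms(1)
proof (induction rule: V_filtration_induct)
  case zero
  show ?case using series_action_0 by blast
next
  case (monomial c \<mu> \<nu>)
  obtain \<kappa> where \<kappa>: "series_action (\<lambda>f. mon \<mu> * f) (\<lambda>\<gamma> \<psi> w. \<kappa> \<gamma> w * \<psi> (\<lambda>j. w j - int_exp \<mu> j))"
    using series_action_mon_mult by blast
  have "\<psi> (\<lambda>j. 0 - int_exp \<mu> j + int_exp \<nu> j) = 0"
    using monomial by (intro \<psi>) (simp add: int_exp_def)
  then show ?case
    using series_action_cst[OF series_action.comp[OF \<kappa> series_action_mono_diff[of \<nu>]], of c]
    by (intro exI conjI) (simp only: o_def, simp)
next
  case (add P Q)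
  then obtain S T where "series_action P S" "series_action Q T"
    and *: "S \<gamma> \<psi> (\<lambda>_. 0) = 0" "T \<gamma> \<psi> (\<lambda>_. 0) = 0" by blast
  from series_action.add[OF this(1,2)] show ?case
    by (intro exI[of _ "\<lambda>\<gamma> \<psi> w. S \<gamma> \<psi> w + T \<gamma> \<psi> w"] conjI) (simp_all add: *)
qed

text \<open>If 1 = P + Q, the coefficient 1 of the series at 0 would be the sum of two zeros:
  \<open>P\<close> kills the series, and \<open>Q\<close> yields 0 there because the support has
  entry 0 at \<open>z\<close>. Comparing P + Q with the identity relies on
  \<open>series_action_unique\<close>.\<close>

lemma one_notin_b_ideal:
  fixes A :: "int ^ 'n::finite ^ 'd::finite"
  assumes \<gamma>: "\<And>i. (\<Sum>j\<in>UNIV. of_int (A $ i $ j) * \<gamma> j) = \<beta> $ i"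
    and ker: "\<And>w. A *v w = 0 \<Longrightarrow> w $ z = 0"
  shows "1 \<notin> b_ideal A \<beta> z"
proof
  assume "1 \<in> b_ideal A \<beta> z"
  then have "oper_poly 1 (theta z) \<in> hyp_V A \<beta> z" by (simp add: b_ideal_iff)
  then obtain P Q where P: "P \<in> hyp_ideal A \<beta>" and Q: "Q \<in> V_filtration z 1"
    and eq: "oper_poly 1 (theta z) = (\<lambda>f. P f + Q f)"
    unfolding hyp_V_def by blast
  have id: "(\<lambda>f. P f + Q f) = id"
    unfolding eq[symmetric] by (auto simp: oper_poly_1)
  obtain S where S: "series_action P S" "S \<gamma> (kernel_series A) = (\<lambda>w. 0)"
    using hyp_ideal_kills_series[OF \<gamma> P] by blast
  have "kernel_series A w = 0" if "w z < 0" for w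
    using ker[of "\<chi> j. w j"] that by (auto simp: kernel_series_def)
  then obtain T where T: "series_action Q T" "T \<gamma> (kernel_series A) (\<lambda>_. 0) = 0"
    using V_filtration_action[OF Q] by blast
  have "kernel_series A (\<lambda>_. 0) = S \<gamma> (kernel_series A) (\<lambda>_. 0) + T \<gamma> (kernel_series A) (\<lambda>_. 0)"
    using series_action_unique[OF series_action_id series_action.add[OF S(1) T(1), unfolded id]] .
  moreover have "kernel_series A (\<lambda>_. 0) = 1"
    by (simp add: kernel_series_def vec_eq_iff matrix_vector_mult_def)
  ultimately show False using S(2) T(2) by simp
qed

subsection \<open>Krull dimension of toric rings and the transversal case\<close>

text \<open>Gaussian elimination, with \<open>E\<close> as the unknowns and \<open>S\<close> as the
  equations: each step solves one equation for one unknown.\<close>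

lemma homogeneous_system:
  fixes M :: "'e \<Rightarrow> 's \<Rightarrow> complex"
  assumes "finite S" "finite E" "card S < card E"
  shows "\<exists>c. (\<exists>e\<in>E. c e \<noteq> 0) \<and> (\<forall>s\<in>S. (\<Sum>e\<in>E. c e * M e s) = 0)"
  using assms
proof (induction S arbitrary: E M)
  case empty
  then obtain e where "e \<in> E" by fastforce
  then show ?case by (intro exI[of _ "\<lambda>_. 1"]) auto
next
  case (insert s S)
  show ?case
  proof (cases "\<forall>e\<in>E. M e s = 0")
    case True
    obtain c where "\<exists>e\<in>E. c e \<noteq> 0" "\<forall>t\<in>S. (\<Sum>e\<in>E. c e * M e t) = 0"
      using insert.IH[of E M] insert.prems insert.hyps by auto
    then show ?thesis using True by (intro exI[of _ c]) auto
  next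
    case False
    then obtain e0 where e0: "e0 \<in> E" "M e0 s \<noteq> 0" by blast
    define M' where "M' e t = M e t - M e s / M e0 s * M e0 t" for e t
    have "card S < card (E - {e0})"
      using insert.prems insert.hyps e0 by simp
    then obtain c where c: "\<exists>e\<in>E - {e0}. c e \<noteq> 0" "\<forall>t\<in>S. (\<Sum>e\<in>E - {e0}. c e * M' e t) = 0"
      using insert.IH[of "E - {e0}" M'] insert.prems by auto
    define a where "a = - (\<Sum>e\<in>E - {e0}. c e * M e s) / M e0 s"
    have sum: "(\<Sum>e\<in>E. (c(e0 := a)) e * M e t) = a * M e0 t + (\<Sum>e\<in>E - {e0}. c e * M e t)" for t
      using insert.prems(1) e0(1) by (subst sum.remove[of E e0]) (auto intro!: sum.cong)
    have "(\<Sum>e\<in>E. (c(e0 := a)) e * M e t) = 0" if "t \<in> insert s S" for t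
    proof (cases "t = s")
      case True
      then show ?thesis unfolding sum using e0(2) by (simp add: a_def)
    next
      case False
      have "(\<Sum>e\<in>E - {e0}. c e * M' e t) =
          (\<Sum>e\<in>E - {e0}. c e * M e t) - (\<Sum>e\<in>E - {e0}. c e * M e s) / M e0 s * M e0 t"
        by (simp add: M'_def right_diff_distrib sum_subtractf sum_distrib_right sum_divide_distrib mult.assoc)
      then show ?thesis unfolding sum using c(2) False that by (simp add: a_def)
    qed
    moreover have "\<exists>e\<in>E. (c(e0 := a)) e \<noteq> 0" using c(1) by auto
    ultimately show ?thesis by blast
  qed
qed

text \<open>Downward induction on \<open>k\<close>: a relation in x_k, ..., x_(m-1) modulo P_k may
  be divided by the common power of x_k, since P_k is prime and does not contain x_k. Modulo P_(k+1)
  the terms still divisible by x_k disappear, and a nontrivial relation in fewer elements is left.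
  For k = 0 this is algebraic independence modulo P_0.\<close>

lemma prime_chain_independent:
  fixes P :: "nat \<Rightarrow> 'n mpol set" and x :: "nat \<Rightarrow> 'n mpol"
  assumes add: "\<And>i f g. i \<le> m \<Longrightarrow> f \<in> P i \<Longrightarrow> g \<in> P i \<Longrightarrow> f + g \<in> P i"
    and zero: "\<And>i. i \<le> m \<Longrightarrow> 0 \<in> P i"
    and mult: "\<And>i f h. i \<le> m \<Longrightarrow> f \<in> P i \<Longrightarrow> h * f \<in> P i"
    and prime: "\<And>i f g. i \<le> m \<Longrightarrow> f * g \<in> P i \<Longrightarrow> f \<in> P i \<or> g \<in> P i"
    and one: "\<And>i. i \<le> m \<Longrightarrow> 1 \<notin> P i"
    and chain: "\<And>i. i < m \<Longrightarrow> P i \<subseteq> P (Suc i)"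
    and x: "\<And>i. i < m \<Longrightarrow> x i \<in> P (Suc i)" "\<And>i. i < m \<Longrightarrow> x i \<notin> P i"
    and "k \<le> m" and E: "finite E" "E \<noteq> {}" "\<And>e. e \<in> E \<Longrightarrow> c e \<noteq> 0"
      "\<And>e i. e \<in> E \<Longrightarrow> i < k \<or> m \<le> i \<Longrightarrow> e i = 0"
  shows "(\<Sum>e\<in>E. cst (c e) * (\<Prod>i<m. x i ^ e i)) \<notin> P k"
  using \<open>k \<le> m\<close> E
proof (induction k arbitrary: E c rule: inc_induct)
  case base
  have "e = (\<lambda>_. 0)" if "e \<in> E" for e using base(4)[OF that] by (meson ext not_le_imp_less)
  then have "E = {\<lambda>_. 0}" using base(2) by blast
  then have sum: "(\<Sum>e\<in>E. cst (c e) * (\<Prod>i<m. x i ^ e i)) = cst (c (\<lambda>_. 0))" "c (\<lambda>_. 0) \<noteq> 0"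
    using base(3) by auto
  show ?case
  proof
    assume "(\<Sum>e\<in>E. cst (c e) * (\<Prod>i<m. x i ^ e i)) \<in> P m"
    then have "cst (inverse (c (\<lambda>_. 0))) * cst (c (\<lambda>_. 0)) \<in> P m"
      unfolding sum by (intro mult) auto
    then show False using one[of m] sum(2) by (simp add: mult_single)
  qed
next
  case (step k)
  \<comment> \<open>The exponent of the largest power of x_k common to all terms.\<close>
  define a where "a = Min ((\<lambda>e. e k) ` E)"
  have a_le: "a \<le> e k" if "e \<in> E" for e using that step.prems(1) by (simp add: a_def)
  have "a \<in> (\<lambda>e. e k) ` E"
    unfolding a_def using step.prems(1,2) by (intro Min_in) auto
  then obtain e1 where e1: "e1 \<in> E" "e1 k = a" by auto
  define X where "X e = (\<Prod>i<m. x i ^ e i)" for e :: "nat \<Rightarrow> nat"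
  have X: "X e = x k ^ e k * (\<Prod>i\<in>{..<m} - {k}. x i ^ e i)" for e
    unfolding X_def using step.hyps by (subst prod.remove[of _ k]) auto
  have X_upd: "X (e(k := l)) = x k ^ l * (\<Prod>i\<in>{..<m} - {k}. x i ^ e i)" for e l
    unfolding X by (auto intro!: prod.cong arg_cong2[where f = "(*)"])
  have X_shift: "X e = x k ^ a * X (e(k := e k - a))" if "e \<in> E" for e
    unfolding X_upd unfolding X using a_le[OF that] by (simp flip: mult.assoc power_add)
  define S where "S = (\<Sum>e\<in>E. cst (c e) * X (e(k := e k - a)))"
  have km: "k \<le> m" "Suc k \<le> m" using step.hyps by auto
  have pow: "f \<in> P k" if "x k ^ l * f \<in> P k" for l f
    using that
  proof (induction l arbitrary: f)
    case (Suc l)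
    then have "x k * (x k ^ l * f) \<in> P k" by (simp add: mult.assoc)
    then have "x k ^ l * f \<in> P k" using prime[of k "x k" "x k ^ l * f"] km(1) x(2)[of k] step.hyps by blast
    then show ?case by (rule Suc.IH)
  qed simp
  have "(\<Sum>e\<in>E. cst (c e) * X e) = x k ^ a * S"
    unfolding S_def sum_distrib_left by (intro sum.cong refl) (simp add: X_shift mult.left_commute)
  moreover have "S \<notin> P k"
  proof
    assume "S \<in> P k"
    then have S: "S \<in> P (Suc k)" using chain step.hyps by blast
    \<comment> \<open>The terms that lose x_k in the division; there is one because the minimum
      \<open>a\<close> is attained.\<close>
    define E0 where "E0 = {e\<in>E. e k = a}"
    have fin: "finite E0" using step.prems(1) by (simp add: E0_def)
    have sum_mem: "(\<Sum>e\<in>D. F e) \<in> P (Suc k)" if "\<And>e. e \<in> D \<Longrightarrow> F e \<in> P (Suc k)" 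
      for D :: "(nat \<Rightarrow> nat) set" and F
      using that by (induction D rule: infinite_finite_induct) (use add zero km in auto)
    have "(\<Sum>e\<in>E - E0. cst (c e) * X (e(k := e k - a))) \<in> P (Suc k)"
    proof (rule sum_mem)
      fix e assume "e \<in> E - E0"
      then have "e k - a \<noteq> 0" using a_le[of e] by (auto simp: E0_def)
      then obtain l where l: "e k - a = Suc l" using not0_implies_Suc by blast
      have "cst (c e) * X (e(k := e k - a)) =
          (cst (c e) * x k ^ l * (\<Prod>i\<in>{..<m} - {k}. x i ^ e i)) * x k"
        unfolding X_upd l by (simp add: ac_simps)
      then show "cst (c e) * X (e(k := e k - a)) \<in> P (Suc k)"
        using mult[of "Suc k" "x k"] km x(1)[of k] step.hyps by auto
    qed
    then have "(-1) * (\<Sum>e\<in>E - E0. cst (c e) * X (e(k := e k - a))) \<in> P (Suc k)"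
      by (intro mult km)
    then have "S + (-1) * (\<Sum>e\<in>E - E0. cst (c e) * X (e(k := e k - a))) \<in> P (Suc k)"
      by (intro add km S)
    moreover have "S = (\<Sum>e\<in>E0. cst (c e) * X (e(k := e k - a))) + (\<Sum>e\<in>E - E0. cst (c e) * X (e(k := e k - a)))"
      unfolding S_def using step.prems(1) by (subst sum.subset_diff[of E0 E]) (auto simp: E0_def)
    ultimately have "(\<Sum>e\<in>E0. cst (c e) * X (e(k := e k - a))) \<in> P (Suc k)"
      by simp
    moreover have "(\<Sum>e\<in>E0. cst (c e) * X (e(k := e k - a))) =
        (\<Sum>e\<in>(\<lambda>e. e(k := 0)) ` E0. cst (c (e(k := a))) * X e)"
    proof (subst sum.reindex)
      show "inj_on (\<lambda>e. e(k := 0)) E0"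
      proof (rule inj_onI)
        fix e e' assume "e \<in> E0" "e' \<in> E0" "e(k := 0) = e'(k := 0)"
        then have "(e(k := 0))(k := a) = (e'(k := 0))(k := a)" "e k = a" "e' k = a" by (auto simp: E0_def)
        then show "e = e'" by (metis fun_upd_triv fun_upd_upd)
      qed
    qed (auto intro!: sum.cong simp: E0_def)
    moreover have "(\<Sum>e\<in>(\<lambda>e. e(k := 0)) ` E0. cst (c (e(k := a))) * X e) \<notin> P (Suc k)"
      unfolding X_def
    proof (rule step.IH)
      show "finite ((\<lambda>e. e(k := 0)) ` E0)" "(\<lambda>e. e(k := 0)) ` E0 \<noteq> {}"
        using fin e1 by (auto simp: E0_def)
      fix e assume "e \<in> (\<lambda>e. e(k := 0)) ` E0"
      then obtain e' where e': "e' \<in> E" "e' k = a" "e = e'(k := 0)" by (auto simp: E0_def)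
      then have "e(k := a) = e'" by auto
      then show "c (e(k := a)) \<noteq> 0" using step.prems(3) e'(1) by simp
      show "e i = 0" if "i < Suc k \<or> m \<le> i" for i
        using that step.prems(4)[OF e'(1), of i] e'(3) by (auto simp: less_Suc_eq)
    qed
    ultimately show False by simp
  qed
  ultimately show ?case using pow[of a S] unfolding X_def by auto
qed

section \<open>Counting degrees: the upper bound for the Krull dimension\<close>

definition degree_bounded :: "int ^ 'n::finite ^ 'd::finite \<Rightarrow> int \<Rightarrow> 'n mpol \<Rightarrow> bool" where
  "degree_bounded A B f \<longleftrightarrow> (\<forall>u\<in>Poly_Mapping.keys f. \<forall>i. \<bar>mono_degree A u $ i\<bar> \<le> B)"

lemma degree_bounded_exists: "\<exists>B. degree_bounded A B f"
proof -
  let ?B = "\<Sum>u\<in>Poly_Mapping.keys f. \<Sum>i\<in>UNIV. \<bar>mono_degree A u $ i\<bar>"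
  have "\<bar>mono_degree A u $ i\<bar> \<le> ?B" if "u \<in> Poly_Mapping.keys f" for u i
  proof -
    have "\<bar>mono_degree A u $ i\<bar> \<le> (\<Sum>i\<in>UNIV. \<bar>mono_degree A u $ i\<bar>)"
      by (rule member_le_sum) auto
    also have "\<dots> \<le> ?B"
      using that by (intro member_le_sum[of u "Poly_Mapping.keys f" "\<lambda>u. \<Sum>i\<in>UNIV. \<bar>mono_degree A u $ i\<bar>"])
        (auto intro: sum_nonneg)
    finally show ?thesis .
  qed
  then show ?thesis unfolding degree_bounded_def by blast
qed

lemma degree_bounded_mono: "degree_bounded A B f \<Longrightarrow> B \<le> C \<Longrightarrow> degree_bounded A C f"
  unfolding degree_bounded_def by (meson order_trans)

lemma degree_bounded_mult:
  assumes "degree_bounded A B f" "degree_bounded A C g"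
  shows "degree_bounded A (B + C) (f * g)"
  unfolding degree_bounded_def
proof (intro ballI allI)
  fix u i assume "u \<in> Poly_Mapping.keys (f * g)"
  then obtain a b where "a \<in> Poly_Mapping.keys f" "b \<in> Poly_Mapping.keys g" "u = a + b"
    using keys_mult[of f g] by auto
  then have "\<bar>mono_degree A a $ i\<bar> \<le> B" "\<bar>mono_degree A b $ i\<bar> \<le> C"
    "mono_degree A u $ i = mono_degree A a $ i + mono_degree A b $ i"
    using assms by (auto simp: degree_bounded_def mono_degree_add)
  then show "\<bar>mono_degree A u $ i\<bar> \<le> B + C" by linarith
qed

lemma degree_bounded_one: "degree_bounded A 0 1"
  by (simp add: degree_bounded_def)

lemma degree_bounded_power:
  assumes "degree_bounded A B f"
  shows "degree_bounded A (int k * B) (f ^ k)"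
proof (induction k)
  case (Suc k)
  from degree_bounded_mult[OF assms Suc] show ?case by (simp add: algebra_simps)
qed (simp add: degree_bounded_one)

lemma degree_bounded_prod:
  assumes "\<And>i. i < m \<Longrightarrow> degree_bounded A B (f i)"
  shows "degree_bounded A (int m * B) (\<Prod>i<m. f i)"
  using assms
proof (induction m)
  case (Suc m)
  then have "degree_bounded A (int m * B + B) ((\<Prod>i<m. f i) * f m)"
    by (intro degree_bounded_mult) auto
  then show ?case by (simp add: algebra_simps)
qed (simp add: degree_bounded_one)

lemma fib_outside: "degree_bounded A B f \<Longrightarrow> \<not> (\<forall>i. \<bar>\<alpha> $ i\<bar> \<le> B) \<Longrightarrow> fib A \<alpha> f = 0"
  unfolding fib_def lin_ext_def degree_bounded_def by (intro sum.neutral) auto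

lemma card_box:
  "finite {\<alpha> :: int ^ 'd::finite. \<forall>i. \<bar>\<alpha> $ i\<bar> \<le> int B}"
  "card {\<alpha> :: int ^ 'd::finite. \<forall>i. \<bar>\<alpha> $ i\<bar> \<le> int B} = (2 * B + 1) ^ CARD('d)"
proof -
  let ?S = "{\<alpha> :: int ^ 'd. \<forall>i. \<bar>\<alpha> $ i\<bar> \<le> int B}" and ?P = "PiE (UNIV :: 'd set) (\<lambda>_. {- int B..int B})"
  have bij: "bij_betw vec_nth ?S ?P"
  proof (rule bij_betwI[where g = vec_lambda])
    show "vec_nth \<in> ?S \<rightarrow> ?P" by (auto simp: abs_le_iff minus_le_iff)
    show "vec_lambda \<in> ?P \<rightarrow> ?S" by (force simp: PiE_iff abs_le_iff minus_le_iff)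
  qed auto
  have "finite ?P" by (intro finite_PiE) auto
  then show "finite ?S" using bij bij_betw_finite by blast
  have "card {- int B..int B} = 2 * B + 1"
    unfolding card_atLeastAtMost_int by linarith
  then have "card ?P = (2 * B + 1) ^ CARD('d)"
    by (subst card_PiE[OF finite]) (simp only: prod_constant)
  then show "card ?S = (2 * B + 1) ^ CARD('d)"
    using bij_betw_same_card[OF bij] by simp
qed

text \<open>There are (N + 1)^m products with exponents up to \<open>N\<close>, while a polynomial
  lies in the toric ideal once its fibre sums vanish. The degrees that occur lie in a box with fewer
  points than there are products, so some combination satisfies all these linear conditions.\<close>

lemma products_dependent_mod_toric_ideal:
  fixes A :: "int ^ 'n::finite ^ 'd::finite" and x :: "nat \<Rightarrow> 'n mpol"
  assumes m: "CARD('d) < m"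
  obtains E c where "finite E" "E \<noteq> {}" "\<And>e. e \<in> E \<Longrightarrow> c e \<noteq> 0" "\<And>e i. e \<in> E \<Longrightarrow> m \<le> i \<Longrightarrow> e i = 0"
    "(\<Sum>e\<in>E. cst (c e) * (\<Prod>i<m. x i ^ e i)) \<in> toric_ideal A UNIV"
proof -
  have "\<exists>b. \<forall>i. degree_bounded A (b i) (x i)" by (intro choice allI degree_bounded_exists)
  then obtain b where b: "\<And>i. degree_bounded A (b i) (x i)" by blast
  define B where "B = (\<Sum>i<m. nat (b i))"
  have B: "degree_bounded A (int B) (x i)" if "i < m" for i
  proof (rule degree_bounded_mono[OF b])
    have "nat (b i) \<le> B" unfolding B_def using that by (intro member_le_sum) auto
    then show "b i \<le> int B" by linarith
  qed
  \<comment> \<open>With d rows, the box has at most ((2 m B + 1)(N + 1))^d points; this choice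
    turns the bound into N (N + 1)^d, which is below (N + 1)^(d + 1).\<close>
  define N where "N = (2 * m * B + 1) ^ CARD('d)"
  define X where "X e = (\<Prod>i<m. x i ^ e i)" for e :: "nat \<Rightarrow> nat"
  \<comment> \<open>Members of \<open>PiE\<close> are \<open>undefined\<close> outside their domain;
    there the exponents are reset to 0.\<close>
  let ?f = "\<lambda>e i. if i < m then e i else (0::nat)"
  define E where "E = ?f ` PiE {..<m} (\<lambda>_. {..N})"
  have inj: "inj_on ?f (PiE {..<m} (\<lambda>_. {..N}))"
  proof (rule inj_onI)
    fix e e' assume e: "e \<in> PiE {..<m} (\<lambda>_. {..N})" "e' \<in> PiE {..<m} (\<lambda>_. {..N})" "?f e = ?f e'"
    show "e = e'"
    proof (rule PiE_ext[OF e(1,2)])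
      fix i assume "i \<in> {..<m}"
      then show "e i = e' i" using fun_cong[OF e(3), of i] by simp
    qed
  qed
  have E_mem: "e i \<le> N" "m \<le> i \<Longrightarrow> e i = 0" if e: "e \<in> E" for e i
  proof -
    obtain e' where e': "e' \<in> PiE {..<m} (\<lambda>_. {..N})" "e = ?f e'"
      using e unfolding E_def by blast
    show "e i \<le> N" using PiE_mem[OF e'(1), of i] unfolding e'(2) by simp
    show "m \<le> i \<Longrightarrow> e i = 0" unfolding e'(2) by simp
  qed
  have finE: "finite E" unfolding E_def by (intro finite_imageI finite_PiE) auto
  have "card E = card (PiE {..<m} (\<lambda>_. {..N}))" unfolding E_def by (rule card_image[OF inj])
  also have "\<dots> = (N + 1) ^ m" by (simp add: card_PiE)
  finally have cardE: "card E = (N + 1) ^ m" .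
  let ?S = "{\<alpha> :: int ^ 'd. \<forall>i. \<bar>\<alpha> $ i\<bar> \<le> int (m * (N * B))}"
  have XB: "degree_bounded A (int (m * (N * B))) (X e)" if "e \<in> E" for e
  proof -
    have "degree_bounded A (int (N * B)) (x i ^ e i)" if "i < m" for i
    proof (rule degree_bounded_mono[OF degree_bounded_power[OF B[OF that]]])
      have "e i \<le> N" using \<open>e \<in> E\<close> by (rule E_mem)
      then show "int (e i) * int B \<le> int (N * B)" by (simp add: mult_right_mono)
    qed
    from degree_bounded_prod[of m A "int (N * B)", OF this] show ?thesis
      by (simp add: X_def)
  qed
  have "card ?S = (2 * (m * (N * B)) + 1) ^ CARD('d)" by (rule card_box)
  also have "\<dots> \<le> ((2 * m * B + 1) * (N + 1)) ^ CARD('d)" by (rule power_mono) (auto simp: algebra_simps)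
  also have "\<dots> = N * (N + 1) ^ CARD('d)" by (simp only: power_mult_distrib N_def)
  also have "\<dots> < (N + 1) * (N + 1) ^ CARD('d)" by simp
  also have "\<dots> = (N + 1) ^ Suc CARD('d)" by simp
  also have "\<dots> \<le> (N + 1) ^ m" using m by (intro power_increasing) auto
  finally have "card ?S < card E" using cardE by simp
  from homogeneous_system[OF card_box(1) finE this, of "\<lambda>e \<alpha>. fib A \<alpha> (X e)"]
  obtain c where c: "\<exists>e\<in>E. c e \<noteq> 0" "\<forall>\<alpha>\<in>?S. (\<Sum>e\<in>E. c e * fib A \<alpha> (X e)) = 0" by blast
  let ?E = "{e\<in>E. c e \<noteq> 0}"
  have "fib A \<alpha> (\<Sum>e\<in>?E. cst (c e) * X e) = 0" for \<alpha>
  proof -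
    have "fib A \<alpha> (\<Sum>e\<in>?E. cst (c e) * X e) = (\<Sum>e\<in>?E. c e * fib A \<alpha> (X e))"
      by (simp add: fib_def lin_ext_sum lin_ext_single_mult)
    also have "\<dots> = (\<Sum>e\<in>E. c e * fib A \<alpha> (X e))"
      using finE by (intro sum.mono_neutral_left) auto
    also have "\<dots> = 0"
    proof (cases "\<alpha> \<in> ?S")
      case False
      then show ?thesis using fib_outside[OF XB] by (intro sum.neutral) auto
    qed (use c(2) in blast)
    finally show ?thesis .
  qed
  then have "(\<Sum>e\<in>?E. cst (c e) * X e) \<in> toric_ideal A UNIV"
    by (simp add: toric_ideal_iff carrier_mpol_ring)
  then show ?thesis
    unfolding X_def by (intro that[of ?E c]) (use finE c(1) E_mem in auto)
qed

text \<open>A chain of primes with m > d steps would give m elements that are independent modulo the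
  smallest prime, but dependent already modulo the toric ideal.\<close>

lemma krull_dim_toric_ring_le:
  fixes A :: "int ^ 'n::finite ^ 'd::finite"
  shows "krull_dim (toric_ring A UNIV) \<le> enat CARD('d)"
  unfolding krull_dim_def
proof (rule Sup_least, safe)
  fix m P
  let ?S = "toric_ring A UNIV" and ?cl = "toric_class A UNIV"
  assume P: "\<forall>i\<le>m. primeideal (P i) ?S" and chain: "\<forall>i<m. P i \<subset> P (Suc i)"
  show "enat m \<le> enat CARD('d)"
  proof (rule ccontr)
    assume "\<not> enat m \<le> enat CARD('d)"
    then have m: "CARD('d) < m" by simp
    define Q where "Q i = {f. ?cl f \<in> P i}" for i
    have c: "h \<in> carrier (mpol_ring UNIV)" for h :: "'n mpol" by (simp add: carrier_mpol_ring)
    note cl = toric_ring_simps[OF c c]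
    have cc: "?cl f \<in> carrier ?S" for f using c by (auto simp: carrier_toric_ring)
    have Qadd: "f + g \<in> Q i" if "i \<le> m" "f \<in> Q i" "g \<in> Q i" for i f g
    proof -
      interpret primeideal "P i" ?S using P that by blast
      show ?thesis
        using additive_subgroup.a_closed[OF is_additive_subgroup, of "?cl f" "?cl g"] that
        by (simp add: Q_def cl)
    qed
    have Qzero: "0 \<in> Q i" if "i \<le> m" for i
    proof -
      interpret primeideal "P i" ?S using P that by blast
      show ?thesis
        using additive_subgroup.zero_closed[OF is_additive_subgroup] by (simp add: Q_def cl)
    qed
    have Qmult: "h * f \<in> Q i" if "i \<le> m" "f \<in> Q i" for i f h
    proof -
      interpret primeideal "P i" ?S using P that by blast
      show ?thesis using I_l_closed[of "?cl f" "?cl h"] that by (simp add: Q_def cl cc)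
    qed
    have Qprime: "f \<in> Q i \<or> g \<in> Q i" if "i \<le> m" "f * g \<in> Q i" for i f g
    proof -
      interpret primeideal "P i" ?S using P that by blast
      show ?thesis using I_prime[of "?cl f" "?cl g"] that by (simp add: Q_def cl cc)
    qed
    have Qone: "1 \<notin> Q i" if "i \<le> m" for i
    proof -
      interpret primeideal "P i" ?S using P that by blast
      show ?thesis using one_imp_carrier I_notcarr by (auto simp: Q_def cl)
    qed
    have Qchain: "Q i \<subseteq> Q (Suc i)" if "i < m" for i using chain that by (auto simp: Q_def)
    have "\<exists>f. f \<in> Q (Suc i) \<and> f \<notin> Q i" if "i < m" for i
    proof -
      obtain y where y: "y \<in> P (Suc i)" "y \<notin> P i" using chain \<open>i < m\<close> by blast
      interpret primeideal "P (Suc i)" ?S using P that by simp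
      have "y \<in> carrier ?S" using y(1) a_subset by blast
      then show ?thesis using y by (auto simp: carrier_toric_ring Q_def)
    qed
    then obtain x where x: "\<And>i. i < m \<Longrightarrow> x i \<in> Q (Suc i)" "\<And>i. i < m \<Longrightarrow> x i \<notin> Q i" by metis
    obtain E c where E: "finite E" "E \<noteq> {}" "\<And>e. e \<in> E \<Longrightarrow> c e \<noteq> 0" "\<And>e i. e \<in> E \<Longrightarrow> m \<le> i \<Longrightarrow> e i = 0"
      "(\<Sum>e\<in>E. cst (c e) * (\<Prod>i<m. x i ^ e i)) \<in> toric_ideal A UNIV"
      by (rule products_dependent_mod_toric_ideal[OF m, of x A]) blast
    have "(\<Sum>e\<in>E. cst (c e) * (\<Prod>i<m. x i ^ e i)) \<notin> Q 0"
      by (rule prime_chain_independent[where k = 0 and m = m])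
        (use Qadd Qzero Qmult Qprime Qone Qchain x E in auto)
    moreover have "?cl f = ?cl 0" if "f \<in> toric_ideal A UNIV" for f
      using that by (simp add: toric_class_eq_iff)
    ultimately show False using E(5) Qzero[of 0] by (simp add: Q_def)
  qed
qed

section \<open>Primality of toric ideals and the lower bound for the Krull dimension\<close>

lemma separating_weights:
  fixes D :: "(int ^ 'd::finite) set"
  assumes "finite D"
  obtains l :: "'d \<Rightarrow> int" where "inj_on (\<lambda>\<alpha>. \<Sum>i\<in>UNIV. l i * \<alpha> $ i) D"
proof -
  obtain h :: "'d \<Rightarrow> nat" where h: "inj h"
    using finite_imp_inj_to_nat_seg[of "UNIV :: 'd set"] by auto
  \<comment> \<open>The weights are the powers t^(h i): the difference of two distinct degrees then
    has as its weight a nonzero polynomial in t, and some integer is a root of none of these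
    finitely many polynomials.\<close>
  define p where "p \<alpha> = (\<Sum>i\<in>UNIV. monom (\<alpha> $ i) (h i))" for \<alpha> :: "int ^ 'd"
  have poly_p: "poly (p \<alpha>) t = (\<Sum>i\<in>UNIV. t ^ h i * \<alpha> $ i)" for \<alpha> t
    by (simp add: p_def poly_sum poly_monom mult.commute)
  have p0: "p \<alpha> \<noteq> 0" if \<alpha>: "\<alpha> \<noteq> 0" for \<alpha>
  proof -
    obtain k where k: "\<alpha> $ k \<noteq> 0" using \<alpha> by (auto simp: vec_eq_iff)
    have "coeff (p \<alpha>) (h k) = (\<Sum>i\<in>UNIV. if i = k then \<alpha> $ k else 0)"
      unfolding p_def coeff_sum coeff_monom using h by (intro sum.cong) (auto simp: inj_eq)
    then show ?thesis using k by auto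
  qed
  define U where "U = (\<Union>\<alpha>\<in>D. \<Union>\<alpha>'\<in>D - {\<alpha>}. {t. poly (p (\<alpha> - \<alpha>')) t = 0})"
  have "finite U"
    unfolding U_def using assms p0 by (intro finite_UN_I finite_Diff poly_roots_finite) auto
  then obtain t where t: "t \<notin> U" using infinite_UNIV_int ex_new_if_finite by blast
  have "inj_on (\<lambda>\<alpha>. \<Sum>i\<in>UNIV. t ^ h i * \<alpha> $ i) D"
  proof (rule inj_onI, rule ccontr)
    fix \<alpha> \<alpha>' assume *: "\<alpha> \<in> D" "\<alpha>' \<in> D" "(\<Sum>i\<in>UNIV. t ^ h i * \<alpha> $ i) = (\<Sum>i\<in>UNIV. t ^ h i * \<alpha>' $ i)" "\<alpha> \<noteq> \<alpha>'"
    then have "poly (p (\<alpha> - \<alpha>')) t = 0" by (simp add: poly_p right_diff_distrib sum_subtractf)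
    then show False using t * by (auto simp: U_def)
  qed
  then show ?thesis by (rule that)
qed

text \<open>
  Monomial substitution into Laurent polynomials in one variable: generic weights do not
  identify any two of finitely many degrees.
\<close>

definition push :: "('u \<Rightarrow> int) \<Rightarrow> ('u \<Rightarrow>\<^sub>0 complex) \<Rightarrow> (int \<Rightarrow>\<^sub>0 complex)" where
  "push \<delta> f = (\<Sum>u\<in>Poly_Mapping.keys f. Poly_Mapping.single (\<delta> u) (Poly_Mapping.lookup f u))"

lemma lookup_push: "Poly_Mapping.lookup (push \<delta> f) n = lin_ext (\<lambda>u. if \<delta> u = n then 1 else 0) f"
  unfolding push_def lin_ext_def lookup_sum by (intro sum.cong) (auto simp: lookup_single when_def)

lemma push_add: "push \<delta> (f + g) = push \<delta> f + push \<delta> g"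
  by (intro poly_mapping_eqI) (simp add: lookup_push lookup_add lin_ext_add)

lemma push_single: "push \<delta> (Poly_Mapping.single u c) = Poly_Mapping.single (\<delta> u) c"
  by (simp add: push_def)

lemma push_0 [simp]: "push \<delta> 0 = 0"
  by (simp add: push_def)

lemma push_mult:
  assumes "\<And>u v. \<delta> (u + v) = \<delta> u + \<delta> v"
  shows "push \<delta> (f * g) = push \<delta> f * push \<delta> g"
proof (induction f rule: poly_mapping_induct_single)
  case (single u c)
  show ?case
    by (induction g rule: poly_mapping_induct_single)
      (simp_all add: distrib_left push_add push_single mult_single assms)
qed (simp_all add: distrib_right push_add)

text \<open>With weights that separate the degrees of \<open>f\<close> and \<open>g\<close>,
  \<open>push\<close> does not kill either of them unless it is in the ideal, whereas it kills the
  whole ideal and hence f g. Laurent polynomials in one variable have no zero divisors.\<close>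

lemma toric_ideal_prime:
  fixes B :: "int ^ 'n::finite ^ 'd::finite"
  assumes f: "f \<in> carrier (mpol_ring J)" and g: "g \<in> carrier (mpol_ring J)" and fg: "f * g \<in> toric_ideal B J"
  shows "f \<in> toric_ideal B J \<or> g \<in> toric_ideal B J"
proof -
  let ?D = "mono_degree B ` (Poly_Mapping.keys f \<union> Poly_Mapping.keys g)"
  obtain l where l: "inj_on (\<lambda>\<alpha>. \<Sum>i\<in>UNIV. l i * \<alpha> $ i) ?D"
    using separating_weights[of ?D] by auto
  define \<delta> where "\<delta> u = (\<Sum>i\<in>UNIV. l i * mono_degree B u $ i)" for u
  have \<delta>_add: "\<delta> (u + v) = \<delta> u + \<delta> v" for u v
    by (simp add: \<delta>_def mono_degree_add distrib_left sum.distrib)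
  have zero: "push \<delta> h = 0" if h: "h \<in> toric_ideal B J" for h
  proof (rule poly_mapping_eqI)
    fix n
    let ?F = "\<lambda>\<alpha>. if (\<Sum>i\<in>UNIV. l i * \<alpha> $ i) = n then 1 else 0 :: complex"
    have "Poly_Mapping.lookup (push \<delta> h) n = (\<Sum>u\<in>Poly_Mapping.keys h. Poly_Mapping.lookup h u * ?F (mono_degree B u))"
      by (simp add: lookup_push lin_ext_def \<delta>_def)
    also have "\<dots> = (\<Sum>\<alpha>\<in>mono_degree B ` Poly_Mapping.keys h. \<Sum>u\<in>{u\<in>Poly_Mapping.keys h. mono_degree B u = \<alpha>}.
        Poly_Mapping.lookup h u * ?F (mono_degree B u))"
      by (rule sum.image_gen) simp
    also have "\<dots> = (\<Sum>\<alpha>\<in>mono_degree B ` Poly_Mapping.keys h. ?F \<alpha> * fib B \<alpha> h)"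
    proof (intro sum.cong refl)
      fix \<alpha>
      have "(\<Sum>u\<in>{u\<in>Poly_Mapping.keys h. mono_degree B u = \<alpha>}. Poly_Mapping.lookup h u * ?F (mono_degree B u)) =
         ?F \<alpha> * (\<Sum>u\<in>{u\<in>Poly_Mapping.keys h. mono_degree B u = \<alpha>}. Poly_Mapping.lookup h u)"
        unfolding sum_distrib_left by (intro sum.cong) (auto simp: mult.commute)
      also have "(\<Sum>u\<in>{u\<in>Poly_Mapping.keys h. mono_degree B u = \<alpha>}. Poly_Mapping.lookup h u) = fib B \<alpha> h"
        by (simp add: fib_def lin_ext_def if_distrib sum.If_cases Int_def cong: if_cong)
      finally show "(\<Sum>u\<in>{u\<in>Poly_Mapping.keys h. mono_degree B u = \<alpha>}. Poly_Mapping.lookup h u * ?F (mono_degree B u)) =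
         ?F \<alpha> * fib B \<alpha> h" .
    qed
    also have "\<dots> = 0" using h by (simp add: toric_ideal_iff)
    finally show "Poly_Mapping.lookup (push \<delta> h) n = Poly_Mapping.lookup 0 n" by simp
  qed
  have nonzero: "push \<delta> h \<noteq> 0" if h: "h \<in> carrier (mpol_ring J)" "h \<notin> toric_ideal B J"
    "Poly_Mapping.keys h \<subseteq> Poly_Mapping.keys f \<union> Poly_Mapping.keys g" for h
  proof
    assume p0: "push \<delta> h = 0"
    obtain \<alpha> where \<alpha>: "fib B \<alpha> h \<noteq> 0" using h by (auto simp: toric_ideal_iff)
    have "\<exists>u0\<in>Poly_Mapping.keys h. mono_degree B u0 = \<alpha>"
    proof (rule ccontr)
      assume "\<not> (\<exists>u0\<in>Poly_Mapping.keys h. mono_degree B u0 = \<alpha>)"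
      then have "fib B \<alpha> h = 0" unfolding fib_def lin_ext_def by (intro sum.neutral) auto
      then show False using \<alpha> by blast
    qed
    then obtain u0 where u0: "u0 \<in> Poly_Mapping.keys h" "mono_degree B u0 = \<alpha>" by blast
    have "\<delta> u = \<delta> u0 \<longleftrightarrow> mono_degree B u = \<alpha>" if "u \<in> Poly_Mapping.keys h" for u
      using inj_onD[OF l, of "mono_degree B u" "mono_degree B u0"] that u0 h(3) by (auto simp: \<delta>_def)
    then have "fib B \<alpha> h = Poly_Mapping.lookup (push \<delta> h) (\<delta> u0)"
      unfolding lookup_push fib_def by (intro lin_ext_cong) auto
    then show False using \<alpha> p0 by simp
  qed
  have "push \<delta> f * push \<delta> g = 0"
    using zero[OF fg] by (simp add: push_mult \<delta>_add)
  then show ?thesis using nonzero[OF f] nonzero[OF g] by auto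
qed

lemma toric_ideal_kernel_mono:
  fixes A B :: "int ^ 'n::finite ^ 'd::finite"
  assumes "\<And>v. A *v v = 0 \<Longrightarrow> B *v v = 0"
  shows "toric_ideal A J \<subseteq> toric_ideal B J"
proof -
  interpret cring "mpol_ring J" by (rule cring_mpol_ring)
  have mem: "mon (pos_part v) - mon (pos_part (- v)) \<in> toric_ideal B J"
    if v: "A *v v = 0" "\<forall>j. j \<notin> J \<longrightarrow> v $ j = 0" for v
  proof (rule mon_diff_in_toric_ideal)
    show "Poly_Mapping.keys (pos_part v) \<subseteq> J" "Poly_Mapping.keys (pos_part (- v)) \<subseteq> J"
      using v(2) by (auto simp: in_keys_iff lookup_pos_part subset_iff)
    show "mono_degree B (pos_part v) = mono_degree B (pos_part (- v))"
      using assms[OF v(1)] mono_degree_pos_part_diff[of B v] by simp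
  qed
  show ?thesis
    unfolding toric_ideal_def[of A]
    by (rule genideal_minimal[OF ideal_toric_ideal]) (use mem in blast)
qed

text \<open>As the ideal of \<open>A\<close> is inside that of \<open>B\<close>, a class lies in the
  image only if its representatives lie in the ideal of \<open>B\<close>; primality of the latter
  thus descends to the quotient.\<close>

lemma primeideal_toric_image:
  fixes A B :: "int ^ 'n::finite ^ 'd::finite"
  assumes sub: "toric_ideal A J \<subseteq> toric_ideal B J"
  shows "primeideal (toric_class A J ` toric_ideal B J) (toric_ring A J)"
proof (rule primeidealI)
  let ?cl = "toric_class A J"
  note I = mpol_ideal_closed[OF ideal_toric_ideal[of B J]]
  have lift: "f \<in> toric_ideal B J" if f: "?cl f \<in> ?cl ` toric_ideal B J" for f
  proof -
    obtain q where q: "q \<in> toric_ideal B J" "f - q \<in> toric_ideal A J"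
      using f by (auto simp: toric_class_eq_iff)
    then have "f - q + q \<in> toric_ideal B J" using sub by (intro I(3)) auto
    then show ?thesis by simp
  qed
  interpret M: cring "mpol_ring J" by (rule cring_mpol_ring)
  have cl: "?cl = (+>\<^bsub>mpol_ring J\<^esub>) (toric_ideal A J)"
    by (auto simp: toric_class_def)
  show "ideal (?cl ` toric_ideal B J) (toric_ring A J)"
    unfolding cl toric_ring_def by (rule M.ring_ideal_imp_quot_ideal[OF ideal_toric_ideal ideal_toric_ideal])
  show "cring (toric_ring A J)"
    unfolding toric_ring_def by (rule ideal.quotient_is_cring[OF ideal_toric_ideal cring_mpol_ring])
  have one: "1 \<in> carrier (mpol_ring J)" by (simp add: carrier_mpol_ring)
  have "1 \<notin> toric_ideal B J"
  proof
    assume "1 \<in> toric_ideal B J"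
    then have "fib B 0 (mon 0) = 0" unfolding toric_ideal_iff by simp
    then show False by (simp add: fib_def del: single_one)
  qed
  then have "?cl 1 \<notin> ?cl ` toric_ideal B J" using lift by blast
  then show "carrier (toric_ring A J) \<noteq> ?cl ` toric_ideal B J"
    using one unfolding carrier_toric_ring by blast
  fix a b assume ab: "a \<in> carrier (toric_ring A J)" "b \<in> carrier (toric_ring A J)"
    "a \<otimes>\<^bsub>toric_ring A J\<^esub> b \<in> ?cl ` toric_ideal B J"
  then obtain f g where fg: "f \<in> carrier (mpol_ring J)" "g \<in> carrier (mpol_ring J)" "a = ?cl f" "b = ?cl g"
    unfolding carrier_toric_ring by blast
  then have "?cl (f * g) \<in> ?cl ` toric_ideal B J" using ab(3) by (simp add: toric_ring_simps)
  from toric_ideal_prime[OF fg(1,2) lift[OF this]]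
  show "a \<in> ?cl ` toric_ideal B J \<or> b \<in> ?cl ` toric_ideal B J" using fg by blast
qed

text \<open>Dropping the rows of \<open>A\<close> one after another enlarges the kernel, and the
  toric ideals form a chain of d + 1 primes. It is strict because a positive multiple of each unit
  vector is an integer combination of the columns.\<close>

lemma krull_dim_toric_ring_ge:
  fixes A :: "int ^ 'n::finite ^ 'd::finite"
  assumes span: "\<And>y :: int ^ 'd. \<exists>w. (vec_of_int y :: real ^ 'd) = (\<Sum>j\<in>J. w j *\<^sub>R vec_of_int (column j A))"
  shows "enat CARD('d) \<le> krull_dim (toric_ring A J)"
proof -
  obtain h :: "nat \<Rightarrow> 'd" where h: "bij_betw h {0..<CARD('d)} UNIV"
    using ex_bij_betw_nat_finite[of "UNIV :: 'd set"] by auto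
  define K where "K m = h ` {m..<CARD('d)}" for m
  define B :: "nat \<Rightarrow> int ^ 'n ^ 'd" where "B m = (\<chi> i. if i \<in> K m then A $ i else 0)" for m
  have Bv: "(B m *v v) $ i = (if i \<in> K m then (A *v v) $ i else 0)" for m v i
    by (simp add: B_def matrix_vector_mult_def)
  have KSuc: "K m = insert (h m) (K (Suc m))" "h m \<notin> K (Suc m)" if "m < CARD('d)" for m
  proof -
    have "{m..<CARD('d)} = insert m {Suc m..<CARD('d)}" using that by auto
    then show "K m = insert (h m) (K (Suc m))" by (simp add: K_def)
    have "h m \<noteq> h l" if "l \<in> {Suc m..<CARD('d)}" for l
      using inj_on_eq_iff[OF bij_betw_imp_inj_on[OF h], of m l] that \<open>m < CARD('d)\<close> by auto
    then show "h m \<notin> K (Suc m)" unfolding K_def by blast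
  qed
  have AB: "toric_ideal A J \<subseteq> toric_ideal (B m) J" for m
    by (rule toric_ideal_kernel_mono) (simp add: vec_eq_iff Bv)
  define P where "P m = toric_class A J ` toric_ideal (B m) J" for m
  have "P m \<subset> P (Suc m)" if m: "m < CARD('d)" for m
  proof
    have "toric_ideal (B m) J \<subseteq> toric_ideal (B (Suc m)) J"
      by (rule toric_ideal_kernel_mono) (use KSuc[OF m] in \<open>auto simp: vec_eq_iff Bv split: if_splits\<close>)
    then show "P m \<subseteq> P (Suc m)" by (auto simp: P_def)
    obtain w where w: "(vec_of_int (axis (h m) 1) :: real ^ 'd) = (\<Sum>j\<in>J. w j *\<^sub>R vec_of_int (column j A))"
      using span by blast
    obtain q p where q: "q > 0" "q *s (axis (h m) 1 :: int ^ 'd) = (\<Sum>j\<in>J. p j *s column j A)"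
      by (rule integer_combination[OF w]) blast
    \<comment> \<open>This \<open>v\<close> is killed by B (m + 1) but not by B m, so its binomial
      separates the two ideals.\<close>
    define v :: "int ^ 'n" where "v = (\<chi> j. if j \<in> J then p j else 0)"
    have "(A *v v) $ i = (\<Sum>j\<in>J. p j *s column j A) $ i" for i
      unfolding matrix_vector_mult_def v_def
      by (auto simp: column_def mult.commute intro!: sum.mono_neutral_cong_right)
    then have Av: "A *v v = q *s axis (h m) 1" using q(2) by (simp add: vec_eq_iff)
    let ?f = "mon (pos_part v) - mon (pos_part (- v)) :: 'n mpol"
    have ks: "Poly_Mapping.keys (pos_part v) \<subseteq> J" "Poly_Mapping.keys (pos_part (- v)) \<subseteq> J"
      by (auto simp: in_keys_iff lookup_pos_part v_def split: if_splits)
    have "B (Suc m) *v v = 0" using KSuc[OF m] by (auto simp: vec_eq_iff Bv Av axis_def)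
    then have "?f \<in> toric_ideal (B (Suc m)) J"
      using mono_degree_pos_part_diff[of "B (Suc m)" v] by (intro mon_diff_in_toric_ideal ks) simp
    moreover have "toric_class A J ?f \<notin> P m"
    proof
      assume "toric_class A J ?f \<in> P m"
      then obtain g where g: "g \<in> toric_ideal (B m) J" "?f - g \<in> toric_ideal A J"
        by (auto simp: P_def toric_class_eq_iff)
      then have "?f - g + g \<in> toric_ideal (B m) J"
        using AB by (intro mpol_ideal_closed(3)[OF ideal_toric_ideal]) auto
      then have "fib (B m) (mono_degree (B m) (pos_part v)) ?f = 0" by (simp add: toric_ideal_iff)
      then have "mono_degree (B m) (pos_part v) = mono_degree (B m) (pos_part (- v))"
        by (simp add: fib_def lin_ext_diff split: if_splits)
      then have "(B m *v v) $ h m = 0" using mono_degree_pos_part_diff[of "B m" v] by simp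
      then show False using q(1) KSuc[OF m] by (simp add: Bv Av axis_def)
    qed
    ultimately show "P m \<noteq> P (Suc m)" by (auto simp: P_def)
  qed
  moreover have "primeideal (P m) (toric_ring A J)" for m
    unfolding P_def by (rule primeideal_toric_image[OF AB])
  ultimately show ?thesis
    unfolding krull_dim_def by (intro Sup_upper) blast
qed

section \<open>The transversal case, where the dimension drops\<close>

lemma transversal_functional:
  fixes A :: "int ^ 'n::finite ^ 'd::finite"
  assumes range: "range (\<lambda>v. A *v v) = UNIV"
    and dim: "krull_dim (toric_ring A UNIV) = krull_dim (toric_ring A (- {z})) + 1"
  obtains c :: "'d \<Rightarrow> real" where "\<And>j. j \<noteq> z \<Longrightarrow> (\<Sum>i\<in>UNIV. c i * of_int (A $ i $ j)) = 0"
    "(\<Sum>i\<in>UNIV. c i * of_int (A $ i $ z)) = 1"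
proof -
  let ?a = "\<lambda>j. vec_of_int (column j A) :: real ^ 'd"
  let ?S = "vec.span (?a ` (- {z}))"
  \<comment> \<open>The upper bound d for the toric ring of \<open>A\<close> leaves less than d for
    that of A'; by the lower bound, the columns of A' cannot span.\<close>
  have "\<not> enat CARD('d) \<le> krull_dim (toric_ring A (- {z}))"
  proof
    assume "enat CARD('d) \<le> krull_dim (toric_ring A (- {z}))"
    then have "enat CARD('d) + 1 \<le> krull_dim (toric_ring A UNIV)"
      unfolding dim by (rule add_right_mono)
    then have "enat CARD('d) + 1 \<le> enat CARD('d)"
      using krull_dim_toric_ring_le[of A] by (rule order_trans)
    then show False by (simp add: one_enat_def)
  qed
  then have "\<exists>y :: int ^ 'd. vec_of_int y \<notin> ?S"
    using krull_dim_toric_ring_ge[where J = "- {z}" and A = A] span_image_sum[of "- {z}" _ ?a]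
    by (auto simp: scalar_mult_eq_scaleR)
  then obtain y :: "int ^ 'd" where y: "vec_of_int y \<notin> ?S" by blast
  obtain c where c: "\<And>s. s \<in> ?S \<Longrightarrow> (\<Sum>i\<in>UNIV. c i * s $ i) = 0" "(\<Sum>i\<in>UNIV. c i * (vec_of_int y :: real ^ 'd) $ i) = 1"
    using separating_functional[OF vec.subspace_span y] by blast
  define k where "k j = (\<Sum>i\<in>UNIV. c i * of_int (A $ i $ j))" for j
  have k0: "k j = 0" if "j \<noteq> z" for j
    using c(1)[of "?a j"] that by (simp add: vec.span_base k_def vec_of_int_def column_def)
  obtain v where v: "A *v v = y" using range by (metis rangeE UNIV_I)
  \<comment> \<open>\<open>y\<close> is an integer combination of all columns and \<open>c\<close>
    vanishes on those of A', so the value 1 is due to column \<open>z\<close>.\<close>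
  have "1 = (\<Sum>i\<in>UNIV. c i * (\<Sum>j\<in>UNIV. of_int (A $ i $ j) * of_int (v $ j)))"
    using c(2) by (simp add: v[symmetric] vec_of_int_def matrix_vector_mult_def)
  also have "\<dots> = (\<Sum>j\<in>UNIV. k j * of_int (v $ j))"
    unfolding sum_distrib_left k_def sum_distrib_right by (subst sum.swap) (simp add: mult.assoc)
  also have "\<dots> = (\<Sum>j\<in>{z}. k j * of_int (v $ j))"
    by (rule sum.mono_neutral_right) (auto simp: k0)
  finally have "k z \<noteq> 0" by auto
  have "(\<Sum>i\<in>UNIV. c i / k z * of_int (A $ i $ j)) = k j / k z" for j
    by (simp add: k_def sum_divide_distrib)
  then show ?thesis using that[of "\<lambda>i. c i / k z"] k0 \<open>k z \<noteq> 0\<close> by simp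
qed

text \<open>The linear form \<open>c\<close> vanishes on the degrees of the toric ring of A', hence
  on their closure, which forces \<epsilon> = c . \<beta>. Conversely \<beta> - \<gamma>_z a_z lies
  in the span of A', and this span consists of quasi-degrees.\<close>

lemma line_locus_transversal:
  fixes A :: "int ^ 'n::finite ^ 'd::finite" and c :: "'d \<Rightarrow> complex"
  assumes c: "\<And>j. j \<noteq> z \<Longrightarrow> (\<Sum>i\<in>UNIV. c i * of_int (A $ i $ j)) = 0"
    "(\<Sum>i\<in>UNIV. c i * of_int (A $ i $ z)) = 1"
    and \<gamma>: "\<And>i. (\<Sum>j\<in>UNIV. of_int (A $ i $ j) * \<gamma> j) = \<beta> $ i"
  shows "line_locus A \<beta> z (qdeg_toric A (- {z})) = {\<Sum>i\<in>UNIV. c i * \<beta> $ i}"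
proof -
  let ?a = "\<lambda>j. vec_of_int (column j A) :: complex ^ 'd"
  let ?X = "{vec_of_int \<alpha> | \<alpha>. \<exists>y\<in>toric_component A (- {z}) \<alpha>. y \<noteq> \<zero>\<^bsub>toric_ring A (- {z})\<^esub>} :: (complex ^ 'd) set"
  have dot: "(\<Sum>i\<in>UNIV. c i * ?a j $ i) = (if j = z then 1 else 0)" for j
    using c by (simp add: vec_of_int_def column_def)
  have \<beta>: "\<beta> = (\<Sum>j\<in>UNIV. \<gamma> j *s ?a j)"
    by (simp add: vec_eq_iff \<gamma>[symmetric] vec_of_int_def column_def mult.commute)
  have dot_sum: "(\<Sum>i\<in>UNIV. c i * (\<Sum>j\<in>UNIV. g j *s ?a j) $ i) = g z" for g
  proof -
    have "(\<Sum>i\<in>UNIV. c i * (\<Sum>j\<in>UNIV. g j *s ?a j) $ i) = (\<Sum>j\<in>UNIV. g j * (\<Sum>i\<in>UNIV. c i * ?a j $ i))"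
      unfolding sum_component sum_distrib_left vector_smult_component
      by (subst sum.swap) (simp add: mult.left_commute)
    then show ?thesis by (simp add: dot if_distrib cong: if_cong)
  qed
  have cb: "(\<Sum>i\<in>UNIV. c i * \<beta> $ i) = \<gamma> z"
    by (subst \<beta>) (rule dot_sum)
  have X_mem: "vec_of_int (mono_degree A u) \<in> ?X" if u: "Poly_Mapping.keys u \<subseteq> - {z}" for u
  proof -
    have "mon u \<notin> toric_ideal A (- {z})"
    proof
      assume "mon u \<in> toric_ideal A (- {z})"
      then have "fib A (mono_degree A u) (mon u) = 0" unfolding toric_ideal_iff by blast
      then show False by (simp add: fib_def)
    qed
    then have "toric_class A (- {z}) (mon u) \<noteq> \<zero>\<^bsub>toric_ring A (- {z})\<^esub>"
      using toric_ring_simps(4)[OF single_mem_carrier[OF u, of 1] single_mem_carrier[OF u, of 1], of A]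
      by (simp add: toric_class_eq_iff)
    moreover have "toric_class A (- {z}) (mon u) \<in> toric_component A (- {z}) (mono_degree A u)"
      using single_mem_carrier[OF u, of 1] by (auto simp: toric_component_def)
    ultimately show ?thesis by blast
  qed
  have X_dot: "(\<Sum>i\<in>UNIV. c i * p $ i) = 0" if p: "p \<in> ?X" for p
  proof -
    obtain f \<alpha> where f: "p = vec_of_int \<alpha>" "f \<in> carrier (mpol_ring (- {z}))"
      "\<forall>u\<in>Poly_Mapping.keys f. mono_degree A u = \<alpha>" "toric_class A (- {z}) f \<noteq> \<zero>\<^bsub>toric_ring A (- {z})\<^esub>"
      using p by (auto simp: toric_component_def)
    then have "f \<noteq> 0" using toric_ring_simps(4)[OF f(2,2), of A] by auto
    then have "Poly_Mapping.keys f \<noteq> {}" using poly_mapping_sum_single[of f] by auto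
    then obtain u where u: "u \<in> Poly_Mapping.keys f" by blast
    then have "p = vec_of_int (mono_degree A u)" using f(1,3) by simp
    then have "p = (\<Sum>j\<in>UNIV. of_nat (Poly_Mapping.lookup u j) *s ?a j)"
      unfolding vec_of_int_mono_degree .
    then have "(\<Sum>i\<in>UNIV. c i * p $ i) = of_nat (Poly_Mapping.lookup u z)"
      by (simp only: dot_sum)
    then show ?thesis using u f(2) by (auto simp: carrier_mpol_ring in_keys_iff)
  qed
  have Q_dot: "(\<Sum>i\<in>UNIV. c i * q $ i) = 0" if "q \<in> zariski_closure ?X" for q
  proof -
    define f :: "'d mpol" where "f = (\<Sum>i\<in>UNIV. Poly_Mapping.single (Poly_Mapping.single i 1) (c i))"
    have ev: "mpol_eval f p = (\<Sum>i\<in>UNIV. c i * p $ i)" for p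
    proof -
      have mono: "(\<Prod>k\<in>UNIV. p $ k ^ Poly_Mapping.lookup (Poly_Mapping.single i (1::nat)) k) = p $ i" for i
      proof -
        have "(\<Prod>k\<in>UNIV. p $ k ^ Poly_Mapping.lookup (Poly_Mapping.single i (1::nat)) k) =
            (\<Prod>k\<in>UNIV. if k = i then p $ i else 1)"
          by (intro prod.cong) (auto simp: lookup_single)
        then show ?thesis by simp
      qed
      have "mpol_eval f p = lin_ext (\<lambda>u. \<Prod>k\<in>UNIV. p $ k ^ Poly_Mapping.lookup u k) f"
        by (simp add: mpol_eval_def lin_ext_def)
      then show ?thesis by (simp add: f_def lin_ext_sum mono del: One_nat_def)
    qed
    have "\<forall>x\<in>?X. mpol_eval f x = 0" unfolding ev using X_dot by blast
    then have "mpol_eval f q = 0" using that unfolding mem_zariski_closure_iff by blast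
    then show ?thesis by (simp only: ev)
  qed
  show ?thesis
    unfolding cb
  proof (intro equalityI subsetI)
    fix \<epsilon> assume "\<epsilon> \<in> line_locus A \<beta> z (qdeg_toric A (- {z}))"
    then obtain q where q: "q \<in> zariski_closure ?X" "\<epsilon> *s ?a z = - q + \<beta>"
      by (auto simp: line_locus_def qdeg_toric_def qdeg_def)
    have "(\<Sum>i\<in>UNIV. c i * (\<epsilon> *s ?a z) $ i) = \<epsilon> * (\<Sum>i\<in>UNIV. c i * ?a z $ i)"
      unfolding vector_smult_component sum_distrib_left by (simp add: mult.left_commute)
    moreover have "(\<Sum>i\<in>UNIV. c i * (- q + \<beta>) $ i) = \<gamma> z"
      using Q_dot[OF q(1)] cb by (simp add: right_diff_distrib sum_subtractf)
    ultimately show "\<epsilon> \<in> {\<gamma> z}" using q(2) dot[of z] by simp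
  next
    fix \<epsilon> assume "\<epsilon> \<in> {\<gamma> z}"
    define q where "q = vec_of_int (mono_degree A 0) + (\<Sum>j\<in>- {z}. \<gamma> j *s ?a j)"
    have "q \<in> zariski_closure ?X"
      unfolding q_def by (rule translate_in_zariski_closure, rule X_mem) simp
    moreover have "\<epsilon> *s ?a z = - q + \<beta>"
    proof -
      have "\<beta> = \<gamma> z *s ?a z + (\<Sum>j\<in>- {z}. \<gamma> j *s ?a j)"
        unfolding \<beta> by (subst sum.remove[of UNIV z]) (auto simp: Compl_eq_Diff_UNIV)
      moreover have "(vec_of_int 0 :: complex ^ 'd) = 0" by (simp add: vec_of_int_def vec_eq_iff)
      ultimately show ?thesis using \<open>\<epsilon> \<in> {\<gamma> z}\<close> by (simp add: q_def)
    qed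
    ultimately show "\<epsilon> \<in> line_locus A \<beta> z (qdeg_toric A (- {z}))"
      unfolding line_locus_def qdeg_toric_def qdeg_def by blast
  qed
qed

text \<open>The combination of the Euler operators with coefficients \<open>c\<close> is theta
  itself.\<close>

lemma linear_in_b_ideal:
  fixes A :: "int ^ 'n::finite ^ 'd::finite" and c :: "'d \<Rightarrow> complex"
  assumes c: "\<And>j. j \<noteq> z \<Longrightarrow> (\<Sum>i\<in>UNIV. c i * of_int (A $ i $ j)) = 0"
    "(\<Sum>i\<in>UNIV. c i * of_int (A $ i $ z)) = 1"
  shows "[:- (\<Sum>i\<in>UNIV. c i * \<beta> $ i), 1:] \<in> b_ideal A \<beta> z"
proof -
  have gen: "(\<lambda>f. euler A i f - cst (\<beta> $ i) * f) \<in> hyp_ideal A \<beta>" for i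
    unfolding hyp_ideal_def by (rule left_ideal_base) auto
  have "(\<lambda>f. \<Sum>i\<in>UNIV. cst (c i) * (euler A i f - cst (\<beta> $ i) * f)) \<in> hyp_V A \<beta> z"
    by (rule hyp_V_sum, rule hyp_V_stable[OF V_stable_cst], rule hyp_ideal_subset_hyp_V, rule gen)
  moreover have "(\<Sum>i\<in>UNIV. cst (c i) * (euler A i f - cst (\<beta> $ i) * f)) =
      oper_poly [:- (\<Sum>i\<in>UNIV. c i * \<beta> $ i), 1:] (theta z) f" for f
  proof -
    have "(\<Sum>i\<in>UNIV. cst (c i) * euler A i f) = theta z f"
      using sum_euler_eq[of "- {z}" c A z f] c by simp
    moreover have "(\<Sum>i\<in>UNIV. cst (c i) * (cst (\<beta> $ i) * f)) = cst (\<Sum>i\<in>UNIV. c i * \<beta> $ i) * f"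
      by (simp add: single_sum sum_distrib_right mult_single flip: mult.assoc)
    ultimately show ?thesis
      by (simp add: right_diff_distrib sum_subtractf oper_poly_pCons[OF theta_linear] single_uminus
          mpol_linearD[OF theta_linear])
  qed
  ultimately show ?thesis by (simp add: b_ideal_iff)
qed

text \<open>\<open>b\<close> divides the linear polynomial of \<open>linear_in_b_ideal\<close>, and
  it is not constant by \<open>one_notin_b_ideal\<close>.\<close>

lemma b_function_transversal:
  fixes A :: "int ^ 'n::finite ^ 'd::finite" and c :: "'d \<Rightarrow> complex"
  assumes b: "is_b_function A \<beta> z b" and range: "range (\<lambda>v. A *v v) = UNIV"
    and c: "\<And>j. j \<noteq> z \<Longrightarrow> (\<Sum>i\<in>UNIV. c i * of_int (A $ i $ j)) = 0"
    "(\<Sum>i\<in>UNIV. c i * of_int (A $ i $ z)) = 1"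
  shows "degree b = 1" "{\<epsilon>. poly b \<epsilon> = 0} = line_locus A \<beta> z (qdeg_toric A (- {z}))"
proof -
  define \<gamma>0 where "\<gamma>0 = (\<Sum>i\<in>UNIV. c i * \<beta> $ i)"

  have "\<exists>v. \<forall>i. A *v v i = axis i 1"
    using range by (intro choice allI) (metis rangeE UNIV_I)
  then obtain v where v: "\<And>i. A *v v i = axis i 1" by blast
  \<comment> \<open>Integer preimages of the unit vectors, weighted by \<open>\<beta>\<close>, give
    a complex solution of A \<gamma> = \<beta>.\<close>
  define \<gamma> where "\<gamma> j = (\<Sum>k\<in>UNIV. \<beta> $ k * of_int (v k $ j))" for j
  have \<gamma>: "(\<Sum>j\<in>UNIV. of_int (A $ i $ j) * \<gamma> j) = \<beta> $ i" for i
  proof -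
    have "(\<Sum>j\<in>UNIV. of_int (A $ i $ j) * \<gamma> j) = (\<Sum>k\<in>UNIV. \<beta> $ k * of_int ((A *v v k) $ i))"
      unfolding \<gamma>_def sum_distrib_left matrix_vector_mult_def
      by (subst sum.swap) (simp add: sum_distrib_left mult.left_commute)
    also have "\<dots> = (\<Sum>k\<in>UNIV. if k = i then \<beta> $ i else 0)"
      unfolding v by (intro sum.cong) (auto simp: axis_def)
    finally show ?thesis by simp
  qed
  \<comment> \<open>Applying \<open>c\<close> to A w = 0 leaves only the entry of \<open>w\<close>
    at \<open>z\<close>.\<close>
  have ker: "w $ z = 0" if "A *v w = 0" for w
  proof -
    have Aw: "(\<Sum>j\<in>UNIV. of_int (A $ i $ j) * of_int (w $ j)) = (0 :: complex)" for i
    proof -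
      have "(\<Sum>j\<in>UNIV. A $ i $ j * w $ j) = 0"
        using arg_cong[OF that, of "\<lambda>v. v $ i"] by (simp add: matrix_vector_mult_def)
      then show ?thesis by (metis (no_types, lifting) of_int_0 of_int_mult of_int_sum sum.cong)
    qed
    have "0 = (\<Sum>i\<in>UNIV. c i * (\<Sum>j\<in>UNIV. of_int (A $ i $ j) * of_int (w $ j)))"
      by (simp add: Aw)
    also have "\<dots> = (\<Sum>j\<in>UNIV. (\<Sum>i\<in>UNIV. c i * of_int (A $ i $ j)) * of_int (w $ j))"
      unfolding sum_distrib_left sum_distrib_right by (subst sum.swap) (simp add: mult.assoc)
    also have "\<dots> = (\<Sum>j\<in>{z}. (\<Sum>i\<in>UNIV. c i * of_int (A $ i $ j)) * of_int (w $ j))"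
      by (rule sum.mono_neutral_right) (auto simp: c(1))
    finally show ?thesis by (simp add: c(2))
  qed
  have "[:- \<gamma>0, 1:] \<in> b_ideal A \<beta> z"
    unfolding \<gamma>0_def by (rule linear_in_b_ideal[OF c])
  then have dvd: "b dvd [:- \<gamma>0, 1:]" by (rule is_b_function_dvd[OF b])
  then have "degree b \<le> 1" using dvd_imp_degree_le[OF dvd] by simp
  moreover have "degree b \<noteq> 0"
  proof
    assume "degree b = 0"
    then have "b = 1" using b by (auto simp: is_b_function_def elim!: degree_eq_zeroE)
    then show False using b one_notin_b_ideal[OF \<gamma> ker] by (simp add: is_b_function_def)
  qed
  ultimately show deg: "degree b = 1" by simp
  obtain k where k: "[:- \<gamma>0, 1:] = b * k" using dvd by (blast elim: dvdE)
  then have "b \<noteq> 0" "k \<noteq> 0" by auto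
  then have "degree k = 0" using deg arg_cong[OF k, of degree] by (simp add: degree_mult_eq)
  then obtain a where "k = [:a:]" by (blast elim: degree_eq_zeroE)
  then have \<gamma>0: "poly b \<gamma>0 = 0"
    using \<open>k \<noteq> 0\<close> arg_cong[OF k, of "\<lambda>p. poly p \<gamma>0"] by simp
  have "\<epsilon> = \<gamma>0" if "poly b \<epsilon> = 0" for \<epsilon>
    using dvd that by (auto elim!: dvdE dest: arg_cong[of _ _ "\<lambda>p. poly p \<epsilon>"])
  then have "{\<epsilon>. poly b \<epsilon> = 0} = {\<gamma>0}" using \<gamma>0 by blast
  moreover have "line_locus A \<beta> z (qdeg_toric A (- {z})) = {\<gamma>0}"
    unfolding \<gamma>0_def by (rule line_locus_transversal[OF c \<gamma>])
  ultimately show "{\<epsilon>. poly b \<epsilon> = 0} = line_locus A \<beta> z (qdeg_toric A (- {z}))" by simp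
qed

theorem theorem3p4:
  fixes A :: "int ^ 'n::finite ^ 'd::finite" and z :: 'n
    and \<beta> :: "complex ^ 'd" and b :: "complex poly"
  assumes "CARD('d) \<le> CARD('n)"
    and "range (\<lambda>v. A *v v) = UNIV"
    and "is_b_function A \<beta> z b"
  shows
    "(\<forall>\<epsilon>. poly b \<epsilon> = 0 \<longrightarrow>
        \<epsilon> \<in> \<nat> \<or> \<epsilon> \<in> line_locus A \<beta> z (qdeg_toric_quot A (- {z}) (J_bar A z))) \<and>
     (\<forall>k. J_ideal A z = J_sum A z {1..k} \<longrightarrow>
        (\<forall>\<epsilon>. poly b \<epsilon> = 0 \<longrightarrow>
          \<epsilon> \<in> of_nat ` {0..<k} \<or>
          \<epsilon> \<in> line_locus A \<beta> z (qdeg_toric_quot A (- {z}) (J_bar A z)))) \<and>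
     (krull_dim (toric_ring A UNIV) = krull_dim (toric_ring A (- {z})) + 1 \<longrightarrow>
        degree b = 1 \<and> {\<epsilon>. poly b \<epsilon> = 0} = line_locus A \<beta> z (qdeg_toric A (- {z}))) \<and>
     ((vec_of_int (column z A) :: real ^ 'd) \<in> real_cone A (- {z}) \<longrightarrow>
        {\<epsilon>. poly b \<epsilon> = 0} \<subseteq>
          of_nat ` {0..<(LEAST t. 1 \<le> t \<and> int t *s column z A \<in> semigroup_of A (- {z}))})"
proof (intro conjI allI impI)
  fix \<epsilon> assume \<epsilon>: "poly b \<epsilon> = 0"
  show "\<epsilon> \<in> \<nat> \<or> \<epsilon> \<in> line_locus A \<beta> z (qdeg_toric_quot A (- {z}) (J_bar A z))"
    \<comment> \<open>\<open>J_ideal_def\<close> supplies all k \<ge> 1 as indices; the exceptional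
      set is then \<open>\<nat>\<close>.\<close>
    by (rule b_function_roots[OF assms(3) \<epsilon> J_ideal_def]) auto
next
  fix k \<epsilon> assume k: "J_ideal A z = J_sum A z {1..k}" and \<epsilon>: "poly b \<epsilon> = 0"
  show "\<epsilon> \<in> of_nat ` {0..<k} \<or> \<epsilon> \<in> line_locus A \<beta> z (qdeg_toric_quot A (- {z}) (J_bar A z))"
    by (rule b_function_roots[OF assms(3) \<epsilon> k]) auto
next
  assume "krull_dim (toric_ring A UNIV) = krull_dim (toric_ring A (- {z})) + 1"
  then obtain c :: "'d \<Rightarrow> real" where c: "\<And>j. j \<noteq> z \<Longrightarrow> (\<Sum>i\<in>UNIV. c i * of_int (A $ i $ j)) = 0"
    "(\<Sum>i\<in>UNIV. c i * of_int (A $ i $ z)) = 1"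
    using transversal_functional[OF assms(2)] by blast
  \<comment> \<open>The functional was found over the reals; its values on the integer columns carry
    over to the complex numbers.\<close>
  have cc: "(\<Sum>i\<in>UNIV. complex_of_real (c i) * of_int (A $ i $ j)) =
      complex_of_real (\<Sum>i\<in>UNIV. c i * of_int (A $ i $ j))" for j
    by simp
  have c0: "(\<Sum>i\<in>UNIV. complex_of_real (c i) * of_int (A $ i $ j)) = 0" if "j \<noteq> z" for j
    unfolding cc c(1)[OF that] by simp
  have c1: "(\<Sum>i\<in>UNIV. complex_of_real (c i) * of_int (A $ i $ z)) = 1"
    unfolding cc c(2) by simp
  show "degree b = 1"
    "{\<epsilon>. poly b \<epsilon> = 0} = line_locus A \<beta> z (qdeg_toric A (- {z}))"
    using b_function_transversal[OF assms(3,2) c0 c1] by simp_all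
next
  assume "(vec_of_int (column z A) :: real ^ 'd) \<in> real_cone A (- {z})"
  then show "{\<epsilon>. poly b \<epsilon> = 0} \<subseteq>
      of_nat ` {0..<(LEAST t. 1 \<le> t \<and> int t *s column z A \<in> semigroup_of A (- {z}))}"
    using b_function_roots_cone[OF assms(3)] by blast
qed

end
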